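(* Let $\alpha\in\mathbb{R}$, $1<p_0<p,q<\infty$ (that is, $1<p_0<p<\infty$ and $p_0<q<\infty$), $0<\lambda<\min\{\alpha+n/p,\alpha+m/p\}$, and $$\max\left\{-\frac np,-\frac mp\right\}<\alpha<\min\left\{n\left(\frac1{p_0}-\frac1p\right),m\left(\frac1{p_0}-\frac1p\right)\right\}.$$ Then the strong maximal operator $M_S$ is bounded on $M\vec{\dot K}_{p,q}^{\alpha,\lambda}(\mathbb{R}^n\times\mathbb{R}^m)$. Moreover, there is a constant $C>0$ such that for all sequences $(f_i)_{i\in\mathbb{N}}$ in $M\vec{\dot K}_{p,q}^{\alpha,\lambda}(\mathbb{R}^n\times\mathbb{R}^m)$, $$\left\|\Big(\sum_{i\in\mathbb{N}}|M_Sf_i|^{p_0}\Big)^{1/p_0}\right\|_{M\vec{\dot K}_{p,q}^{\alpha,\lambda}(\mathbb{R}^n\times\mathbb{R}^m)}\le C\left\|\Big(\sum_{i\in\mathbb{N}}|f_i|^{p_0}\Big)^{1/p_0}\right\|_{M\vec{\dot K}_{p,q}^{\alpha,\lambda}(\mathbb{R}^n\times\mathbb{R}^m)}.$$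
   Context: $n,m$ are positive integers. For $x\in\mathbb{R}^d$, $r>0$, $Q(x,r)$ is the cube centered at $x$ with side length $r$; $\mathcal{R}$ is the set of all $Q(x,r)\times Q(y,s)$, $x\in\mathbb{R}^n$, $y\in\mathbb{R}^m$, $r,s>0$. The strong maximal operator is $M_Sf(z)=\sup_{z\in R\in\mathcal{R}}\frac1{|R|}\int_R|f(z')|\,dz'$. For $k\in\mathbb{Z}$, $Q_k=Q(0,2^k)$ (in $\mathbb{R}^n$ or $\mathbb{R}^m$); $R_{i,j}=Q_i\times Q_j$; $I_i=Q_i\setminus Q_{i-1}\subset\mathbb{R}^n$, $J_j=Q_j\setminus Q_{j-1}\subset\mathbb{R}^m$; $\chi_{i,j}$ is the characteristic function of $I_i\times J_j$. For measurable $f$ (norms may be $+\infty$), $$\|f\|_{\vec{\dot K}_{p,q}^{\alpha}}=\Big(\sum_{i,j\in\mathbb{Z}}2^{(i+j)q\alpha}\|f\chi_{i,j}\|_{L^p(\mathbb{R}^n\times\mathbb{R}^m)}^q\Big)^{1/q},\qquad \|f\|_{M\vec{\dot K}_{p,q}^{\alpha,\lambda}}=\sup_{L_1,L_2\in\mathbb{Z}}2^{-(L_1+L_2)\lambda}\|f\chi_{R_{L_1,L_2}}\|_{\vec{\dot K}_{p,q}^{\alpha}}.$$ The product Morrey-Herz space $M\vec{\dot K}_{p,q}^{\alpha,\lambda}$ consists of all $f\in L^p_{\mathrm{loc}}((\mathbb{R}^n\setminus\{0\})\times(\mathbb{R}^m\setminus\{0\}))$ with $\|f\|_{M\vec{\dot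 K}_{p,q}^{\alpha,\lambda}}<\infty$. *)

theory Defs
  imports "HOL-Analysis.Analysis"
begin

text \<open>
  The Euclidean spaces of dimension \<open>n\<close> and \<open>m\<close> are \<open>real ^ 'n\<close> and \<open>real ^ 'm\<close>, with
  \<open>n = CARD('n)\<close> and \<open>m = CARD('m)\<close>.  Norms may be infinite, and so may the values of
  \<open>M\<^sub>S f\<close> and of \<open>(\<Sum>i. |f i| powr p0) powr (1 / p0)\<close>.  All the norms depend on the modulus of
  a function only, so they are defined for functions with values in \<open>[0, \<infinity>]\<close>; the spaces
  consist of complex-valued Lebesgue measurable functions.
\<close>

text \<open>Powers on \<open>[0, \<infinity>]\<close>; intended for exponents \<open>a > 0\<close> only, where \<open>\<infinity>\<close> is mapped to \<open>\<infinity>\<close>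
  and \<open>0\<close> to \<open>0\<close>.\<close>

definition enn_powr :: "ennreal \<Rightarrow> real \<Rightarrow> ennreal" where
  "enn_powr x a = (if x = \<infinity> then \<infinity> else ennreal (enn2real x powr a))"

definition modulus :: "('a \<Rightarrow> complex) \<Rightarrow> 'a \<Rightarrow> ennreal" where
  "modulus f z = ennreal (cmod (f z))"

text \<open>Cubes have sides parallel to the axes and are taken open, with side length \<open>r\<close>.
  Closed cubes would give the same maximal function at every point, and dyadic shells that
  differ from these by null sets.\<close>

definition cube :: "real ^ 'd \<Rightarrow> real \<Rightarrow> (real ^ 'd) set" where
  "cube x r = {y. \<forall>i. \<bar>y $ i - x $ i\<bar> < r / 2}"

definition rectangles :: "((real ^ 'n) \<times> (real ^ 'm)) set set" where
  "rectangles = {cube x r \<times> cube y s | x y r s. r > 0 \<and> s > 0}"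

definition strong_maximal ::
    "((real ^ 'n) \<times> (real ^ 'm) \<Rightarrow> complex) \<Rightarrow> (real ^ 'n) \<times> (real ^ 'm) \<Rightarrow> ennreal" where
  "strong_maximal f z =
     (SUP R \<in> {R \<in> rectangles. z \<in> R}.
        (\<integral>\<^sup>+ w. modulus f w * indicator R w \<partial>lebesgue) / emeasure lebesgue R)"

definition dyadic_cube :: "int \<Rightarrow> (real ^ 'd) set" where
  "dyadic_cube k = cube 0 (2 powi k)"

definition dyadic_rectangle :: "int \<Rightarrow> int \<Rightarrow> ((real ^ 'n) \<times> (real ^ 'm)) set" where
  "dyadic_rectangle i j = dyadic_cube i \<times> dyadic_cube j"

text \<open>\<open>I\<^sub>k\<close> in \<open>real ^ 'n\<close> and \<open>J\<^sub>k\<close> in \<open>real ^ 'm\<close>\<close>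

definition shell :: "int \<Rightarrow> (real ^ 'd) set" where
  "shell k = dyadic_cube k - dyadic_cube (k - 1)"

definition Lp_norm :: "real \<Rightarrow> ((real ^ 'n) \<times> (real ^ 'm) \<Rightarrow> ennreal) \<Rightarrow> ennreal" where
  "Lp_norm p g = enn_powr (\<integral>\<^sup>+ z. enn_powr (g z) p \<partial>lebesgue) (1 / p)"

definition product_herz_norm ::
    "real \<Rightarrow> real \<Rightarrow> real \<Rightarrow> ((real ^ 'n) \<times> (real ^ 'm) \<Rightarrow> ennreal) \<Rightarrow> ennreal" where
  "product_herz_norm p q \<alpha> g =
     enn_powr
       (\<Sum>\<^sub>\<infinity>(i, j) \<in> (UNIV :: (int \<times> int) set).
          ennreal (2 powr (of_int (i + j) * q * \<alpha>)) *
          enn_powr (Lp_norm p (\<lambda>z. g z * indicator (shell i \<times> shell j) z)) q)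
       (1 / q)"

definition product_morrey_herz_norm ::
    "real \<Rightarrow> real \<Rightarrow> real \<Rightarrow> real \<Rightarrow> ((real ^ 'n) \<times> (real ^ 'm) \<Rightarrow> ennreal) \<Rightarrow> ennreal" where
  "product_morrey_herz_norm p q \<alpha> lam g =
     (SUP (L1, L2) \<in> (UNIV :: (int \<times> int) set).
        ennreal (2 powr (- of_int (L1 + L2) * lam)) *
        product_herz_norm p q \<alpha> (\<lambda>z. g z * indicator (dyadic_rectangle L1 L2) z))"

text \<open>\<open>L\<^sup>p\<close> on compact subsets of the domain with both coordinate subspaces removed.  The removed
  set is null, so total measurable functions represent all elements.\<close>

definition Lp_loc ::
    "real \<Rightarrow> ((real ^ 'n) \<times> (real ^ 'm) \<Rightarrow> complex) set" where
  "Lp_loc p = {f \<in> borel_measurable lebesgue.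
     \<forall>K. compact K \<and> K \<subseteq> (UNIV - {0}) \<times> (UNIV - {0}) \<longrightarrow>
       Lp_norm p (\<lambda>z. modulus f z * indicator K z) < \<infinity>}"

definition product_morrey_herz ::
    "real \<Rightarrow> real \<Rightarrow> real \<Rightarrow> real \<Rightarrow> ((real ^ 'n) \<times> (real ^ 'm) \<Rightarrow> complex) set" where
  "product_morrey_herz p q \<alpha> lam =
     {f \<in> Lp_loc p. product_morrey_herz_norm p q \<alpha> lam (modulus f) < \<infinity>}"

text \<open>Membership of a \<open>[0, \<infinity>]\<close>-valued function in the space: it is finite almost everywhere,
  and the complex-valued function it then represents (with \<open>\<infinity>\<close> replaced by \<open>0\<close> on a null set)
  is in the space.\<close>

definition ext_in_product_morrey_herz ::
    "real \<Rightarrow> real \<Rightarrow> real \<Rightarrow> real \<Rightarrow> ((real ^ 'n) \<times> (real ^ 'm) \<Rightarrow> ennreal) \<Rightarrow> bool" where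
  "ext_in_product_morrey_herz p q \<alpha> lam g \<longleftrightarrow>
     (AE z in lebesgue. g z < \<infinity>) \<and>
     (\<lambda>z. complex_of_real (enn2real (g z))) \<in> product_morrey_herz p q \<alpha> lam"

definition lp_sum :: "real \<Rightarrow> (nat \<Rightarrow> 'a \<Rightarrow> ennreal) \<Rightarrow> 'a \<Rightarrow> ennreal" where
  "lp_sum p0 g z = enn_powr (\<Sum>i. enn_powr (g i z) p0) (1 / p0)"

end

theory Submission
  imports Defs
begin

text \<open>
  For Borel functions, \<open>M\<^sub>S f\<close> is dominated by the composition of the cube maximal operators in the
  two variables, so the weighted Fefferman--Stein inequality, used once in each variable, gives
  \<open>\<integral> (M\<^sub>2 M\<^sub>1 f)\<^sup>s u \<le> C \<integral> f\<^sup>s M\<^sub>1 M\<^sub>2 u\<close>.  By duality this reduces the vector-valued estimate between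
  two dyadic blocks to a scalar one: if \<open>u\<close> lives on \<open>I\<^sub>k \<times> J\<^sub>l\<close>, then the \<open>L\<^sup>s\<close> norm of \<open>M\<^sub>1 M\<^sub>2 u\<close> on
  \<open>I\<^sub>i \<times> J\<^sub>j\<close>, where \<open>s\<close> is conjugate to \<open>p / p0\<close>, decays geometrically in \<open>k - i\<close> and \<open>l - j\<close>.
  Raised to the power \<open>1 / p0\<close>, this decay has the rates \<open>n (1 / p0 - 1 / p)\<close> for \<open>k > i\<close> and \<open>n / p\<close>
  for \<open>k < i\<close>, which are the bounds imposed on \<open>\<alpha>\<close> and \<open>\<lambda>\<close>.  Splitting \<open>f\<close> into blocks, Minkowski's
  inequality in \<open>\<ell>\<close>-\<open>p0\<close>, \<open>L\<^sup>p\<close> and \<open>\<ell>\<^sup>q\<close> bounds the Morrey--Herz norm by a convolution with a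
  summable kernel.
\<close>

section \<open>Powers and inequalities on the extended half-line\<close>

text \<open>The weighted inequality stands in for a direct vector-valued theorem: for a fixed weight
  it is linear in the p0-th powers of the functions, so it can be summed over the whole sequence
  without loss, and only one scalar weight remains to be estimated. Duality exchanges source and
  target, which is why the decay is measured for a weight living on the target block and evaluated
  on the source block. Two measure-theoretic obstacles shape the rest. A section of a Lebesgue
  measurable function may fail to be measurable, so the functions are replaced by Borel
  representatives; these are also set to zero on the coordinate subspaces, because the shells do not
  cover the origin. The one-variable maximal operator is taken over cubes with rational centre and
  side, a countable supremum, at the price of a factor 2^d. The Morrey supremum costs nothing: a
  shift of the blocks shifts the quadrant of blocks inside a dyadic rectangle, and the resulting
  powers of \<open>2 powr (- lam)\<close> join the convolution kernel.\<close>

lemma enn_powr_0 [simp]: "enn_powr 0 a = 0"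
  by (simp add: enn_powr_def)

lemma enn_powr_top [simp]: "enn_powr top a = top"
  by (simp add: enn_powr_def)

lemma enn_powr_1 [simp]: "enn_powr 1 a = 1"
  by (simp add: enn_powr_def)

lemma enn_powr_one [simp]: "enn_powr x 1 = x"
  by (cases x) (auto simp: enn_powr_def)

lemma enn_powr_ennreal: "0 \<le> x \<Longrightarrow> enn_powr (ennreal x) a = ennreal (x powr a)"
  by (simp add: enn_powr_def)

lemma enn_powr_mono: "x \<le> y \<Longrightarrow> 0 \<le> a \<Longrightarrow> enn_powr x a \<le> enn_powr y a"
  by (cases x; cases y) (auto simp: enn_powr_def top_unique intro!: ennreal_leI powr_mono2)

lemma enn_powr_mult: "0 < a \<Longrightarrow> enn_powr (x * y) a = enn_powr x a * enn_powr y a"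
proof (cases x; cases y)
  fix r s assume "0 < a" "0 \<le> r" "x = ennreal r" "0 \<le> s" "y = ennreal s"
  then show ?thesis
    by (simp add: enn_powr_def ennreal_mult[symmetric] powr_mult del: ennreal_mult)
qed (auto simp: enn_powr_def ennreal_top_mult ennreal_mult_top powr_eq_0_iff)

lemma enn_powr_powr: "enn_powr (enn_powr x a) b = enn_powr x (a * b)"
  by (cases x) (auto simp: enn_powr_def powr_powr)

lemma enn_powr_add: "0 < a \<Longrightarrow> 0 < b \<Longrightarrow> enn_powr x (a + b) = enn_powr x a * enn_powr x b"
  by (cases x) (auto simp: enn_powr_def powr_add ennreal_mult ennreal_top_mult)

lemma enn_powr_inverse1 [simp]: "a \<noteq> 0 \<Longrightarrow> enn_powr (enn_powr x a) (1 / a) = x"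
  by (simp add: enn_powr_powr)

lemma enn_powr_inverse2 [simp]: "a \<noteq> 0 \<Longrightarrow> enn_powr (enn_powr x (1 / a)) a = x"
  by (simp add: enn_powr_powr)

lemma enn_powr_le_iff: "0 < a \<Longrightarrow> enn_powr x a \<le> y \<longleftrightarrow> x \<le> enn_powr y (1 / a)"
  using enn_powr_mono[of "enn_powr x a" y "1 / a"] enn_powr_mono[of x "enn_powr y (1 / a)" a]
  by auto

lemma enn_powr_eq_0_iff [simp]: "enn_powr x a = 0 \<longleftrightarrow> x = 0"
  by (cases x) (auto simp: enn_powr_def)

lemma enn_powr_eq_top_iff [simp]: "enn_powr x a = top \<longleftrightarrow> x = top"
  by (cases x) (auto simp: enn_powr_def)

lemma enn_powr_less_top_iff [simp]: "enn_powr x a < top \<longleftrightarrow> x < top"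
  by (simp only: less_top[symmetric] enn_powr_eq_top_iff)

lemma enn_powr_measurable [measurable (raw)]:
  assumes "f \<in> borel_measurable M" shows "(\<lambda>x. enn_powr (f x) a) \<in> borel_measurable M"
proof -
  have [measurable]: "(\<lambda>x. enn_powr x a) \<in> borel_measurable borel"
    unfolding enn_powr_def by measurable
  show ?thesis using assms by measurable
qed

text \<open>A positive power is an order isomorphism of \<open>[0, \<infinity>]\<close> with inverse
  the power \<open>1 / a\<close>, so it commutes with suprema.\<close>

lemma enn_powr_SUP:
  assumes "0 < a"
  shows "enn_powr (SUP i\<in>I. f i) a = (SUP i\<in>I. enn_powr (f i) a)"
proof (rule antisym)
  show "enn_powr (SUP i\<in>I. f i) a \<le> (SUP i\<in>I. enn_powr (f i) a)"
    unfolding enn_powr_le_iff[OF assms]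
    by (rule SUP_least) (auto simp flip: enn_powr_le_iff[OF assms] intro: SUP_upper)
  show "(SUP i\<in>I. enn_powr (f i) a) \<le> enn_powr (SUP i\<in>I. f i) a"
    using assms by (auto intro!: SUP_least enn_powr_mono SUP_upper)
qed

section \<open>Hoelder and Minkowski inequalities for functions with values in the extended
  half-line\<close>

lemma powr_convex_combination:
  fixes u v \<theta> q :: real
  assumes "1 \<le> q" "0 \<le> u" "0 \<le> v" "0 \<le> \<theta>" "\<theta> \<le> 1"
  shows "(\<theta> * u + (1 - \<theta>) * v) powr q \<le> \<theta> * u powr q + (1 - \<theta>) * v powr q"
proof -
  \<comment> \<open>If \<open>u\<close> or \<open>v\<close> vanishes, this bound applied to the
    surviving coefficient is the whole claim; convexity of the power is used only for positive
    arguments.\<close>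
  have le: "t powr q \<le> t" if "0 \<le> t" "t \<le> 1" for t :: real
    using that assms powr_mono'[of 1 q t] by (cases "t = 0") auto
  consider "u = 0" | "v = 0" | "0 < u" "0 < v" using assms by linarith
  then show ?thesis
  proof cases
    case 1
    then show ?thesis using assms le[of "1 - \<theta>"] by (auto simp: powr_mult intro: mult_right_mono)
  next
    case 2
    then show ?thesis using assms le[of \<theta>] by (auto simp: powr_mult intro: mult_right_mono)
  next
    case 3
    then show ?thesis
      using convex_onD[OF powr_convex[OF assms(1)], of "1 - \<theta>" u v] assms by simp
  qed
qed

text \<open>The measure is a parameter so that a single set of inequalities serves L^p over
  \<open>lborel\<close> and the sequence spaces over \<open>count_space\<close>.\<close>

definition Lq :: "'a measure \<Rightarrow> real \<Rightarrow> ('a \<Rightarrow> ennreal) \<Rightarrow> ennreal" where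
  "Lq M q f = enn_powr (\<integral>\<^sup>+ x. enn_powr (f x) q \<partial>M) (1 / q)"

lemma Lq_mono_AE: "0 < q \<Longrightarrow> AE x in M. f x \<le> g x \<Longrightarrow> Lq M q f \<le> Lq M q g"
  unfolding Lq_def by (intro enn_powr_mono nn_integral_mono_AE) (auto elim!: eventually_mono simp: enn_powr_mono)

lemma Lq_mono: "0 < q \<Longrightarrow> (\<And>x. x \<in> space M \<Longrightarrow> f x \<le> g x) \<Longrightarrow> Lq M q f \<le> Lq M q g"
  by (intro Lq_mono_AE) auto

lemma Lq_cong_AE: "AE x in M. f x = g x \<Longrightarrow> Lq M q f = Lq M q g"
  unfolding Lq_def
  by (intro arg_cong[where f = "\<lambda>x. enn_powr x (1 / q)"] nn_integral_cong_AE) auto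

lemma Lq_powr: "0 < q \<Longrightarrow> enn_powr (Lq M q f) q = (\<integral>\<^sup>+ x. enn_powr (f x) q \<partial>M)"
  by (simp add: Lq_def)

lemma Lq_cmult:
  assumes "0 < q" "f \<in> borel_measurable M"
  shows "Lq M q (\<lambda>x. c * f x) = c * Lq M q f"
  using assms by (simp add: Lq_def enn_powr_mult nn_integral_cmult)

lemma Lq_0 [simp]: "Lq M q (\<lambda>x. 0) = 0"
  by (simp add: Lq_def)

lemma Lq_eq_0_iff:
  "0 < q \<Longrightarrow> f \<in> borel_measurable M \<Longrightarrow> Lq M q f = 0 \<longleftrightarrow> (AE x in M. f x = 0)"
  by (simp add: Lq_def nn_integral_0_iff_AE)

lemma Youngs_inequality_ennreal:
  fixes x y :: ennreal
  assumes "1 < r" "1 < s" "1 / r + 1 / s = 1"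
  shows "x * y \<le> ennreal (1 / r) * enn_powr x r + ennreal (1 / s) * enn_powr y s"
proof (cases x; cases y)
  fix a b assume "0 \<le> a" "x = ennreal a" "0 \<le> b" "y = ennreal b"
  then show ?thesis
    using Youngs_inequality[OF assms, of a b] assms
    by (simp add: enn_powr_ennreal ennreal_leI flip: ennreal_mult ennreal_plus)
qed (use assms in \<open>auto simp: ennreal_mult_top\<close>)

lemma Lq_normalize:
  assumes "0 < q" "f \<in> borel_measurable M" "Lq M q f = ennreal a" "0 < a"
  shows "(\<integral>\<^sup>+ x. enn_powr (ennreal (1 / a) * f x) q \<partial>M) = 1"
proof -
  have "Lq M q (\<lambda>x. ennreal (1 / a) * f x) = 1"
    using assms by (simp add: Lq_cmult flip: ennreal_mult)
  then show ?thesis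
    using Lq_powr[OF assms(1), of M "\<lambda>x. ennreal (1 / a) * f x"] by simp
qed

text \<open>After division by the two norms, Young's inequality integrates to 1 / r + 1 / s =
  1.\<close>

lemma Holder_inequality_nn_integral:
  assumes [measurable]: "f \<in> borel_measurable M" "g \<in> borel_measurable M"
  assumes r: "1 < r" "1 < s" "1 / r + 1 / s = 1"
  shows "(\<integral>\<^sup>+ x. f x * g x \<partial>M) \<le> Lq M r f * Lq M s g"
proof -
  \<comment> \<open>A zero norm makes the integrand vanish almost everywhere, and an infinite norm
    beside a nonzero one makes the right-hand side infinite. Only finite positive norms are left, by
    which one may divide.\<close>
  consider "Lq M r f = 0" | "Lq M s g = 0" | "Lq M r f = \<infinity>" "Lq M s g \<noteq> 0"
    | "Lq M s g = \<infinity>" "Lq M r f \<noteq> 0"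
    | a b where "Lq M r f = ennreal a" "Lq M s g = ennreal b" "0 < a" "0 < b"
    by (cases "Lq M r f"; cases "Lq M s g") (auto simp: less_le)
  then show ?thesis
  proof cases
    case 1
    then have "AE x in M. f x = 0" using r by (simp add: Lq_eq_0_iff)
    then have "AE x in M. f x * g x = 0" by eventually_elim simp
    then have "(\<integral>\<^sup>+ x. f x * g x \<partial>M) = 0" by (simp add: nn_integral_0_iff_AE)
    then show ?thesis by simp
  next
    case 2
    then have "AE x in M. g x = 0" using r by (simp add: Lq_eq_0_iff)
    then have "AE x in M. f x * g x = 0" by eventually_elim simp
    then have "(\<integral>\<^sup>+ x. f x * g x \<partial>M) = 0" by (simp add: nn_integral_0_iff_AE)
    then show ?thesis by simp
  next
    case 5
    let ?f = "\<lambda>x. ennreal (1 / a) * f x" and ?g = "\<lambda>x. ennreal (1 / b) * g x"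
    have "(\<integral>\<^sup>+ x. ?f x * ?g x \<partial>M)
      \<le> (\<integral>\<^sup>+ x. ennreal (1 / r) * enn_powr (?f x) r + ennreal (1 / s) * enn_powr (?g x) s \<partial>M)"
      by (intro nn_integral_mono Youngs_inequality_ennreal r)
    also have "\<dots> = ennreal (1 / r) + ennreal (1 / s)"
      using 5 r by (simp add: nn_integral_add nn_integral_cmult Lq_normalize)
    also have "\<dots> = 1"
      using r by (simp flip: ennreal_plus)
    finally have *: "(\<integral>\<^sup>+ x. ?f x * ?g x \<partial>M) \<le> 1" .
    have "(\<integral>\<^sup>+ x. f x * g x \<partial>M) = (\<integral>\<^sup>+ x. (ennreal a * ennreal b) * (?f x * ?g x) \<partial>M)"
    proof (intro nn_integral_cong)
      fix x
      have "ennreal a * ennreal b * (?f x * ?g x)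
        = (ennreal a * ennreal (1 / a)) * (ennreal b * ennreal (1 / b)) * (f x * g x)"
        by (simp only: ac_simps)
      also have "\<dots> = f x * g x"
        using 5 by (simp flip: ennreal_mult)
      finally show "f x * g x = ennreal a * ennreal b * (?f x * ?g x)" ..
    qed
    also have "\<dots> = ennreal a * ennreal b * (\<integral>\<^sup>+ x. ?f x * ?g x \<partial>M)"
      by (subst nn_integral_cmult) auto
    also have "\<dots> \<le> ennreal a * ennreal b * 1"
      using * by (intro mult_left_mono) auto
    finally show ?thesis using 5 by simp
  qed (auto simp: ennreal_top_mult ennreal_mult_top)
qed

text \<open>With \<open>a\<close> and \<open>b\<close> the norms and \<theta> = a / (a + b), the sum
  is a + b times the convex combination of f / a and g / b with coefficients \<theta> and 1 -
  \<theta>. Convexity of the q-th power then gives the claim without a conjugate exponent, the case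
  q = 1 included.\<close>

lemma Lq_add_le:
  assumes [measurable]: "f \<in> borel_measurable M" "g \<in> borel_measurable M" and q: "1 \<le> q"
  shows "Lq M q (\<lambda>x. f x + g x) \<le> Lq M q f + Lq M q g"
proof -
  consider "Lq M q f = 0" | "Lq M q g = 0" | "Lq M q f = \<infinity>" | "Lq M q g = \<infinity>"
    | a b where "Lq M q f = ennreal a" "Lq M q g = ennreal b" "0 < a" "0 < b"
    by (cases "Lq M q f"; cases "Lq M q g") (auto simp: less_le)
  then show ?thesis
  proof cases
    case 1
    then have "AE x in M. f x = 0" using q by (simp add: Lq_eq_0_iff)
    then have "AE x in M. f x + g x = g x" by eventually_elim simp
    then show ?thesis using Lq_cong_AE[of "\<lambda>x. f x + g x" g] by simp
  next
    case 2
    then have "AE x in M. g x = 0" using q by (simp add: Lq_eq_0_iff)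
    then have "AE x in M. f x + g x = f x" by eventually_elim simp
    then show ?thesis using Lq_cong_AE[of "\<lambda>x. f x + g x" f] by simp
  next
    case 5
    define \<theta> where "\<theta> = a / (a + b)"
    have \<theta>: "0 < \<theta>" "\<theta> < 1" "(a + b) * \<theta> = a" "(a + b) * (1 - \<theta>) = b"
      using 5 by (auto simp: \<theta>_def field_simps)
    let ?f = "\<lambda>x. ennreal (1 / a) * f x" and ?g = "\<lambda>x. ennreal (1 / b) * g x"
    have pt: "enn_powr (f x + g x) q \<le> ennreal ((a + b) powr q) *
        (ennreal \<theta> * enn_powr (?f x) q + ennreal (1 - \<theta>) * enn_powr (?g x) q)" for x
    proof (cases "f x"; cases "g x")
      fix u v assume uv: "0 \<le> u" "f x = ennreal u" "0 \<le> v" "g x = ennreal v"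
      have "u + v = (a + b) * (\<theta> * (1 / a * u) + (1 - \<theta>) * (1 / b * v))"
      proof -
        have "(a + b) * (\<theta> * (1 / a * u) + (1 - \<theta>) * (1 / b * v))
            = ((a + b) * \<theta>) * (1 / a * u) + ((a + b) * (1 - \<theta>)) * (1 / b * v)"
          by (simp only: ring_distribs mult.assoc)
        then show ?thesis using \<theta> 5 by simp
      qed
      then have "(u + v) powr q = (a + b) powr q * (\<theta> * (1 / a * u) + (1 - \<theta>) * (1 / b * v)) powr q"
        using uv 5 \<theta> by (simp only: powr_mult)
      also have "\<dots> \<le> (a + b) powr q * (\<theta> * (1 / a * u) powr q + (1 - \<theta>) * (1 / b * v) powr q)"
        using uv 5 \<theta> q by (intro mult_left_mono powr_convex_combination) auto
      finally have "ennreal ((u + v) powr q)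
          \<le> ennreal ((a + b) powr q * (\<theta> * (1 / a * u) powr q + (1 - \<theta>) * (1 / b * v) powr q))"
        by (rule ennreal_leI)
      moreover have "enn_powr (f x + g x) q = ennreal ((u + v) powr q)"
        using uv by (simp add: enn_powr_ennreal flip: ennreal_plus)
      moreover have "?f x = ennreal (1 / a * u)" "?g x = ennreal (1 / b * v)"
        using uv 5 by (auto simp flip: ennreal_mult)
      ultimately show ?thesis
        using uv 5 \<theta> by (simp add: enn_powr_ennreal ennreal_mult)
    qed (use 5 \<theta> in \<open>auto simp: ennreal_mult_top\<close>)
    have "enn_powr (Lq M q (\<lambda>x. f x + g x)) q \<le> (\<integral>\<^sup>+ x. ennreal ((a + b) powr q) *
        (ennreal \<theta> * enn_powr (?f x) q + ennreal (1 - \<theta>) * enn_powr (?g x) q) \<partial>M)"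
      using q by (subst Lq_powr) (auto intro!: nn_integral_mono pt)
    also have "\<dots> = ennreal ((a + b) powr q) * (ennreal \<theta> + ennreal (1 - \<theta>))"
      using 5 q by (simp add: nn_integral_add nn_integral_cmult Lq_normalize)
    also have "\<dots> = enn_powr (ennreal (a + b)) q"
      using 5 \<theta> by (simp add: enn_powr_ennreal flip: ennreal_plus)
    finally have "Lq M q (\<lambda>x. f x + g x) \<le> ennreal (a + b)"
      using q by (simp add: enn_powr_le_iff)
    then show ?thesis using 5 by simp
  qed auto
qed

lemma Lq_sum_le:
  assumes "finite I" and "\<And>i. i \<in> I \<Longrightarrow> f i \<in> borel_measurable M" and q: "1 \<le> q"
  shows "Lq M q (\<lambda>x. \<Sum>i\<in>I. f i x) \<le> (\<Sum>i\<in>I. Lq M q (f i))"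
  using assms(1,2)
proof (induction I)
  case (insert i I)
  have "Lq M q (\<lambda>x. f i x + (\<Sum>i\<in>I. f i x)) \<le> Lq M q (f i) + Lq M q (\<lambda>x. \<Sum>i\<in>I. f i x)"
    using insert q by (intro Lq_add_le) auto
  also have "\<dots> \<le> Lq M q (f i) + (\<Sum>i\<in>I. Lq M q (f i))"
    using insert by (intro add_mono) auto
  finally show ?case using insert by simp
qed simp

text \<open>Monotone convergence along the partial sums; \<open>enn_powr_SUP\<close> moves the
  supremum through both powers.\<close>

lemma Lq_suminf_le:
  fixes f :: "nat \<Rightarrow> 'a \<Rightarrow> ennreal"
  assumes [measurable]: "\<And>i. f i \<in> borel_measurable M" and q: "1 \<le> q"
  shows "Lq M q (\<lambda>x. \<Sum>i. f i x) \<le> (\<Sum>i. Lq M q (f i))"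
proof -
  have "(\<integral>\<^sup>+ x. enn_powr (\<Sum>i. f i x) q \<partial>M)
      = (\<integral>\<^sup>+ x. (SUP n. enn_powr (\<Sum>i<n. f i x) q) \<partial>M)"
    using q by (simp add: suminf_eq_SUP enn_powr_SUP)
  also have "\<dots> = (SUP n. \<integral>\<^sup>+ x. enn_powr (\<Sum>i<n. f i x) q \<partial>M)"
    using q by (intro nn_integral_monotone_convergence_SUP)
      (auto simp: incseq_def le_fun_def intro!: enn_powr_mono sum_mono2)
  finally have "Lq M q (\<lambda>x. \<Sum>i. f i x) = (SUP n. Lq M q (\<lambda>x. \<Sum>i<n. f i x))"
    using q by (simp add: Lq_def enn_powr_SUP)
  also have "\<dots> \<le> (SUP n. \<Sum>i<n. Lq M q (f i))"
    using q by (intro SUP_mono) (blast intro: Lq_sum_le assms)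
  finally show ?thesis by (simp add: suminf_eq_SUP)
qed

text \<open>Encodes a countable index type in the naturals, with zero terms off the range of
  \<open>to_nat\<close>, so that series arguments also apply to indices in
  \<open>int \<times> int\<close>.\<close>

lemma nn_integral_count_space_from_nat:
  fixes f :: "'i::countable \<Rightarrow> ennreal"
  shows "(\<integral>\<^sup>+ i. f i \<partial>count_space UNIV) = (\<Sum>n. if n \<in> range (to_nat :: 'i \<Rightarrow> nat) then f (from_nat n) else 0)"
proof -
  have "(\<integral>\<^sup>+ i. f i \<partial>count_space UNIV) = (\<integral>\<^sup>+ i. f (from_nat (to_nat (i :: 'i))) \<partial>count_space UNIV)"
    by (simp only: from_nat_to_nat)
  also have "\<dots> = (\<integral>\<^sup>+ n. f (from_nat n) \<partial>count_space (range (to_nat :: 'i \<Rightarrow> nat)))"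
    by (intro nn_integral_bij_count_space inj_on_imp_bij_betw inj_to_nat)
  also have "\<dots> = (\<integral>\<^sup>+ n. f (from_nat n) * indicator (range (to_nat :: 'i \<Rightarrow> nat)) n \<partial>count_space UNIV)"
    by (rule nn_integral_count_space_indicator) auto
  also have "\<dots> = (\<Sum>n. f (from_nat n) * indicator (range (to_nat :: 'i \<Rightarrow> nat)) n)"
    by (rule nn_integral_count_space_nat)
  finally show ?thesis by (auto simp: indicator_def intro!: suminf_cong)
qed

text \<open>Used with three choices of \<open>M\<close>: counting measure on the naturals for the
  ell-p0 sums, \<open>lborel\<close> for L^p, and counting measure on
  \<open>int \<times> int\<close> for ell-q.\<close>

lemma Minkowski_count_space:
  fixes f :: "'i::countable \<Rightarrow> 'a \<Rightarrow> ennreal"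
  assumes [measurable]: "\<And>i. f i \<in> borel_measurable M" and q: "1 \<le> q"
  shows "Lq M q (\<lambda>x. \<integral>\<^sup>+ i. f i x \<partial>count_space UNIV) \<le> (\<integral>\<^sup>+ i. Lq M q (f i) \<partial>count_space UNIV)"
proof -
  let ?R = "range (to_nat :: 'i \<Rightarrow> nat)"
  have "Lq M q (\<lambda>x. \<Sum>n. if n \<in> ?R then f (from_nat n) x else 0)
      \<le> (\<Sum>n. Lq M q (\<lambda>x. if n \<in> ?R then f (from_nat n) x else 0))"
    by (intro Lq_suminf_le q) auto
  also have "\<dots> = (\<Sum>n. if n \<in> ?R then Lq M q (f (from_nat n)) else 0)"
    by (intro suminf_cong) auto
  finally show ?thesis unfolding nn_integral_count_space_from_nat .
qed

section \<open>Cubes and the cube maximal operator\<close>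

lemma cube_eq_box: "cube c r = box (\<chi> i. c $ i - r / 2) (\<chi> i. c $ i + r / 2)"
proof -
  have "\<bar>y $ i - c $ i\<bar> < r / 2 \<longleftrightarrow> c $ i - r / 2 < y $ i \<and> y $ i < c $ i + r / 2" for y i
    by linarith
  then show ?thesis by (simp add: cube_def set_eq_iff mem_box_cart)
qed

lemma open_cube [simp]: "open (cube c r)"
  by (simp add: cube_eq_box open_box)

lemma cube_borel [measurable, simp]: "cube c r \<in> sets borel"
  by (simp add: borel_open)

lemma emeasure_cube:
  fixes c :: "real ^ 'd"
  assumes "0 < r"
  shows "emeasure lborel (cube c r) = ennreal (r ^ CARD('d))"
proof -
  let ?l = "\<chi> i. c $ i - r / 2" and ?u = "\<chi> i. c $ i + r / 2"
  have *: "(?u - ?l) \<bullet> b = r" if "b \<in> Basis" for b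
    using that by (auto simp: Basis_vec_def inner_axis)
  have "emeasure lborel (cube c r) = ennreal (\<Prod>b\<in>Basis. (?u - ?l) \<bullet> b)"
    unfolding cube_eq_box
  proof (rule emeasure_lborel_box)
    fix b :: "real ^ 'd" assume "b \<in> Basis"
    then have "(?u - ?l) \<bullet> b = r" by (rule *)
    then show "?l \<bullet> b \<le> ?u \<bullet> b"
      using assms by (simp add: inner_diff_left)
  qed
  also have "(\<Prod>b\<in>Basis. (?u - ?l) \<bullet> b) = (\<Prod>b\<in>(Basis :: (real ^ 'd) set). r)"
    by (intro prod.cong refl *)
  finally show ?thesis by simp
qed

lemma cube_subset: "(\<And>i. \<bar>c $ i - c' $ i\<bar> + r / 2 \<le> r' / 2) \<Longrightarrow> cube c r \<subseteq> cube c' r'"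
proof
  fix x assume le: "\<And>i. \<bar>c $ i - c' $ i\<bar> + r / 2 \<le> r' / 2" and "x \<in> cube c r"
  then have x: "\<bar>x $ i - c $ i\<bar> < r / 2" for i by (auto simp: cube_def)
  have "\<bar>x $ i - c' $ i\<bar> < r' / 2" for i using le[of i] x[of i] by linarith
  then show "x \<in> cube c' r'" by (simp add: cube_def)
qed

text \<open>A countable family that is still closed under tripling, which the covering argument
  uses.\<close>

definition rat_cubes :: "(real ^ 'd) set set" where
  "rat_cubes = {cube c r | c r. (\<forall>i. c $ i \<in> \<rat>) \<and> r \<in> \<rat> \<and> 0 < r}"

lemma countable_rat_cubes: "countable (rat_cubes :: (real ^ 'd) set set)"
proof -
  have "countable (vec_lambda ` (PiE UNIV (\<lambda>_. \<rat>)) :: (real ^ 'd) set)"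
    by (intro countable_image countable_PiE) (auto simp: countable_rat)
  moreover have "{c :: real ^ 'd. \<forall>i. c $ i \<in> \<rat>} \<subseteq> vec_lambda ` (PiE UNIV (\<lambda>_. \<rat>))"
    by (auto intro!: image_eqI[of _ _ "vec_nth _"])
  ultimately have "countable {c :: real ^ 'd. \<forall>i. c $ i \<in> \<rat>}"
    by (rule countable_subset[rotated])
  then have "countable ((\<lambda>(c, r). cube c r) ` ({c :: real ^ 'd. \<forall>i. c $ i \<in> \<rat>} \<times> \<rat>))"
    by (intro countable_image countable_SIGMA) (auto simp: countable_rat)
  then show ?thesis
    by (rule countable_subset[rotated]) (auto simp: rat_cubes_def)
qed

lemma rat_cubes_borel [measurable, simp]: "Q \<in> rat_cubes \<Longrightarrow> Q \<in> sets borel"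
  by (auto simp: rat_cubes_def)

lemma rat_cube_finite_pos:
  "Q \<in> rat_cubes \<Longrightarrow> emeasure lborel Q \<noteq> 0" "Q \<in> rat_cubes \<Longrightarrow> emeasure lborel Q \<noteq> top"
  by (auto simp: rat_cubes_def emeasure_cube)

text \<open>Moving the centre by at most r / 4 in each coordinate is compensated by a side of at
  least 3 r / 2, because r / 4 + r / 2 = (3 r / 2) / 2. Keeping the side below 2 r bounds the loss
  of volume by 2^d.\<close>

lemma cube_subset_rat_cube:
  fixes c :: "real ^ 'd"
  assumes "0 < r"
  obtains Q where "Q \<in> rat_cubes" "cube c r \<subseteq> Q"
    "emeasure lborel Q \<le> 2 ^ CARD('d) * emeasure lborel (cube c r)"
proof -
  obtain r' where r': "r' \<in> \<rat>" "3 / 2 * r < r'" "r' < 2 * r"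
    using Rats_dense_in_real[of "3 / 2 * r" "2 * r"] assms by auto
  have "\<exists>q\<in>\<rat>. \<bar>c $ i - q\<bar> \<le> r / 4" for i
    using Rats_dense_in_real[of "c $ i" "c $ i + r / 4"] assms by force
  then obtain q where q: "\<And>i. q i \<in> \<rat>" "\<And>i. \<bar>c $ i - q i\<bar> \<le> r / 4"
    by metis
  show ?thesis
  proof
    show "cube (vec_lambda q) r' \<in> rat_cubes"
      using q r' assms unfolding rat_cubes_def by (intro CollectI exI conjI refl) auto
    show "cube c r \<subseteq> cube (vec_lambda q) r'"
    proof (rule cube_subset)
      fix i show "\<bar>c $ i - vec_lambda q $ i\<bar> + r / 2 \<le> r' / 2"
        using q(2)[of i] r' by simp
    qed
    have "r' ^ CARD('d) \<le> 2 ^ CARD('d) * r ^ CARD('d)"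
      using r' assms by (subst power_mult_distrib[symmetric]) (intro power_mono; simp)
    then have "ennreal (r' ^ CARD('d)) \<le> ennreal (2 ^ CARD('d) * r ^ CARD('d))"
      by (rule ennreal_leI)
    then show "emeasure lborel (cube (vec_lambda q) r')
        \<le> 2 ^ CARD('d) * emeasure lborel (cube c r)"
      using r' assms by (simp add: emeasure_cube ennreal_mult flip: ennreal_power)
  qed
qed

text \<open>The uncentred maximal function over rational cubes. The condition that \<open>x\<close>
  lies in the cube is an indicator factor and not a restriction of the index set, so each term is a
  measurable function of \<open>x\<close>.\<close>

definition cube_max :: "(real ^ 'd \<Rightarrow> ennreal) \<Rightarrow> real ^ 'd \<Rightarrow> ennreal" where
  "cube_max f x =
     (SUP Q\<in>rat_cubes. indicator Q x * ((\<integral>\<^sup>+ y. f y * indicator Q y \<partial>lborel) / emeasure lborel Q))"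

lemma average_le_cube_max:
  assumes "Q \<in> rat_cubes" "x \<in> Q"
  shows "(\<integral>\<^sup>+ y. f y * indicator Q y \<partial>lborel) / emeasure lborel Q \<le> cube_max f x"
  unfolding cube_max_def using assms by (intro SUP_upper2[of Q]) auto

lemma cube_max_leI:
  assumes "\<And>Q. Q \<in> rat_cubes \<Longrightarrow> x \<in> Q \<Longrightarrow>
    (\<integral>\<^sup>+ y. f y * indicator Q y \<partial>lborel) / emeasure lborel Q \<le> C"
  shows "cube_max f x \<le> C"
  unfolding cube_max_def using assms by (intro SUP_least) (auto simp: indicator_def)

text \<open>The passage from arbitrary to rational cubes; it is the source of the powers of 2 in the
  bound for the strong maximal operator.\<close>

lemma average_le_cube_max':
  fixes f :: "real ^ 'd \<Rightarrow> ennreal"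
  assumes "0 < r" "x \<in> cube c r"
  shows "(\<integral>\<^sup>+ y. f y * indicator (cube c r) y \<partial>lborel) / emeasure lborel (cube c r)
    \<le> 2 ^ CARD('d) * cube_max f x"
proof -
  obtain Q :: "(real ^ 'd) set" where Q: "Q \<in> rat_cubes" "cube c r \<subseteq> Q"
    "emeasure lborel Q \<le> 2 ^ CARD('d) * emeasure lborel (cube c r)"
    using cube_subset_rat_cube[OF assms(1)] by blast
  let ?E = "emeasure lborel (cube c r)"
  have fin: "?E \<noteq> 0" "?E \<noteq> top" using assms(1) by (auto simp: emeasure_cube)
  have "(\<integral>\<^sup>+ y. f y * indicator (cube c r) y \<partial>lborel) / ?E
      \<le> (\<integral>\<^sup>+ y. f y * indicator Q y \<partial>lborel) / ?E"
    using Q(2) by (intro divide_right_mono_ennreal nn_integral_mono) (auto simp: indicator_def)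
  also have "\<dots> = (\<integral>\<^sup>+ y. f y * indicator Q y \<partial>lborel) / emeasure lborel Q * emeasure lborel Q / ?E"
    using rat_cube_finite_pos[OF Q(1)] by (simp add: ennreal_divide_times ennreal_divide_self less_top[symmetric] zero_less_iff_neq_zero)
  also have "\<dots> \<le> cube_max f x * (2 ^ CARD('d) * ?E) / ?E"
    using Q assms by (intro divide_right_mono_ennreal mult_mono average_le_cube_max) auto
  also have "\<dots> = 2 ^ CARD('d) * cube_max f x"
    using fin by (subst mult.assoc[symmetric], subst mult_divide_eq_ennreal) (auto simp: mult.commute)
  finally show ?thesis .
qed

lemma cube_max_mono: "(\<And>y. f y \<le> g y) \<Longrightarrow> cube_max f x \<le> cube_max g x"
  by (intro cube_max_leI order_trans[OF divide_right_mono_ennreal average_le_cube_max]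
      nn_integral_mono mult_right_mono) auto

lemma cube_max_0 [simp]: "cube_max (\<lambda>y. 0) x = 0"
  using cube_max_leI[of x "\<lambda>y. 0" 0] by simp

lemma cube_max_const_le:
  fixes x :: "real ^ 'd"
  shows "cube_max (\<lambda>y. a) x \<le> a"
proof (rule cube_max_leI)
  fix Q :: "(real ^ 'd) set" assume Q: "Q \<in> rat_cubes"
  then show "(\<integral>\<^sup>+ y. a * indicator Q y \<partial>lborel) / emeasure lborel Q \<le> a"
    using rat_cube_finite_pos[OF Q] by (simp add: nn_integral_cmult mult_divide_eq_ennreal)
qed

lemma cube_max_add_le:
  fixes f g :: "real ^ 'd \<Rightarrow> ennreal"
  assumes [measurable]: "f \<in> borel_measurable borel" "g \<in> borel_measurable borel"
  shows "cube_max (\<lambda>y. f y + g y) x \<le> cube_max f x + cube_max g x"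
proof (rule cube_max_leI)
  fix Q :: "(real ^ 'd) set" assume Q: "Q \<in> rat_cubes" "x \<in> Q"
  note [measurable] = rat_cubes_borel[OF Q(1)]
  have "(\<integral>\<^sup>+ y. (f y + g y) * indicator Q y \<partial>lborel) / emeasure lborel Q
      = (\<integral>\<^sup>+ y. f y * indicator Q y \<partial>lborel) / emeasure lborel Q +
        (\<integral>\<^sup>+ y. g y * indicator Q y \<partial>lborel) / emeasure lborel Q"
    by (simp add: distrib_right nn_integral_add add_divide_distrib_ennreal)
  also have "\<dots> \<le> cube_max f x + cube_max g x"
    using Q by (intro add_mono average_le_cube_max)
  finally show "(\<integral>\<^sup>+ y. (f y + g y) * indicator Q y \<partial>lborel) / emeasure lborel Q
    \<le> cube_max f x + cube_max g x" .
qed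

lemma cube_max_count_space_le:
  fixes f :: "'i::countable \<Rightarrow> real ^ 'd \<Rightarrow> ennreal"
  assumes [measurable]: "\<And>i. f i \<in> borel_measurable borel"
  shows "cube_max (\<lambda>y. \<integral>\<^sup>+ i. f i y \<partial>count_space UNIV) x
    \<le> (\<integral>\<^sup>+ i. cube_max (f i) x \<partial>count_space UNIV)"
proof (rule cube_max_leI)
  fix Q :: "(real ^ 'd) set" assume Q: "Q \<in> rat_cubes" "x \<in> Q"
  note [measurable] = rat_cubes_borel[OF Q(1)]
  have "(\<integral>\<^sup>+ y. (\<integral>\<^sup>+ i. f i y \<partial>count_space UNIV) * indicator Q y \<partial>lborel)
      = (\<integral>\<^sup>+ y. (\<integral>\<^sup>+ i. f i y * indicator Q y \<partial>count_space UNIV) \<partial>lborel)"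
    by (simp add: nn_integral_multc)
  also have "\<dots> = (\<integral>\<^sup>+ i. (\<integral>\<^sup>+ y. f i y * indicator Q y \<partial>lborel) \<partial>count_space UNIV)"
    by (subst nn_integral_count_space_nn_integral) auto
  finally have "(\<integral>\<^sup>+ y. (\<integral>\<^sup>+ i. f i y \<partial>count_space UNIV) * indicator Q y \<partial>lborel) / emeasure lborel Q
      = (\<integral>\<^sup>+ i. (\<integral>\<^sup>+ y. f i y * indicator Q y \<partial>lborel) / emeasure lborel Q \<partial>count_space UNIV)"
    by (simp add: nn_integral_divide)
  also have "\<dots> \<le> (\<integral>\<^sup>+ i. cube_max (f i) x \<partial>count_space UNIV)"
    using Q by (intro nn_integral_mono average_le_cube_max)
  finally show "(\<integral>\<^sup>+ y. (\<integral>\<^sup>+ i. f i y \<partial>count_space UNIV) * indicator Q y \<partial>lborel) / emeasure lborel Q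
    \<le> (\<integral>\<^sup>+ i. cube_max (f i) x \<partial>count_space UNIV)" .
qed

text \<open>Joint measurability in point and parameter, so that the maximal operator in one variable
  of a product yields a function to which Tonelli's theorem applies.\<close>

lemma cube_max_measurable_param:
  fixes f :: "real ^ 'd \<Rightarrow> 'b \<Rightarrow> ennreal"
  assumes f: "(\<lambda>(x, t). f x t) \<in> borel_measurable (borel \<Otimes>\<^sub>M N)"
  shows "(\<lambda>(x, t). cube_max (\<lambda>y. f y t) x) \<in> borel_measurable (borel \<Otimes>\<^sub>M N)"
proof -
  have "(\<lambda>(t, x). f x t) \<in> borel_measurable (N \<Otimes>\<^sub>M lborel)"
    using measurable_compose[OF measurable_pair_swap' f] by (simp add: case_prod_unfold cong: measurable_cong_sets)
  then have [measurable]: "(\<lambda>p. f (snd p) (fst p)) \<in> borel_measurable (N \<Otimes>\<^sub>M lborel)"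
    by (simp add: case_prod_unfold)
  have "(\<lambda>(x, t). SUP Q\<in>rat_cubes. indicator Q x *
      ((\<integral>\<^sup>+ y. f y t * indicator Q y \<partial>lborel) / emeasure lborel Q)) \<in> borel_measurable (borel \<Otimes>\<^sub>M N)"
    unfolding case_prod_unfold
  proof (rule borel_measurable_SUP[OF countable_rat_cubes])
    fix Q :: "(real ^ 'd) set" assume "Q \<in> rat_cubes"
    note [measurable] = rat_cubes_borel[OF this]
    have [measurable]: "(\<lambda>t. \<integral>\<^sup>+ y. f y t * indicator Q y \<partial>lborel) \<in> borel_measurable N"
      by (rule lborel.borel_measurable_nn_integral) (simp add: case_prod_unfold)
    show "(\<lambda>p. indicator Q (fst p) * ((\<integral>\<^sup>+ y. f y (snd p) * indicator Q y \<partial>lborel) / emeasure lborel Q))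
      \<in> borel_measurable (borel \<Otimes>\<^sub>M N)"
      by measurable
  qed
  then show ?thesis by (simp add: cube_max_def)
qed

lemma cube_max_measurable [measurable (raw)]:
  fixes f :: "real ^ 'd \<Rightarrow> ennreal"
  shows "cube_max f \<in> borel_measurable borel"
proof -
  have "(\<lambda>x. SUP Q\<in>rat_cubes. indicator Q x *
      ((\<integral>\<^sup>+ y. f y * indicator Q y \<partial>lborel) / emeasure lborel Q)) \<in> borel_measurable borel"
    by (intro borel_measurable_SUP[OF countable_rat_cubes]) auto
  then show ?thesis by (simp add: cube_max_def[abs_def])
qed

text \<open>Greedy selection: take a cube of largest side r, discard every cube meeting it, and
  recurse. A discarded cube of side r' \<le> r lies within r / 2 + r' / 2 + r' / 2 \<le> 3 r / 2 of
  the chosen centre in each coordinate, hence in the tripled cube.\<close>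

lemma Vitali_finite_cubes:
  fixes F :: "((real ^ 'd) \<times> real) set"
  assumes "finite F" "\<And>c r. (c, r) \<in> F \<Longrightarrow> 0 < r"
  shows "\<exists>G\<subseteq>F. disjoint_family_on (\<lambda>(c, r). cube c r) G \<and>
    (\<Union>(c, r)\<in>F. cube c r) \<subseteq> (\<Union>(c, r)\<in>G. cube c (3 * r))"
  using assms
proof (induction "card F" arbitrary: F rule: less_induct)
  case less
  show ?case
  proof (cases "F = {}")
    case False
    have fin: "finite (snd ` F)" "snd ` F \<noteq> {}" using less.prems False by auto
    obtain p where "p \<in> F" "snd p = Max (snd ` F)" using Max_in[OF fin] by auto
    then have p: "p \<in> F" "\<And>p'. p' \<in> F \<Longrightarrow> snd p' \<le> snd p"
      using fin by auto
    obtain c r where cr: "p = (c, r)" by (cases p)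
    let ?F = "{(c', r') \<in> F. cube c r \<inter> cube c' r' = {}}"
    have r: "0 < r" using less.prems p cr by auto
    have sub: "?F \<subseteq> F" by auto
    have c: "c \<in> cube c r" using r by (auto simp: cube_def)
    then have "p \<in> F - ?F" using p cr by auto
    then have "?F \<subset> F" using sub by blast
    then have card: "card ?F < card F" using less.prems(1) by (simp add: psubset_card_mono)
    have IH: "\<exists>G\<subseteq>?F. disjoint_family_on (\<lambda>(c, r). cube c r) G \<and>
        (\<Union>(c, r)\<in>?F. cube c r) \<subseteq> (\<Union>(c, r)\<in>G. cube c (3 * r))"
      using less.prems finite_subset[OF sub] by (intro less.hyps[OF card]) auto
    then obtain G where G: "G \<subseteq> ?F" "disjoint_family_on (\<lambda>(c, r). cube c r) G"
      "(\<Union>(c, r)\<in>?F. cube c r) \<subseteq> (\<Union>(c, r)\<in>G. cube c (3 * r))"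
      using IH by (elim exE conjE)
    have "disjoint_family_on (\<lambda>(c, r). cube c r) (insert p G)"
      using G(1,2) unfolding disjoint_family_on_def cr by fastforce
    moreover have "(\<Union>(c, r)\<in>F. cube c r) \<subseteq> (\<Union>(c, r)\<in>insert p G. cube c (3 * r))"
    proof safe
      fix x c' r' assume *: "(c', r') \<in> F" "x \<in> cube c' r'"
      show "x \<in> (\<Union>(c, r)\<in>insert p G. cube c (3 * r))"
      proof (cases "(c', r') \<in> ?F")
        case True
        then show ?thesis using G(3) * by blast
      next
        case False
        then obtain y where y: "y \<in> cube c r" "y \<in> cube c' r'" using * by auto
        have "r' \<le> r" using p(2)[OF *(1)] cr by simp
        have "x \<in> cube c (3 * r)"
          unfolding cube_def
        proof safe
          fix i
          have "\<bar>y $ i - c $ i\<bar> < r / 2" "\<bar>y $ i - c' $ i\<bar> < r' / 2" "\<bar>x $ i - c' $ i\<bar> < r' / 2"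
            using y * by (auto simp: cube_def)
          with \<open>r' \<le> r\<close> show "\<bar>x $ i - c $ i\<bar> < 3 * r / 2" by linarith
        qed
        then show ?thesis using cr by auto
      qed
    qed
    ultimately show ?thesis using G(1) p(1)
      by (intro exI[of _ "insert p G"]) auto
  qed (auto simp: disjoint_family_on_def)
qed

section \<open>The weighted Fefferman--Stein inequality\<close>

text \<open>On each selected cube the mass of \<open>u\<close> over the tripled cube is its average
  there times 3^d times the volume of the small cube. The volume times \<open>t\<close> is at most
  the integral of \<open>f\<close>, and the average is at most \<open>cube_max u\<close> at every
  point of the small cube. Disjointness allows the integrals to be added.\<close>

lemma cube_max_weak_type_finite:
  fixes f u :: "real ^ 'd \<Rightarrow> ennreal"
  assumes [measurable]: "f \<in> borel_measurable borel" "u \<in> borel_measurable borel"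
  assumes F: "finite F" "F \<subseteq> rat_cubes"
    and t: "\<And>Q. Q \<in> F \<Longrightarrow> t \<le> (\<integral>\<^sup>+ y. f y * indicator Q y \<partial>lborel) / emeasure lborel Q"
  shows "t * (\<integral>\<^sup>+ x. u x * indicator (\<Union>F) x \<partial>lborel)
    \<le> 3 ^ CARD('d) * (\<integral>\<^sup>+ x. f x * cube_max u x \<partial>lborel)"
proof -
  have "\<exists>c r. Q = cube c r \<and> (\<forall>i. c $ i \<in> \<rat>) \<and> r \<in> \<rat> \<and> 0 < r" if "Q \<in> F" for Q
    using F(2) that by (auto simp: rat_cubes_def)
  then obtain c r where cr: "\<And>Q. Q \<in> F \<Longrightarrow> Q = cube (c Q) (r Q)"
    "\<And>Q i. Q \<in> F \<Longrightarrow> c Q $ i \<in> \<rat>" "\<And>Q. Q \<in> F \<Longrightarrow> r Q \<in> \<rat>" "\<And>Q. Q \<in> F \<Longrightarrow> 0 < r Q"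
    by metis
  define K where "K = (\<lambda>Q. (c Q, r Q)) ` F"
  have K: "finite K" "\<And>c r. (c, r) \<in> K \<Longrightarrow> 0 < r"
    using F(1) cr(4) by (auto simp: K_def)
  have KF: "cube c r \<in> F" "\<And>i. c $ i \<in> \<rat>" "r \<in> \<rat>" "0 < r" if "(c, r) \<in> K" for c r
    using that cr(2-4) cr(1)[symmetric] by (auto simp: K_def)
  obtain G where G: "G \<subseteq> K" "disjoint_family_on (\<lambda>(c, r). cube c r) G"
    "(\<Union>(c, r)\<in>K. cube c r) \<subseteq> (\<Union>(c, r)\<in>G. cube c (3 * r))"
    using Vitali_finite_cubes[of K] K by metis
  have finG: "finite G" using G(1) K(1) by (rule finite_subset)
  have un: "\<Union>F \<subseteq> (\<Union>(c, r)\<in>K. cube c r)"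
    using cr(1) by (force simp: K_def)
  have step: "t * (\<integral>\<^sup>+ x. u x * indicator (cube c (3 * r)) x \<partial>lborel)
      \<le> 3 ^ CARD('d) * (\<integral>\<^sup>+ x. f x * cube_max u x * indicator (cube c r) x \<partial>lborel)"
    if "(c, r) \<in> G" for c r
  proof -
    note Q = KF[OF subsetD[OF G(1) that]]
    \<comment> \<open>The tripled cube has to be rational, so that the average of \<open>u\<close>
      over it is one of those in the definition of \<open>cube_max u\<close>.\<close>
    have Q3: "cube c (3 * r) \<in> rat_cubes"
      using Q unfolding rat_cubes_def by (intro CollectI exI[of _ c] exI[of _ "3 * r"]) auto
    have sub: "cube c r \<subseteq> cube c (3 * r)" using Q(4) by (intro cube_subset) auto
    define A where "A = (\<integral>\<^sup>+ y. u y * indicator (cube c (3 * r)) y \<partial>lborel) / emeasure lborel (cube c (3 * r))"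
    have vol: "emeasure lborel (cube c (3 * r)) = 3 ^ CARD('d) * emeasure lborel (cube c r)"
      using Q(4) by (simp add: emeasure_cube power_mult_distrib ennreal_mult flip: ennreal_power)
    have eq: "(\<integral>\<^sup>+ x. u x * indicator (cube c (3 * r)) x \<partial>lborel) = A * emeasure lborel (cube c (3 * r))"
      unfolding A_def using rat_cube_finite_pos[OF Q3]
      by (simp add: ennreal_divide_times ennreal_divide_self less_top[symmetric] zero_less_iff_neq_zero)
    have "t * (\<integral>\<^sup>+ x. u x * indicator (cube c (3 * r)) x \<partial>lborel)
        = 3 ^ CARD('d) * (A * (t * emeasure lborel (cube c r)))"
      by (simp only: eq vol) (simp only: mult_ac)
    also have "t * emeasure lborel (cube c r) \<le> (\<integral>\<^sup>+ y. f y * indicator (cube c r) y \<partial>lborel)"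
    proof -
      have "cube c r \<in> rat_cubes" using Q F by auto
      from rat_cube_finite_pos[OF this] mult_right_mono[OF t[OF Q(1)], of "emeasure lborel (cube c r)"]
      show ?thesis
        by (simp add: ennreal_divide_times ennreal_divide_self less_top[symmetric] zero_less_iff_neq_zero)
    qed
    also have "A * (\<integral>\<^sup>+ y. f y * indicator (cube c r) y \<partial>lborel)
        = (\<integral>\<^sup>+ y. f y * A * indicator (cube c r) y \<partial>lborel)"
      by (simp add: nn_integral_cmult[symmetric] mult_ac)
    also have "\<dots> \<le> (\<integral>\<^sup>+ y. f y * cube_max u y * indicator (cube c r) y \<partial>lborel)"
    proof (intro nn_integral_mono)
      fix y
      show "f y * A * indicator (cube c r) y \<le> f y * cube_max u y * indicator (cube c r) y"
        using average_le_cube_max[OF Q3, of y u] sub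
        by (auto simp: A_def indicator_def intro!: mult_left_mono)
    qed
    finally show ?thesis by (simp add: mult_left_mono)
  qed
  have "(\<integral>\<^sup>+ x. u x * indicator (\<Union>F) x \<partial>lborel)
      \<le> (\<integral>\<^sup>+ x. (\<Sum>(c, r)\<in>G. u x * indicator (cube c (3 * r)) x) \<partial>lborel)"
  proof (intro nn_integral_mono)
    fix x
    show "u x * indicator (\<Union>F) x \<le> (\<Sum>(c, r)\<in>G. u x * indicator (cube c (3 * r)) x)"
    proof (cases "x \<in> \<Union>F")
      case True
      then obtain c r where "(c, r) \<in> G" "x \<in> cube c (3 * r)"
        using un G(3) by blast
      then show ?thesis
        using member_le_sum[of "(c, r)" G "\<lambda>(c, r). u x * indicator (cube c (3 * r)) x"] finG True
        by auto
    qed simp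
  qed
  also have "\<dots> = (\<Sum>(c, r)\<in>G. \<integral>\<^sup>+ x. u x * indicator (cube c (3 * r)) x \<partial>lborel)"
    by (simp add: case_prod_unfold nn_integral_sum)
  finally have "t * (\<integral>\<^sup>+ x. u x * indicator (\<Union>F) x \<partial>lborel)
      \<le> (\<Sum>(c, r)\<in>G. t * (\<integral>\<^sup>+ x. u x * indicator (cube c (3 * r)) x \<partial>lborel))"
    by (auto simp: case_prod_unfold sum_distrib_left[symmetric] intro: mult_left_mono)
  also have "\<dots> \<le> (\<Sum>(c, r)\<in>G. 3 ^ CARD('d) *
      (\<integral>\<^sup>+ x. f x * cube_max u x * indicator (cube c r) x \<partial>lborel))"
    using step by (intro sum_mono) auto
  also have "\<dots> = 3 ^ CARD('d) *
      (\<integral>\<^sup>+ x. (\<Sum>(c, r)\<in>G. f x * cube_max u x * indicator (cube c r) x) \<partial>lborel)"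
    by (simp add: case_prod_unfold nn_integral_sum sum_distrib_left)
  also have "\<dots> \<le> 3 ^ CARD('d) * (\<integral>\<^sup>+ x. f x * cube_max u x \<partial>lborel)"
  proof (intro mult_left_mono nn_integral_mono)
    fix x
    have "(\<Sum>(c, r)\<in>G. f x * cube_max u x * indicator (cube c r) x)
        = f x * cube_max u x * indicator (\<Union>p\<in>G. (\<lambda>(c, r). cube c r) p) x"
      unfolding indicator_UN_disjoint[OF finG G(2)] by (simp add: sum_distrib_left case_prod_unfold)
    then show "(\<Sum>(c, r)\<in>G. f x * cube_max u x * indicator (cube c r) x) \<le> f x * cube_max u x"
      by (simp add: indicator_def)
  qed simp
  finally show ?thesis .
qed

text \<open>The level set is exactly the union of the rational cubes whose average exceeds
  \<open>t\<close>. It is exhausted by finite unions, and continuity from below of the measure with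
  density \<open>u\<close> passes to the limit.\<close>

lemma cube_max_weak_type:
  fixes f u :: "real ^ 'd \<Rightarrow> ennreal"
  assumes [measurable]: "f \<in> borel_measurable borel" "u \<in> borel_measurable borel"
  shows "t * (\<integral>\<^sup>+ x. u x * indicator {x. t < cube_max f x} x \<partial>lborel)
    \<le> 3 ^ CARD('d) * (\<integral>\<^sup>+ x. f x * cube_max u x \<partial>lborel)"
proof -
  define \<Q> where "\<Q> = {Q \<in> rat_cubes. t < (\<integral>\<^sup>+ y. f y * indicator Q y \<partial>lborel) / emeasure lborel Q}"
  have eq: "{x. t < cube_max f x} = \<Union>\<Q>"
  proof -
    have "t < indicator Q x * a \<longleftrightarrow> x \<in> Q \<and> t < a" for Q and x :: "real ^ 'd" and a
      by (auto simp: indicator_def)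
    then show ?thesis by (auto simp: cube_max_def less_SUP_iff \<Q>_def)
  qed
  show ?thesis
  proof (cases "\<Q> = {}")
    case False
    have "countable \<Q>"
      by (rule countable_subset[OF _ countable_rat_cubes]) (auto simp: \<Q>_def)
    then have rng: "range (from_nat_into \<Q>) = \<Q>" using False by simp
    let ?A = "\<lambda>n. \<Union>(from_nat_into \<Q> ` {..<n})"
    have Qi: "from_nat_into \<Q> i \<in> \<Q>" for i using rng by auto
    have [measurable]: "from_nat_into \<Q> i \<in> sets borel" for i
      using Qi[of i] by (auto simp: \<Q>_def)
    have un: "\<Union>\<Q> = (\<Union>n. ?A n)"
      by (subst rng[symmetric]) blast
    have "(\<integral>\<^sup>+ x. u x * indicator (\<Union>n. ?A n) x \<partial>lborel) = emeasure (density lborel u) (\<Union>n. ?A n)"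
      by (subst emeasure_density) (auto intro!: sets.countable_UN)
    also have "\<dots> = (SUP n. emeasure (density lborel u) (?A n))"
      by (intro SUP_emeasure_incseq[symmetric]) (auto simp: incseq_def intro: order.strict_trans2)
    also have "\<dots> = (SUP n. \<integral>\<^sup>+ x. u x * indicator (?A n) x \<partial>lborel)"
      by (intro SUP_cong refl emeasure_density) auto
    finally have "t * (\<integral>\<^sup>+ x. u x * indicator (\<Union>\<Q>) x \<partial>lborel)
        = (SUP n. t * (\<integral>\<^sup>+ x. u x * indicator (?A n) x \<partial>lborel))"
      by (simp add: un SUP_mult_left_ennreal)
    also have "\<dots> \<le> 3 ^ CARD('d) * (\<integral>\<^sup>+ x. f x * cube_max u x \<partial>lborel)"
    proof (rule SUP_least)
      fix n
      have "t \<le> (\<integral>\<^sup>+ y. f y * indicator Q y \<partial>lborel) / emeasure lborel Q"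
        if "Q \<in> from_nat_into \<Q> ` {..<n}" for Q
        using that Qi by (auto simp: \<Q>_def less_imp_le)
      then show "t * (\<integral>\<^sup>+ x. u x * indicator (?A n) x \<partial>lborel)
        \<le> 3 ^ CARD('d) * (\<integral>\<^sup>+ x. f x * cube_max u x \<partial>lborel)"
        using Qi by (intro cube_max_weak_type_finite) (auto simp: \<Q>_def)
    qed
    finally show ?thesis by (simp add: eq)
  qed (simp add: eq)
qed

section \<open>Dyadic layer-cake sums and the strong-type inequality\<close>

definition geometric_sum :: "real \<Rightarrow> ennreal" where
  "geometric_sum e = (\<integral>\<^sup>+ k. ennreal (2 powr (- e * \<bar>of_int k\<bar>)) \<partial>count_space (UNIV :: int set))"

lemma geometric_sum_finite:
  assumes "0 < e" shows "geometric_sum e < top"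
proof -
  let ?f = "\<lambda>k::int. ennreal (2 powr (- e * \<bar>of_int k\<bar>))"
  have sum: "(\<Sum>n. ennreal (2 powr (- e * real n))) < top"
  proof -
    have "2 powr (- e * real n) = (2 powr (- e)) ^ n" for n
      by (simp add: powr_powr powr_realpow[symmetric])
    moreover have "2 powr (- e) < (1::real)"
      using assms powr_less_cancel_iff[of 2 "- e" 0] by simp
    ultimately have "summable (\<lambda>n. 2 powr (- e * real n))" by (simp add: summable_geometric)
    then show ?thesis by (simp add: suminf_ennreal_eq[OF _ summable_sums])
  qed
  have "geometric_sum e = (\<integral>\<^sup>+ k. ?f k * indicator {0..} k + ?f k * indicator {..<0} k \<partial>count_space UNIV)"
    unfolding geometric_sum_def by (intro nn_integral_cong) (auto simp: indicator_def)
  also have "\<dots> = (\<integral>\<^sup>+ k. ?f k \<partial>count_space {0..}) + (\<integral>\<^sup>+ k. ?f k \<partial>count_space {..<0})"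
    by (subst nn_integral_add) (simp_all only: nn_integral_count_space_indicator[of "{0..}" ?f]
      nn_integral_count_space_indicator[of "{..<0}" ?f] borel_measurable_count_space NO_MATCH_def)
  also have "\<dots> \<le> (\<Sum>n. ennreal (2 powr (- e * real n))) + (\<Sum>n. ennreal (2 powr (- e * real n)))"
  proof (rule add_mono)
    have "(\<integral>\<^sup>+ k. ?f k \<partial>count_space {0..}) = (\<integral>\<^sup>+ n. ?f (int n) \<partial>count_space UNIV)"
      by (rule nn_integral_bij_count_space[symmetric], rule bij_betwI[of _ _ _ nat]) auto
    also have "\<dots> = (\<Sum>n. ennreal (2 powr (- e * real n)))"
      by (subst nn_integral_count_space_nat) simp
    finally show "(\<integral>\<^sup>+ k. ?f k \<partial>count_space {0..}) \<le> (\<Sum>n. ennreal (2 powr (- e * real n)))"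
      by (rule eq_refl)
    have "(\<integral>\<^sup>+ k. ?f k \<partial>count_space {..<0}) = (\<integral>\<^sup>+ n. ?f (- int n - 1) \<partial>count_space UNIV)"
      by (rule nn_integral_bij_count_space[symmetric], rule bij_betwI[of _ _ _ "\<lambda>k. nat (- k - 1)"]) auto
    also have "\<dots> \<le> (\<integral>\<^sup>+ n. ennreal (2 powr (- e * real n)) \<partial>count_space UNIV)"
      using assms by (intro nn_integral_mono ennreal_leI) auto
    also have "\<dots> = (\<Sum>n. ennreal (2 powr (- e * real n)))"
      by (rule nn_integral_count_space_nat)
    finally show "(\<integral>\<^sup>+ k. ?f k \<partial>count_space {..<0}) \<le> (\<Sum>n. ennreal (2 powr (- e * real n)))" .
  qed
  also have "\<dots> < top" using sum by simp
  finally show ?thesis .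
qed

lemma geometric_sum_pos: "0 < geometric_sum e"
proof -
  have "ennreal (2 powr (- e * \<bar>of_int 0\<bar>)) \<le> geometric_sum e"
    unfolding geometric_sum_def by (rule nn_integral_ge_point) simp
  then show ?thesis using less_le_trans[OF zero_less_one] by simp
qed

lemma geometric_sum_shift:
  "(\<integral>\<^sup>+ k. ennreal (2 powr (- e * \<bar>of_int (k - j)\<bar>)) \<partial>count_space (UNIV :: int set)) = geometric_sum e"
  unfolding geometric_sum_def
  by (rule nn_integral_bij_count_space[of "\<lambda>k. k - j" UNIV UNIV])
     (auto intro!: bij_betwI[of _ _ _ "\<lambda>k. k + j"])

lemma dyadic_level:
  fixes y :: real
  assumes "0 < y"
  obtains K :: int where "2 powr of_int K < y" "y \<le> 2 powr (of_int K + 1)"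
proof
  let ?K = "\<lceil>log 2 y\<rceil> - 1"
  have "of_int ?K < log 2 y" "log 2 y \<le> of_int ?K + 1" by linarith+
  then show "2 powr of_int ?K < y" "y \<le> 2 powr (of_int ?K + 1)"
    using assms log_le_iff[of 2 y "of_int ?K + 1"] less_log_iff[of 2 y "of_int ?K"] by auto
qed

text \<open>A discrete layer-cake bound. For finite positive \<open>y\<close> the single term at the
  largest dyadic level strictly below \<open>y\<close> already suffices.\<close>

lemma enn_powr_le_dyadic_sum:
  assumes "0 < s"
  shows "enn_powr y s \<le> (\<integral>\<^sup>+ k. ennreal (2 powr ((of_int k + 1) * s)) *
    indicator {k. ennreal (2 powr of_int k) < y} k \<partial>count_space (UNIV :: int set))" (is "_ \<le> ?S")
proof -
  have le: "ennreal (2 powr ((of_int k + 1) * s)) * indicator {k. ennreal (2 powr of_int k) < y} k \<le> ?S" for k :: int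
    by (rule nn_integral_ge_point) simp
  show ?thesis
  proof (cases y)
    case (real r)
    show ?thesis
    proof (cases "r = 0")
      case False
      with real obtain K :: int where K: "2 powr of_int K < r" "r \<le> 2 powr (of_int K + 1)"
        using dyadic_level[of r] by auto
      have "r powr s \<le> (2 powr (of_int K + 1)) powr s"
        using K real assms by (intro powr_mono2) auto
      then have "enn_powr y s \<le> ennreal (2 powr ((of_int K + 1) * s))"
        using real by (simp add: enn_powr_ennreal powr_powr ennreal_leI)
      also have "\<dots> \<le> ?S"
        using le[of K] K real by (simp add: ennreal_less_iff)
      finally show ?thesis .
    qed (use real in simp)
  next
    case top
    \<comment> \<open>For infinite \<open>y\<close> every level contributes, and a term with large
      enough \<open>k\<close> exceeds any presumed finite value \<open>b\<close> of the sum.\<close>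
    have "?S = top"
    proof (cases "?S")
      case (real b)
      define k :: int where "k = \<lceil>log 2 (b + 1) / s\<rceil>"
      have "log 2 (b + 1) \<le> of_int k * s"
        using assms unfolding k_def by (simp add: pos_divide_le_eq[symmetric])
      also have "\<dots> < (of_int k + 1) * s" using assms by simp
      finally have "b + 1 < 2 powr ((of_int k + 1) * s)"
        using real by (simp add: log_less_iff)
      moreover have "ennreal (2 powr ((of_int k + 1) * s)) \<le> ennreal b"
        using le[of k] real top by simp
      ultimately show ?thesis using real by simp
    qed simp
    then show ?thesis by simp
  qed
qed

text \<open>The terms grow like \<open>2 powr (k * (s - 1))\<close> and stop near the level of
  \<open>y\<close>, so the sum is a geometric series dominated by its last terms; this is where
  \<open>1 < s\<close> enters. The exponent - (k - 1) comes from dividing by the half level in the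
  weak-type bound.\<close>

lemma dyadic_sum_le_enn_powr:
  assumes "1 < s"
  shows "(\<integral>\<^sup>+ k. ennreal (2 powr ((of_int k + 1) * s - (of_int k - 1))) * y *
      indicator {k. ennreal (2 powr (of_int k - 1)) < y} k \<partial>count_space (UNIV :: int set))
    \<le> ennreal (2 powr (2 * s)) * geometric_sum (s - 1) * enn_powr y s"
proof (cases y)
  case (real r)
  show ?thesis
  proof (cases "r = 0")
    case False
    with real obtain K :: int where K: "2 powr of_int K < r" "r \<le> 2 powr (of_int K + 1)"
      using dyadic_level[of r] by auto
    \<comment> \<open>A contributing index satisfies k - 1 < K + 1, so the last one is at most K + 1
      and the decay is measured from there.\<close>
    have bound: "ennreal (2 powr ((of_int k + 1) * s - (of_int k - 1))) * y *
        indicator {k. ennreal (2 powr (of_int k - 1)) < y} k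
      \<le> ennreal (2 powr (2 * s) * r powr s) * ennreal (2 powr (- (s - 1) * \<bar>of_int (k - (K + 1))\<bar>))"
      for k :: int
    proof (cases "ennreal (2 powr (of_int k - 1)) < y")
      case True
      then have "2 powr (of_int k - 1) < r" using real by (simp add: ennreal_less_iff)
      also have "\<dots> \<le> 2 powr (of_int K + 1)" by (rule K)
      finally have "k - 1 < K + 1" by simp
      then have k: "k \<le> K + 1" by simp
      have "2 powr ((of_int k + 1) * s - (of_int k - 1)) * r
          = 2 powr (2 * s) * ((2 powr of_int K) powr (s - 1) *
              2 powr (- (s - 1) * \<bar>of_int (k - (K + 1))\<bar>)) * r"
        using k by (simp add: powr_powr powr_add[symmetric] algebra_simps)
      also have "\<dots> \<le> 2 powr (2 * s) * (r powr (s - 1) *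
          2 powr (- (s - 1) * \<bar>of_int (k - (K + 1))\<bar>)) * r"
        using K assms real by (intro mult_left_mono mult_right_mono powr_mono2) auto
      also have "\<dots> = 2 powr (2 * s) * r powr s * 2 powr (- (s - 1) * \<bar>of_int (k - (K + 1))\<bar>)"
        using real False by (simp add: powr_diff)
      finally have "ennreal (2 powr ((of_int k + 1) * s - (of_int k - 1)) * r)
        \<le> ennreal (2 powr (2 * s) * r powr s * 2 powr (- (s - 1) * \<bar>of_int (k - (K + 1))\<bar>))"
        by (rule ennreal_leI)
      then show ?thesis using True real by (simp add: ennreal_mult)
    qed simp
    have "(\<integral>\<^sup>+ k. ennreal (2 powr ((of_int k + 1) * s - (of_int k - 1))) * y *
        indicator {k. ennreal (2 powr (of_int k - 1)) < y} k \<partial>count_space UNIV)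
      \<le> (\<integral>\<^sup>+ k. ennreal (2 powr (2 * s) * r powr s) *
          ennreal (2 powr (- (s - 1) * \<bar>of_int (k - (K + 1))\<bar>)) \<partial>count_space UNIV)"
      by (intro nn_integral_mono bound)
    also have "\<dots> = ennreal (2 powr (2 * s) * r powr s) * geometric_sum (s - 1)"
      by (simp only: nn_integral_cmult[OF borel_measurable_count_space] geometric_sum_shift)
    finally show ?thesis
      using real by (simp add: enn_powr_ennreal ennreal_mult mult_ac)
  qed (use real in simp)
next
  case top
  then show ?thesis using geometric_sum_pos[of "s - 1"]
    by (simp add: ennreal_mult_top zero_less_iff_neq_zero)
qed

text \<open>Marcinkiewicz interpolation between the weighted weak-type bound and the trivial bound
  for constants: at each level 2^k only the part of \<open>f\<close> above 2^(k-1) matters, and the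
  levels are then summed pointwise.\<close>

theorem Fefferman_Stein_weighted:
  fixes f u :: "real ^ 'd \<Rightarrow> ennreal"
  assumes [measurable]: "f \<in> borel_measurable borel" "u \<in> borel_measurable borel" and s: "1 < s"
  shows "(\<integral>\<^sup>+ x. enn_powr (cube_max f x) s * u x \<partial>lborel)
    \<le> 3 ^ CARD('d) * (ennreal (2 powr (2 * s)) * geometric_sum (s - 1)) *
      (\<integral>\<^sup>+ x. enn_powr (f x) s * cube_max u x \<partial>lborel)"
proof -
  let ?a = "\<lambda>k::int. ennreal (2 powr ((of_int k + 1) * s))"
  let ?b = "\<lambda>k::int. ennreal (2 powr ((of_int k + 1) * s - (of_int k - 1)))"
  let ?h = "\<lambda>k::int. ennreal (2 powr (of_int k - 1))"
  let ?I = "\<lambda>k::int. indicator {x. ?h k < f x} :: _ \<Rightarrow> ennreal"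
  have level: "?a k * (\<integral>\<^sup>+ x. u x * indicator {x. ennreal (2 powr of_int k) < cube_max f x} x \<partial>lborel)
      \<le> 3 ^ CARD('d) * (\<integral>\<^sup>+ x. ?b k * f x * ?I k x * cube_max u x \<partial>lborel)" for k :: int
  proof -
    \<comment> \<open>The part of \<open>f\<close> at or below half the level has maximal function
      at most 2^(k-1), so where that of \<open>f\<close> exceeds 2^k, that of \<open>g\<close>
      exceeds 2^(k-1).\<close>
    define g where "g = (\<lambda>x. f x * ?I k x)"
    have [measurable]: "g \<in> borel_measurable borel" unfolding g_def by measurable
    have sub: "?h k < cube_max g x" if "ennreal (2 powr of_int k) < cube_max f x" for x
    proof (rule ccontr)
      assume "\<not> ?h k < cube_max g x"
      have "cube_max f x \<le> cube_max (\<lambda>y. g y + ?h k) x"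
        by (intro cube_max_mono) (auto simp: g_def indicator_def)
      also have "\<dots> \<le> cube_max g x + cube_max (\<lambda>y. ?h k) x"
        by (intro cube_max_add_le) auto
      also have "\<dots> \<le> ?h k + ?h k"
        using \<open>\<not> ?h k < cube_max g x\<close> by (intro add_mono cube_max_const_le) auto
      also have "\<dots> = ennreal (2 powr of_int k)"
        by (simp add: powr_diff flip: ennreal_plus)
      finally show False using that by simp
    qed
    have "?a k * (\<integral>\<^sup>+ x. u x * indicator {x. ennreal (2 powr of_int k) < cube_max f x} x \<partial>lborel)
        \<le> ?a k * (\<integral>\<^sup>+ x. u x * indicator {x. ?h k < cube_max g x} x \<partial>lborel)"
      using sub by (intro mult_left_mono nn_integral_mono) (auto simp: indicator_def)
    \<comment> \<open>The half level is split off as the \<open>t\<close> of the weak-type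
      inequality; what is left of the weight is \<open>?b k\<close>.\<close>
    also have "\<dots> = ?b k * (?h k * (\<integral>\<^sup>+ x. u x * indicator {x. ?h k < cube_max g x} x \<partial>lborel))"
      by (simp add: powr_add[symmetric] mult.assoc[symmetric] flip: ennreal_mult)
    also have "\<dots> \<le> ?b k * (3 ^ CARD('d) * (\<integral>\<^sup>+ x. g x * cube_max u x \<partial>lborel))"
      by (intro mult_left_mono cube_max_weak_type) auto
    also have "\<dots> = 3 ^ CARD('d) * (\<integral>\<^sup>+ x. ?b k * (g x * cube_max u x) \<partial>lborel)"
      by (subst nn_integral_cmult) (auto simp: mult_ac)
    finally show ?thesis by (simp add: g_def mult_ac)
  qed
  have "(\<integral>\<^sup>+ x. enn_powr (cube_max f x) s * u x \<partial>lborel)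
      \<le> (\<integral>\<^sup>+ x. (\<integral>\<^sup>+ k. ?a k * (u x * indicator {x. ennreal (2 powr of_int k) < cube_max f x} x)
            \<partial>count_space UNIV) \<partial>lborel)"
  proof (intro nn_integral_mono)
    fix x
    have "enn_powr (cube_max f x) s * u x \<le> (\<integral>\<^sup>+ k. ?a k *
        indicator {k. ennreal (2 powr of_int k) < cube_max f x} k \<partial>count_space (UNIV :: int set)) * u x"
      using s by (intro mult_right_mono enn_powr_le_dyadic_sum) auto
    also have "\<dots> = (\<integral>\<^sup>+ k. ?a k * (u x * indicator {x. ennreal (2 powr of_int k) < cube_max f x} x)
        \<partial>count_space UNIV)"
      by (subst nn_integral_multc[symmetric]) (auto intro!: nn_integral_cong simp: indicator_def)
    finally show "enn_powr (cube_max f x) s * u x \<le> (\<integral>\<^sup>+ k. ?a k *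
        (u x * indicator {x. ennreal (2 powr of_int k) < cube_max f x} x) \<partial>count_space UNIV)" .
  qed
  also have "\<dots> = (\<integral>\<^sup>+ k. ?a k * (\<integral>\<^sup>+ x. u x *
      indicator {x. ennreal (2 powr of_int k) < cube_max f x} x \<partial>lborel) \<partial>count_space UNIV)"
    by (subst nn_integral_count_space_nn_integral) (auto simp: nn_integral_cmult)
  also have "\<dots> \<le> (\<integral>\<^sup>+ k. 3 ^ CARD('d) *
      (\<integral>\<^sup>+ x. ?b k * f x * ?I k x * cube_max u x \<partial>lborel) \<partial>count_space UNIV)"
    by (intro nn_integral_mono level)
  also have "\<dots> = 3 ^ CARD('d) *
      (\<integral>\<^sup>+ x. (\<integral>\<^sup>+ k. ?b k * f x * ?I k x * cube_max u x \<partial>count_space UNIV) \<partial>lborel)"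
    by (subst nn_integral_count_space_nn_integral) (auto simp: nn_integral_cmult)
  also have "\<dots> \<le> 3 ^ CARD('d) * (\<integral>\<^sup>+ x. (ennreal (2 powr (2 * s)) * geometric_sum (s - 1)) *
      (enn_powr (f x) s * cube_max u x) \<partial>lborel)"
  proof (intro mult_left_mono nn_integral_mono)
    fix x
    have "(\<integral>\<^sup>+ k. ?b k * f x * ?I k x * cube_max u x \<partial>count_space UNIV)
        = (\<integral>\<^sup>+ k. ?b k * f x * indicator {k. ?h k < f x} k \<partial>count_space UNIV) * cube_max u x"
      by (subst nn_integral_multc[symmetric]) (auto intro!: nn_integral_cong simp: indicator_def)
    also have "\<dots> \<le> ennreal (2 powr (2 * s)) * geometric_sum (s - 1) * enn_powr (f x) s * cube_max u x"
      by (intro mult_right_mono dyadic_sum_le_enn_powr s) auto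
    finally show "(\<integral>\<^sup>+ k. ?b k * f x * ?I k x * cube_max u x \<partial>count_space UNIV)
        \<le> (ennreal (2 powr (2 * s)) * geometric_sum (s - 1)) * (enn_powr (f x) s * cube_max u x)"
      by (simp add: mult_ac)
  qed simp
  also have "\<dots> = 3 ^ CARD('d) * (ennreal (2 powr (2 * s)) * geometric_sum (s - 1)) *
      (\<integral>\<^sup>+ x. enn_powr (f x) s * cube_max u x \<partial>lborel)"
    by (subst nn_integral_cmult) (auto simp: mult_ac)
  finally show ?thesis .
qed

section \<open>Decay between dyadic shells\<close>

definition maximal_constant :: "nat \<Rightarrow> real \<Rightarrow> ennreal" where
  "maximal_constant d s = 3 ^ d * (ennreal (2 powr (2 * s)) * geometric_sum (s - 1))"

lemma maximal_constant_finite: "1 < s \<Longrightarrow> maximal_constant d s < top"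
  using geometric_sum_finite[of "s - 1"]
  by (auto simp: maximal_constant_def ennreal_mult_less_top power_less_top_ennreal)

text \<open>The weighted inequality with weight 1, whose maximal function is at most 1.\<close>

lemma cube_max_Lp_bound:
  fixes f :: "real ^ 'd \<Rightarrow> ennreal"
  assumes [measurable]: "f \<in> borel_measurable borel" and s: "1 < s"
  shows "(\<integral>\<^sup>+ x. enn_powr (cube_max f x) s \<partial>lborel)
    \<le> maximal_constant CARD('d) s * (\<integral>\<^sup>+ x. enn_powr (f x) s \<partial>lborel)"
proof -
  have "(\<integral>\<^sup>+ x. enn_powr (cube_max f x) s * 1 \<partial>lborel)
    \<le> maximal_constant CARD('d) s * (\<integral>\<^sup>+ x. enn_powr (f x) s * cube_max (\<lambda>y. 1) x \<partial>lborel)"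
    unfolding maximal_constant_def by (intro Fefferman_Stein_weighted s) auto
  also have "\<dots> \<le> maximal_constant CARD('d) s * (\<integral>\<^sup>+ x. enn_powr (f x) s * 1 \<partial>lborel)"
    by (intro mult_left_mono nn_integral_mono cube_max_const_le) auto
  finally show ?thesis by simp
qed

lemma shell_borel [measurable, simp]: "shell k \<in> sets borel"
  by (simp add: shell_def dyadic_cube_def)

text \<open>Side length 2^k means half side 2^(k-1), so in the maximum norm the shell with index k
  is the range from 2^(k-2) up to 2^(k-1).\<close>

lemma mem_shell_iff:
  fixes x :: "real ^ 'd"
  shows "x \<in> shell k \<longleftrightarrow>
    (\<forall>j. \<bar>x $ j\<bar> < 2 powr (of_int k - 1)) \<and> (\<exists>j. 2 powr (of_int k - 2) \<le> \<bar>x $ j\<bar>)"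
proof -
  have "2 powi k / 2 = (2 powr (of_int k - 1) :: real)"
    "2 powi (k - 1) / 2 = (2 powr (of_int k - 2) :: real)"
    by (auto simp: powr_diff powr_real_of_int' power_int_diff)
  then show ?thesis
    by (auto simp: shell_def dyadic_cube_def cube_def not_less)
qed

lemma emeasure_shell_le:
  "emeasure lborel (shell k :: (real ^ 'd) set) \<le> ennreal (2 powr (of_int k * real CARD('d)))"
proof -
  have "emeasure lborel (shell k :: (real ^ 'd) set) \<le> emeasure lborel (cube 0 (2 powi k) :: (real ^ 'd) set)"
    by (intro emeasure_mono) (auto simp: shell_def dyadic_cube_def)
  also have "\<dots> = ennreal ((2 powi k) ^ CARD('d))"
    by (simp add: emeasure_cube)
  also have "(2 powi k) ^ CARD('d) = 2 powr (of_int k * real CARD('d))"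
    by (simp add: powr_powr[symmetric] powr_real_of_int' powr_realpow)
  finally show ?thesis .
qed

text \<open>Adjacent shells touch, hence the gap of two. The outer point has a coordinate of size at
  least 2^(b-2), while all coordinates of the inner one are below 2^(b-3), where b is the larger
  index.\<close>

lemma shell_separation:
  fixes x y :: "real ^ 'd"
  assumes "x \<in> shell i" "y \<in> shell k" "2 \<le> \<bar>i - k\<bar>"
  shows "\<exists>j. 2 powr (of_int (max i k) - 3) \<le> \<bar>x $ j - y $ j\<bar>"
proof -
  have gap: "\<exists>j. 2 powr (of_int b - 3) \<le> \<bar>u $ j - v $ j\<bar>"
    if uv: "u \<in> shell a" "v \<in> shell b" "a + 2 \<le> b" for u v :: "real ^ 'd" and a b
  proof -
    obtain j where j: "2 powr (of_int b - 2) \<le> \<bar>v $ j\<bar>" using uv by (auto simp: mem_shell_iff)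
    have "\<bar>u $ j\<bar> < 2 powr (of_int a - 1)" using uv by (auto simp: mem_shell_iff)
    also have "\<dots> \<le> 2 powr (of_int b - 3)" using that by simp
    finally have "\<bar>u $ j\<bar> < 2 powr (of_int b - 3)" .
    moreover have "2 powr (of_int b - 2) = 2 * 2 powr (of_int b - 3 :: real)"
      using powr_add[of 2 1 "of_int b - 3 :: real"] by simp
    ultimately have "2 powr (of_int b - 3) \<le> \<bar>u $ j - v $ j\<bar>" using j by linarith
    then show ?thesis ..
  qed
  show ?thesis
  proof (cases "i \<le> k")
    case True
    then show ?thesis using gap[of x i y k] assms by (simp add: max_def)
  next
    case False
    then show ?thesis using gap[of y k x i] assms by (simp add: max_def abs_minus_commute)
  qed
qed

text \<open>A cube that contains \<open>x\<close> and meets the support has side at least 2^(max i k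
  - 3), so its average is at most the whole integral over that volume.\<close>

lemma cube_max_far_shell:
  fixes u :: "real ^ 'd \<Rightarrow> ennreal"
  assumes supp: "\<And>y. y \<notin> shell k \<Longrightarrow> u y = 0" and x: "x \<in> shell i" and far: "2 \<le> \<bar>i - k\<bar>"
  shows "cube_max u x \<le> ennreal (2 powr ((3 - of_int (max i k)) * real CARD('d))) * (\<integral>\<^sup>+ y. u y \<partial>lborel)"
proof (rule cube_max_leI)
  fix Q :: "(real ^ 'd) set" assume Q: "Q \<in> rat_cubes" "x \<in> Q"
  then obtain c r where cr: "Q = cube c r" "0 < r" by (auto simp: rat_cubes_def)
  let ?h = "2 powr (of_int (max i k) - 3) :: real"
  show "(\<integral>\<^sup>+ y. u y * indicator Q y \<partial>lborel) / emeasure lborel Q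
    \<le> ennreal (2 powr ((3 - of_int (max i k)) * real CARD('d))) * (\<integral>\<^sup>+ y. u y \<partial>lborel)"
  proof (cases "Q \<inter> shell k = {}")
    case True
    then have "(\<integral>\<^sup>+ y. u y * indicator Q y \<partial>lborel) = (\<integral>\<^sup>+ y. 0 \<partial>(lborel :: (real ^ 'd) measure))"
      using supp by (intro nn_integral_cong) (auto simp: indicator_def)
    then show ?thesis by simp
  next
    case False
    then obtain y where y: "y \<in> Q" "y \<in> shell k" by auto
    obtain j where j: "?h \<le> \<bar>x $ j - y $ j\<bar>" using shell_separation[OF x y(2) far] by auto
    have "\<bar>x $ j - c $ j\<bar> < r / 2" "\<bar>y $ j - c $ j\<bar> < r / 2" using Q(2) y(1) by (auto simp: cr cube_def)
    with j have "?h \<le> r" by linarith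
    then have "?h ^ CARD('d) \<le> r ^ CARD('d)" by (intro power_mono) auto
    then have vol: "inverse (r ^ CARD('d)) \<le> inverse (?h ^ CARD('d))" by (intro le_imp_inverse_le) auto
    have "(\<integral>\<^sup>+ y. u y * indicator Q y \<partial>lborel) / emeasure lborel Q
        = ennreal (inverse (r ^ CARD('d))) * (\<integral>\<^sup>+ y. u y * indicator Q y \<partial>lborel)"
      using cr by (simp add: emeasure_cube divide_ennreal_def inverse_ennreal mult.commute)
    also have "\<dots> \<le> ennreal (inverse (?h ^ CARD('d))) * (\<integral>\<^sup>+ y. u y \<partial>lborel)"
      using vol by (intro mult_mono nn_integral_mono ennreal_leI) (auto simp: indicator_def)
    also have "inverse (?h ^ CARD('d)) = 2 powr ((3 - of_int (max i k)) * real CARD('d))"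
    proof -
      have "?h ^ CARD('d) = 2 powr ((of_int (max i k) - 3) * real CARD('d))"
        by (simp add: powr_powr[symmetric] powr_realpow)
      then have "inverse (?h ^ CARD('d)) = 2 powr (- ((of_int (max i k) - 3) * real CARD('d)))"
        by (simp only: powr_minus)
      then show ?thesis by (simp add: algebra_simps)
    qed
    finally show ?thesis .
  qed
qed

text \<open>The decay of the s-th power of the L^s norm, where \<open>t\<close> is the index of the
  shell of evaluation minus that of the support. Combining the pointwise bound 2^(-d max(i,k)) with
  Hoelder and the volume of the target gives the exponent - d s max(i,k) + k d (s - 1) + i d, and
  the two branches are its values for i \<le> k and i > k.\<close>

definition shell_decay :: "nat \<Rightarrow> real \<Rightarrow> int \<Rightarrow> real" where
  "shell_decay d s t = (if t \<le> 0 then 2 powr (of_int t * real d)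
     else 2 powr (- of_int t * real d * (s - 1)))"

text \<open>Hoelder against the indicator of the shell; raising the conjugate norm to the power
  \<open>s\<close> leaves the volume to the power s - 1.\<close>

lemma nn_integral_powr_le_shell:
  fixes u :: "real ^ 'd \<Rightarrow> ennreal"
  assumes [measurable]: "u \<in> borel_measurable borel" and supp: "\<And>y. y \<notin> shell k \<Longrightarrow> u y = 0" and s: "1 < s"
  shows "enn_powr (\<integral>\<^sup>+ y. u y \<partial>lborel) s
    \<le> ennreal (2 powr (of_int k * real CARD('d) * (s - 1))) * (\<integral>\<^sup>+ y. enn_powr (u y) s \<partial>lborel)"
proof -
  define s' where "s' = s / (s - 1)"
  have s': "1 < s'" "1 / s + 1 / s' = 1" "1 / s' * s = s - 1"
    using s by (auto simp: s'_def field_simps)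
  have "(\<integral>\<^sup>+ y. u y \<partial>lborel) = (\<integral>\<^sup>+ y. u y * indicator (shell k) y \<partial>lborel)"
    using supp by (intro nn_integral_cong) (auto simp: indicator_def)
  also have "\<dots> \<le> Lq lborel s u * Lq lborel s' (indicator (shell k :: (real ^ 'd) set))"
    using s s' by (intro Holder_inequality_nn_integral) auto
  finally have "enn_powr (\<integral>\<^sup>+ y. u y \<partial>lborel) s \<le> enn_powr (Lq lborel s u * Lq lborel s' (indicator (shell k :: (real ^ 'd) set))) s"
    using s by (intro enn_powr_mono) auto
  also have "\<dots> = (\<integral>\<^sup>+ y. enn_powr (u y) s \<partial>lborel) * enn_powr (Lq lborel s' (indicator (shell k :: (real ^ 'd) set))) s"
    using s by (simp add: enn_powr_mult Lq_powr)
  also have "enn_powr (Lq lborel s' (indicator (shell k :: (real ^ 'd) set))) s = enn_powr (emeasure lborel (shell k :: (real ^ 'd) set)) (s - 1)"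
  proof -
    have "enn_powr (indicator (shell k) x) s' = indicator (shell k) x" for x :: "real ^ 'd"
      by (auto simp: indicator_def)
    then show ?thesis using s'(3) by (simp add: Lq_def enn_powr_powr)
  qed
  also have "\<dots> \<le> enn_powr (ennreal (2 powr (of_int k * real CARD('d)))) (s - 1)"
    using s by (intro enn_powr_mono emeasure_shell_le) auto
  also have "\<dots> = ennreal (2 powr (of_int k * real CARD('d) * (s - 1)))"
    by (simp add: enn_powr_ennreal powr_powr)
  finally have "enn_powr (\<integral>\<^sup>+ y. u y \<partial>lborel) s
    \<le> (\<integral>\<^sup>+ y. enn_powr (u y) s \<partial>lborel) * ennreal (2 powr (of_int k * real CARD('d) * (s - 1)))"
    by (simp add: mult_left_mono)
  then show ?thesis by (simp only: mult.commute)
qed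

text \<open>Well separated shells are governed by the pointwise bound, equal or adjacent ones by the
  unweighted L^s inequality. The summand 1 in the constant lets one constant cover both
  cases.\<close>

lemma cube_max_shell_decay:
  assumes s: "1 < s"
  obtains C :: ennreal where "C < top"
    "\<And>i k u. u \<in> borel_measurable borel \<Longrightarrow> (\<And>y :: real ^ 'd. y \<notin> shell k \<Longrightarrow> u y = 0) \<Longrightarrow>
      (\<integral>\<^sup>+ x. enn_powr (cube_max u x) s * indicator (shell i) x \<partial>lborel)
        \<le> C * ennreal (shell_decay CARD('d) s (i - k)) * (\<integral>\<^sup>+ x. enn_powr (u x) s \<partial>lborel)"
proof
  let ?d = "real CARD('d)"
  define C where "C = (maximal_constant CARD('d) s + 1) * ennreal (2 powr (3 * ?d * s))"
  show "C < top"
    using maximal_constant_finite[OF s] by (simp add: C_def ennreal_mult_less_top)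
  fix i k and u :: "real ^ 'd \<Rightarrow> ennreal"
  assume [measurable]: "u \<in> borel_measurable borel" and supp: "\<And>y. y \<notin> shell k \<Longrightarrow> u y = 0"
  let ?w = "shell_decay CARD('d) s (i - k)" and ?U = "\<integral>\<^sup>+ x. enn_powr (u x) s \<partial>lborel"
  show "(\<integral>\<^sup>+ x. enn_powr (cube_max u x) s * indicator (shell i) x \<partial>lborel) \<le> C * ennreal ?w * ?U"
  proof (cases "2 \<le> \<bar>i - k\<bar>")
    case True
    define m where "m = max i k"
    let ?A = "2 powr ((3 - of_int m) * ?d) :: real"
    have "(\<integral>\<^sup>+ x. enn_powr (cube_max u x) s * indicator (shell i) x \<partial>lborel)
        \<le> (\<integral>\<^sup>+ x. enn_powr (ennreal ?A * (\<integral>\<^sup>+ y. u y \<partial>lborel)) s * indicator (shell i :: (real ^ 'd) set) x \<partial>lborel)"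
      using s cube_max_far_shell[OF supp _ True]
      by (intro nn_integral_mono) (auto simp: indicator_def m_def intro!: enn_powr_mono)
    also have "\<dots> = ennreal (?A powr s) * enn_powr (\<integral>\<^sup>+ y. u y \<partial>lborel) s * emeasure lborel (shell i :: (real ^ 'd) set)"
      using s by (simp add: nn_integral_cmult_indicator enn_powr_mult enn_powr_ennreal)
    also have "\<dots> \<le> ennreal (?A powr s) * (ennreal (2 powr (of_int k * ?d * (s - 1))) * ?U) *
        ennreal (2 powr (of_int i * ?d))"
      using s supp by (intro mult_mono mult_left_mono emeasure_shell_le nn_integral_powr_le_shell) auto
    also have "\<dots> = ennreal (?A powr s * 2 powr (of_int k * ?d * (s - 1)) * 2 powr (of_int i * ?d)) * ?U"
      by (simp add: ennreal_mult mult_ac)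
    also have "?A powr s * 2 powr (of_int k * ?d * (s - 1)) * 2 powr (of_int i * ?d)
        = 2 powr (3 * ?d * s) * ?w"
    proof -
      have "?A powr s * 2 powr (of_int k * ?d * (s - 1)) * 2 powr (of_int i * ?d)
        = 2 powr ((3 - of_int m) * ?d * s + of_int k * ?d * (s - 1) + of_int i * ?d)"
        by (simp add: powr_powr powr_add)
      also have "(3 - of_int m) * ?d * s + of_int k * ?d * (s - 1) + of_int i * ?d
        = 3 * ?d * s + (if i - k \<le> 0 then of_int (i - k) * ?d else - of_int (i - k) * ?d * (s - 1))"
        using True by (simp add: m_def max_def algebra_simps)
      finally show ?thesis by (simp add: shell_decay_def powr_add)
    qed
    also have "ennreal (2 powr (3 * ?d * s) * ?w) * ?U = 1 * ennreal (2 powr (3 * ?d * s)) * ennreal ?w * ?U"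
      by (simp add: ennreal_mult shell_decay_def)
    also have "\<dots> \<le> C * ennreal ?w * ?U"
      unfolding C_def by (intro mult_right_mono) auto
    finally show ?thesis .
  next
    case False
    \<comment> \<open>Here |i - k| \<le> 1, so the decay factor is at least 2^(-d max(1, s - 1)),
      which 2^(3 d s) outweighs.\<close>
    have w: "1 \<le> 2 powr (3 * ?d * s) * ?w"
    proof -
      have "0 \<le> 3 * ?d * s + (if i - k \<le> 0 then of_int (i - k) * ?d else - of_int (i - k) * ?d * (s - 1))"
      proof -
        consider "i - k = 0" | "i - k = 1" | "i - k = - 1" using False by linarith
        then show ?thesis using s by cases (auto simp: algebra_simps)
      qed
      then have "1 \<le> 2 powr (3 * ?d * s + (if i - k \<le> 0 then of_int (i - k) * ?d else - of_int (i - k) * ?d * (s - 1)))"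
        by (intro ge_one_powr_ge_zero) auto
      then show ?thesis by (simp add: shell_decay_def powr_add split: if_splits)
    qed
    have "(\<integral>\<^sup>+ x. enn_powr (cube_max u x) s * indicator (shell i) x \<partial>lborel)
        \<le> (\<integral>\<^sup>+ x. enn_powr (cube_max u x) s \<partial>lborel)"
      by (intro nn_integral_mono) (auto simp: indicator_def)
    also have "\<dots> \<le> maximal_constant CARD('d) s * 1 * ?U"
      using cube_max_Lp_bound[of u s] s by simp
    also have "\<dots> \<le> (maximal_constant CARD('d) s + 1) * ennreal (2 powr (3 * ?d * s) * ?w) * ?U"
      using w by (intro mult_right_mono mult_mono) auto
    also have "\<dots> = C * ennreal ?w * ?U"
      by (simp add: C_def ennreal_mult shell_decay_def mult.assoc)
    finally show ?thesis .
  qed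
qed

section \<open>Maximal operators in each variable of the product\<close>

definition max1 :: "((real ^ 'n) \<times> (real ^ 'm) \<Rightarrow> ennreal) \<Rightarrow> (real ^ 'n) \<times> (real ^ 'm) \<Rightarrow> ennreal" where
  "max1 f z = cube_max (\<lambda>x. f (x, snd z)) (fst z)"

definition max2 :: "((real ^ 'n) \<times> (real ^ 'm) \<Rightarrow> ennreal) \<Rightarrow> (real ^ 'n) \<times> (real ^ 'm) \<Rightarrow> ennreal" where
  "max2 f z = cube_max (\<lambda>y. f (fst z, y)) (snd z)"

lemma max1_measurable [measurable (raw)]:
  fixes f :: "(real ^ 'n) \<times> (real ^ 'm) \<Rightarrow> ennreal"
  assumes "f \<in> borel_measurable borel"
  shows "max1 f \<in> borel_measurable borel"
proof -
  have "(\<lambda>(x, t). cube_max (\<lambda>y. f (y, t)) x) \<in> borel_measurable (borel \<Otimes>\<^sub>M borel)"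
    using assms by (intro cube_max_measurable_param) (simp add: borel_prod)
  then show ?thesis by (simp add: max1_def[abs_def] borel_prod case_prod_unfold)
qed

lemma max2_measurable [measurable (raw)]:
  fixes f :: "(real ^ 'n) \<times> (real ^ 'm) \<Rightarrow> ennreal"
  assumes "f \<in> borel_measurable borel"
  shows "max2 f \<in> borel_measurable borel"
proof -
  have [measurable]: "f \<in> borel_measurable (borel \<Otimes>\<^sub>M borel)" using assms by (simp add: borel_prod)
  have "(\<lambda>(y, x). cube_max (\<lambda>y'. f (x, y')) y) \<in> borel_measurable (borel \<Otimes>\<^sub>M borel)"
    by (intro cube_max_measurable_param) measurable
  from measurable_compose[OF measurable_pair_swap' this]
  show ?thesis by (simp add: max2_def[abs_def] borel_prod case_prod_unfold)
qed

lemma section_measurable: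
  fixes f :: "(real ^ 'n) \<times> (real ^ 'm) \<Rightarrow> ennreal"
  assumes "f \<in> borel_measurable borel"
  shows "(\<lambda>x. f (x, y)) \<in> borel_measurable borel" "(\<lambda>y. f (x, y)) \<in> borel_measurable borel"
proof -
  have [measurable]: "f \<in> borel_measurable (borel \<Otimes>\<^sub>M borel)" using assms by (simp add: borel_prod)
  show "(\<lambda>x. f (x, y)) \<in> borel_measurable borel" "(\<lambda>y. f (x, y)) \<in> borel_measurable borel"
    by measurable
qed

lemma Tonelli_lborel:
  fixes f :: "(real ^ 'n) \<times> (real ^ 'm) \<Rightarrow> ennreal"
  assumes "f \<in> borel_measurable borel"
  shows "(\<integral>\<^sup>+ z. f z \<partial>lborel) = (\<integral>\<^sup>+ x. (\<integral>\<^sup>+ y. f (x, y) \<partial>lborel) \<partial>lborel)"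
    and "(\<integral>\<^sup>+ z. f z \<partial>lborel) = (\<integral>\<^sup>+ y. (\<integral>\<^sup>+ x. f (x, y) \<partial>lborel) \<partial>lborel)"
proof -
  have f: "f \<in> borel_measurable (lborel \<Otimes>\<^sub>M lborel)" using assms by (simp add: lborel_prod)
  show "(\<integral>\<^sup>+ z. f z \<partial>lborel) = (\<integral>\<^sup>+ x. (\<integral>\<^sup>+ y. f (x, y) \<partial>lborel) \<partial>lborel)"
    using lborel.nn_integral_fst[OF f] by (simp add: lborel_prod)
  show "(\<integral>\<^sup>+ z. f z \<partial>lborel) = (\<integral>\<^sup>+ y. (\<integral>\<^sup>+ x. f (x, y) \<partial>lborel) \<partial>lborel)"
    using lborel_pair.nn_integral_snd[OF f] by (simp add: lborel_prod)
qed

text \<open>The one-variable inequality on each slice with the second variable frozen, integrated by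
  Tonelli.\<close>

lemma max1_weighted:
  fixes f u :: "(real ^ 'n) \<times> (real ^ 'm) \<Rightarrow> ennreal"
  assumes [measurable]: "f \<in> borel_measurable borel" "u \<in> borel_measurable borel" and s: "1 < s"
  shows "(\<integral>\<^sup>+ z. enn_powr (max1 f z) s * u z \<partial>lborel)
    \<le> maximal_constant CARD('n) s * (\<integral>\<^sup>+ z. enn_powr (f z) s * max1 u z \<partial>lborel)"
proof -
  have "(\<integral>\<^sup>+ z. enn_powr (max1 f z) s * u z \<partial>lborel)
      = (\<integral>\<^sup>+ y. (\<integral>\<^sup>+ x. enn_powr (cube_max (\<lambda>x. f (x, y)) x) s * u (x, y) \<partial>lborel) \<partial>lborel)"
  proof -
    have "(\<lambda>z. enn_powr (max1 f z) s * u z) \<in> borel_measurable borel" by measurable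
    from Tonelli_lborel(2)[OF this] show ?thesis by (simp only: max1_def fst_conv snd_conv)
  qed
  also have "\<dots> \<le> (\<integral>\<^sup>+ y. maximal_constant CARD('n) s *
      (\<integral>\<^sup>+ x. enn_powr (f (x, y)) s * cube_max (\<lambda>x. u (x, y)) x \<partial>lborel) \<partial>lborel)"
    unfolding maximal_constant_def
    by (intro nn_integral_mono Fefferman_Stein_weighted section_measurable s assms)
  also have "\<dots> = (\<integral>\<^sup>+ y. (\<integral>\<^sup>+ x. maximal_constant CARD('n) s * (enn_powr (f (x, y)) s * max1 u (x, y)) \<partial>lborel) \<partial>lborel)"
  proof (intro nn_integral_cong)
    fix y
    have [measurable]: "(\<lambda>x. f (x, y)) \<in> borel_measurable borel" by (intro section_measurable assms)
    show "maximal_constant CARD('n) s * (\<integral>\<^sup>+ x. enn_powr (f (x, y)) s * cube_max (\<lambda>x. u (x, y)) x \<partial>lborel)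
      = (\<integral>\<^sup>+ x. maximal_constant CARD('n) s * (enn_powr (f (x, y)) s * max1 u (x, y)) \<partial>lborel)"
      unfolding max1_def fst_conv snd_conv by (rule nn_integral_cmult[symmetric]) measurable
  qed
  also have "\<dots> = (\<integral>\<^sup>+ z. maximal_constant CARD('n) s * (enn_powr (f z) s * max1 u z) \<partial>lborel)"
    by (subst Tonelli_lborel(2)) auto
  also have "\<dots> = maximal_constant CARD('n) s * (\<integral>\<^sup>+ z. enn_powr (f z) s * max1 u z \<partial>lborel)"
    by (rule nn_integral_cmult) auto
  finally show ?thesis .
qed

lemma max2_weighted:
  fixes f u :: "(real ^ 'n) \<times> (real ^ 'm) \<Rightarrow> ennreal"
  assumes [measurable]: "f \<in> borel_measurable borel" "u \<in> borel_measurable borel" and s: "1 < s"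
  shows "(\<integral>\<^sup>+ z. enn_powr (max2 f z) s * u z \<partial>lborel)
    \<le> maximal_constant CARD('m) s * (\<integral>\<^sup>+ z. enn_powr (f z) s * max2 u z \<partial>lborel)"
proof -
  have "(\<integral>\<^sup>+ z. enn_powr (max2 f z) s * u z \<partial>lborel)
      = (\<integral>\<^sup>+ x. (\<integral>\<^sup>+ y. enn_powr (cube_max (\<lambda>y. f (x, y)) y) s * u (x, y) \<partial>lborel) \<partial>lborel)"
  proof -
    have "(\<lambda>z. enn_powr (max2 f z) s * u z) \<in> borel_measurable borel" by measurable
    from Tonelli_lborel(1)[OF this] show ?thesis by (simp only: max2_def fst_conv snd_conv)
  qed
  also have "\<dots> \<le> (\<integral>\<^sup>+ x. maximal_constant CARD('m) s *
      (\<integral>\<^sup>+ y. enn_powr (f (x, y)) s * cube_max (\<lambda>y. u (x, y)) y \<partial>lborel) \<partial>lborel)"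
    unfolding maximal_constant_def
    by (intro nn_integral_mono Fefferman_Stein_weighted section_measurable s assms)
  also have "\<dots> = (\<integral>\<^sup>+ x. (\<integral>\<^sup>+ y. maximal_constant CARD('m) s * (enn_powr (f (x, y)) s * max2 u (x, y)) \<partial>lborel) \<partial>lborel)"
  proof (intro nn_integral_cong)
    fix x
    have [measurable]: "(\<lambda>y. f (x, y)) \<in> borel_measurable borel" by (intro section_measurable assms)
    show "maximal_constant CARD('m) s * (\<integral>\<^sup>+ y. enn_powr (f (x, y)) s * cube_max (\<lambda>y. u (x, y)) y \<partial>lborel)
      = (\<integral>\<^sup>+ y. maximal_constant CARD('m) s * (enn_powr (f (x, y)) s * max2 u (x, y)) \<partial>lborel)"
      unfolding max2_def fst_conv snd_conv by (rule nn_integral_cmult[symmetric]) measurable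
  qed
  also have "\<dots> = (\<integral>\<^sup>+ z. maximal_constant CARD('m) s * (enn_powr (f z) s * max2 u z) \<partial>lborel)"
    by (subst Tonelli_lborel(1)) auto
  also have "\<dots> = maximal_constant CARD('m) s * (\<integral>\<^sup>+ z. enn_powr (f z) s * max2 u z \<partial>lborel)"
    by (rule nn_integral_cmult) auto
  finally show ?thesis .
qed

text \<open>The outer operator is transferred to the weight first, so the two operators act on
  \<open>u\<close> in the reverse order.\<close>

lemma iterated_weighted:
  fixes f u :: "(real ^ 'n) \<times> (real ^ 'm) \<Rightarrow> ennreal"
  assumes [measurable]: "f \<in> borel_measurable borel" "u \<in> borel_measurable borel" and s: "1 < s"
  shows "(\<integral>\<^sup>+ z. enn_powr (max2 (max1 f) z) s * u z \<partial>lborel)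
    \<le> maximal_constant CARD('m) s * maximal_constant CARD('n) s *
      (\<integral>\<^sup>+ z. enn_powr (f z) s * max1 (max2 u) z \<partial>lborel)"
proof -
  have "(\<integral>\<^sup>+ z. enn_powr (max2 (max1 f) z) s * u z \<partial>lborel)
      \<le> maximal_constant CARD('m) s * (\<integral>\<^sup>+ z. enn_powr (max1 f z) s * max2 u z \<partial>lborel)"
    by (intro max2_weighted s) auto
  also have "\<dots> \<le> maximal_constant CARD('m) s * (maximal_constant CARD('n) s *
      (\<integral>\<^sup>+ z. enn_powr (f z) s * max1 (max2 u) z \<partial>lborel))"
    by (intro mult_left_mono max1_weighted s) auto
  finally show ?thesis by (simp only: mult.assoc)
qed

text \<open>Tonelli lets the one-variable decay be applied first to the outer operator in x and then
  to the inner one in y, so the two factors multiply.\<close>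

lemma iterated_shell_decay:
  assumes s: "1 < s"
  obtains C :: ennreal where "C < top"
    "\<And>i j k l (u :: (real ^ 'n) \<times> (real ^ 'm) \<Rightarrow> ennreal). u \<in> borel_measurable borel \<Longrightarrow>
      (\<And>z. z \<notin> shell k \<times> shell l \<Longrightarrow> u z = 0) \<Longrightarrow>
      (\<integral>\<^sup>+ z. enn_powr (max1 (max2 u) z) s * indicator (shell i \<times> shell j) z \<partial>lborel)
        \<le> C * ennreal (shell_decay CARD('n) s (i - k) * shell_decay CARD('m) s (j - l)) *
          (\<integral>\<^sup>+ z. enn_powr (u z) s \<partial>lborel)"
proof -
  obtain C1 :: ennreal where C1: "C1 < top" and decay1:
    "\<And>i k u. u \<in> borel_measurable borel \<Longrightarrow> (\<And>y :: real ^ 'n. y \<notin> shell k \<Longrightarrow> u y = 0) \<Longrightarrow>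
      (\<integral>\<^sup>+ x. enn_powr (cube_max u x) s * indicator (shell i) x \<partial>lborel)
        \<le> C1 * ennreal (shell_decay CARD('n) s (i - k)) * (\<integral>\<^sup>+ x. enn_powr (u x) s \<partial>lborel)"
    by (rule cube_max_shell_decay[OF s, where 'd = 'n]) blast
  obtain C2 :: ennreal where C2: "C2 < top" and decay2:
    "\<And>i k u. u \<in> borel_measurable borel \<Longrightarrow> (\<And>y :: real ^ 'm. y \<notin> shell k \<Longrightarrow> u y = 0) \<Longrightarrow>
      (\<integral>\<^sup>+ x. enn_powr (cube_max u x) s * indicator (shell i) x \<partial>lborel)
        \<le> C2 * ennreal (shell_decay CARD('m) s (i - k)) * (\<integral>\<^sup>+ x. enn_powr (u x) s \<partial>lborel)"
    by (rule cube_max_shell_decay[OF s, where 'd = 'm]) blast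
  show ?thesis
  proof
    show "C1 * C2 < top" using C1 C2 by (simp add: ennreal_mult_less_top)
    fix i j k l and u :: "(real ^ 'n) \<times> (real ^ 'm) \<Rightarrow> ennreal"
    assume u [measurable]: "u \<in> borel_measurable borel"
      and supp: "\<And>z. z \<notin> shell k \<times> shell l \<Longrightarrow> u z = 0"
    let ?w1 = "ennreal (shell_decay CARD('n) s (i - k))" and ?w2 = "ennreal (shell_decay CARD('m) s (j - l))"
    have [measurable]: "(shell i :: (real ^ 'n) set) \<times> (shell j :: (real ^ 'm) set) \<in> sets borel" for i j
      unfolding borel_prod[symmetric] by (intro pair_measureI) auto
    have [measurable]: "(UNIV :: (real ^ 'n) set) \<times> (shell j :: (real ^ 'm) set) \<in> sets borel" for j
      unfolding borel_prod[symmetric] by (intro pair_measureI) auto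
    \<comment> \<open>The operator in y spreads mass only along vertical slices and so keeps the
      support in x inside \<open>shell k\<close>, as the decay in the first variable
      requires.\<close>
    have supp2: "max2 u (x, y) = 0" if "x \<notin> shell k" for x y
      using supp that by (simp add: max2_def)
    have ind: "indicator (shell i \<times> shell j) (x, y) = indicator (shell i) x * (indicator (shell j) y :: ennreal)"
      for x :: "real ^ 'n" and y :: "real ^ 'm" by (auto simp: indicator_def)
    have "(\<integral>\<^sup>+ z. enn_powr (max1 (max2 u) z) s * indicator (shell i \<times> shell j) z \<partial>lborel)
        = (\<integral>\<^sup>+ y. (\<integral>\<^sup>+ x. enn_powr (max1 (max2 u) (x, y)) s * indicator (shell i \<times> shell j) (x, y) \<partial>lborel) \<partial>lborel)"
      by (rule Tonelli_lborel(2)) measurable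
    also have "\<dots> = (\<integral>\<^sup>+ y. (\<integral>\<^sup>+ x. enn_powr (cube_max (\<lambda>x. max2 u (x, y)) x) s * indicator (shell i) x \<partial>lborel) *
            indicator (shell j) y \<partial>lborel)"
    proof (intro nn_integral_cong)
      fix y :: "real ^ 'm"
      show "(\<integral>\<^sup>+ x. enn_powr (max1 (max2 u) (x, y)) s * indicator (shell i \<times> shell j) (x, y) \<partial>lborel)
        = (\<integral>\<^sup>+ x. enn_powr (cube_max (\<lambda>x. max2 u (x, y)) x) s * indicator (shell i) x \<partial>lborel) * indicator (shell j) y"
        unfolding max1_def fst_conv snd_conv ind mult.assoc[symmetric] by (rule nn_integral_multc) measurable
    qed
    also have "\<dots> \<le> (\<integral>\<^sup>+ y. C1 * ?w1 * (\<integral>\<^sup>+ x. enn_powr (max2 u (x, y)) s \<partial>lborel) * indicator (shell j) y \<partial>lborel)"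
      by (intro nn_integral_mono mult_right_mono decay1 section_measurable supp2) auto
    also have "\<dots> = (\<integral>\<^sup>+ y. (\<integral>\<^sup>+ x. C1 * ?w1 * (enn_powr (max2 u (x, y)) s * indicator (UNIV \<times> shell j) (x, y)) \<partial>lborel) \<partial>lborel)"
    proof (intro nn_integral_cong)
      fix y :: "real ^ 'm"
      have [measurable]: "(\<lambda>x. max2 u (x, y)) \<in> borel_measurable borel" by (intro section_measurable) auto
      show "C1 * ?w1 * (\<integral>\<^sup>+ x. enn_powr (max2 u (x, y)) s \<partial>lborel) * indicator (shell j) y
        = (\<integral>\<^sup>+ x. C1 * ?w1 * (enn_powr (max2 u (x, y)) s * indicator (UNIV \<times> shell j) (x, y)) \<partial>lborel)"
        by (subst nn_integral_cmult) (auto simp: indicator_def)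
    qed
    also have "\<dots> = (\<integral>\<^sup>+ z. C1 * ?w1 * (enn_powr (max2 u z) s * indicator (UNIV \<times> shell j) z) \<partial>lborel)"
      by (subst Tonelli_lborel(2)) auto
    also have "\<dots> = C1 * ?w1 * (\<integral>\<^sup>+ z. enn_powr (max2 u z) s * indicator (UNIV \<times> shell j) z \<partial>lborel)"
      by (rule nn_integral_cmult) auto
    also have "(\<integral>\<^sup>+ z. enn_powr (max2 u z) s * indicator (UNIV \<times> shell j) z \<partial>lborel)
        = (\<integral>\<^sup>+ x. (\<integral>\<^sup>+ y. enn_powr (max2 u (x, y)) s * indicator (UNIV \<times> shell j) (x, y) \<partial>lborel) \<partial>lborel)"
      by (rule Tonelli_lborel(1)) measurable
    also have "\<dots> = (\<integral>\<^sup>+ x. (\<integral>\<^sup>+ y. enn_powr (cube_max (\<lambda>y. u (x, y)) y) s * indicator (shell j) y \<partial>lborel) \<partial>lborel)"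
      by (auto simp: max2_def indicator_def intro!: nn_integral_cong)
    also have "\<dots> \<le> (\<integral>\<^sup>+ x. C2 * ?w2 * (\<integral>\<^sup>+ y. enn_powr (u (x, y)) s \<partial>lborel) \<partial>lborel)"
      by (intro nn_integral_mono decay2 section_measurable supp) auto
    also have "\<dots> = (\<integral>\<^sup>+ x. (\<integral>\<^sup>+ y. C2 * ?w2 * enn_powr (u (x, y)) s \<partial>lborel) \<partial>lborel)"
      by (intro nn_integral_cong nn_integral_cmult[symmetric]) (auto intro!: enn_powr_measurable section_measurable)
    also have "\<dots> = (\<integral>\<^sup>+ z. C2 * ?w2 * enn_powr (u z) s \<partial>lborel)"
      by (subst Tonelli_lborel(1)) auto
    also have "\<dots> = C2 * ?w2 * (\<integral>\<^sup>+ z. enn_powr (u z) s \<partial>lborel)"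
      by (rule nn_integral_cmult) auto
    finally have "(\<integral>\<^sup>+ z. enn_powr (max1 (max2 u) z) s * indicator (shell i \<times> shell j) z \<partial>lborel)
        \<le> C1 * ?w1 * (C2 * ?w2 * (\<integral>\<^sup>+ z. enn_powr (u z) s \<partial>lborel))"
      by (simp add: mult_left_mono)
    also have "\<dots> = C1 * C2 * ennreal (shell_decay CARD('n) s (i - k) * shell_decay CARD('m) s (j - l)) *
          (\<integral>\<^sup>+ z. enn_powr (u z) s \<partial>lborel)"
      by (subst ennreal_mult) (auto simp: shell_decay_def mult_ac)
    finally show "(\<integral>\<^sup>+ z. enn_powr (max1 (max2 u) z) s * indicator (shell i \<times> shell j) z \<partial>lborel)
        \<le> C1 * C2 * ennreal (shell_decay CARD('n) s (i - k) * shell_decay CARD('m) s (j - l)) *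
          (\<integral>\<^sup>+ z. enn_powr (u z) s \<partial>lborel)" .
  qed
qed

section \<open>The vector-valued block estimate\<close>

text \<open>Cancels \<open>enn_powr X (1 / s)\<close>, using 1 / r + 1 / s = 1. The cancellation is
  legitimate only for finite \<open>X\<close>.\<close>

lemma enn_powr_self_improve:
  assumes "X < top" "X \<le> Y * enn_powr X (1 / s)" "0 < r" "0 < s" "1 / r + 1 / s = 1"
  shows "enn_powr X (1 / r) \<le> Y"
proof (cases "X = 0")
  case False
  have "enn_powr X (1 / s) * enn_powr X (1 / r) = X"
    using assms enn_powr_add[of "1 / r" "1 / s" X] by (simp add: mult.commute)
  then have "enn_powr X (1 / s) * enn_powr X (1 / r) \<le> enn_powr X (1 / s) * Y"
    using assms by (simp add: mult.commute)
  then show ?thesis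
    using False assms by (subst (asm) ennreal_mult_le_mult_iff) (auto simp: less_top[symmetric])
qed simp

lemma shell_product_borel [measurable, simp]:
  "(shell i :: (real ^ 'n) set) \<times> (shell j :: (real ^ 'm) set) \<in> sets borel"
  unfolding borel_prod[symmetric] by (intro pair_measureI) auto

lemma emeasure_shell_finite: "emeasure lborel (shell k :: (real ^ 'd) set) < top"
  using emeasure_shell_le by (rule order.strict_trans1) simp

lemma emeasure_shell_product_finite:
  "emeasure lborel ((shell i :: (real ^ 'n) set) \<times> (shell j :: (real ^ 'm) set)) < top"
  by (simp add: lborel_prod[symmetric] lborel.emeasure_pair_measure_Times ennreal_mult_less_top emeasure_shell_finite)

lemma lp_sum_eq_Lq: "lp_sum p0 g z = Lq (count_space UNIV) p0 (\<lambda>i. g i z)"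
  by (simp add: lp_sum_def Lq_def nn_integral_count_space_nat)

lemma lp_sum_measurable [measurable (raw)]:
  assumes [measurable]: "\<And>i. g i \<in> borel_measurable M"
  shows "lp_sum p0 g \<in> borel_measurable M"
  unfolding lp_sum_def[abs_def] by measurable

text \<open>With s = p / (p - p0), conjugate to p / p0, the outer exponent is (1 / s)(1 / p0): the
  L^s norm of the dual weight followed by the p0-th root. The sign of \<open>t\<close> is reversed
  because here \<open>t\<close> is target minus source, while the dual weight lives on the target.
  The resulting rates are d (1 / p0 - 1 / p) for t \<ge> 0 and d / p for t < 0.\<close>

definition block_decay :: "nat \<Rightarrow> real \<Rightarrow> real \<Rightarrow> int \<Rightarrow> real" where
  "block_decay d p0 p t = shell_decay d (p / (p - p0)) (- t) powr ((p - p0) / (p * p0))"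

text \<open>Tests \<open>H\<close> against \<open>min H N ^ (r - 1)\<close>; the truncation at \<open>N\<close> makes the left-hand side finite,
  so that it can be absorbed.\<close>

lemma vector_block_estimate_truncated:
  fixes g :: "nat \<Rightarrow> (real ^ 'n) \<times> (real ^ 'm) \<Rightarrow> ennreal" and N :: nat
  assumes p0: "1 < p0" and r: "1 < r" "1 < s" "1 / r + 1 / s = 1"
    and [measurable]: "\<And>\<nu>. g \<nu> \<in> borel_measurable borel"
    and supp: "\<And>\<nu> z. z \<notin> shell i \<times> shell j \<Longrightarrow> g \<nu> z = 0"
    and decay: "\<And>u :: (real ^ 'n) \<times> (real ^ 'm) \<Rightarrow> ennreal. u \<in> borel_measurable borel \<Longrightarrow>
      (\<And>z. z \<notin> shell k \<times> shell l \<Longrightarrow> u z = 0) \<Longrightarrow>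
      (\<integral>\<^sup>+ z. enn_powr (max1 (max2 u) z) s * indicator (shell i \<times> shell j) z \<partial>lborel)
        \<le> W * (\<integral>\<^sup>+ z. enn_powr (u z) s \<partial>lborel)"
  defines "H \<equiv> \<lambda>z. \<Sum>\<nu>. enn_powr (max2 (max1 (g \<nu>)) z) p0"
    and "G \<equiv> \<lambda>z. \<Sum>\<nu>. enn_powr (g \<nu> z) p0"
  shows "enn_powr (\<integral>\<^sup>+ z. enn_powr (min (H z) (of_nat N)) r * indicator (shell k \<times> shell l) z \<partial>lborel) (1 / r)
    \<le> maximal_constant CARD('m) p0 * maximal_constant CARD('n) p0 * Lq lborel r G * enn_powr W (1 / s)"
proof -
  let ?B = "(shell k :: (real ^ 'n) set) \<times> (shell l :: (real ^ 'm) set)"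
  let ?A = "(shell i :: (real ^ 'n) set) \<times> (shell j :: (real ^ 'm) set)"
  let ?K = "maximal_constant CARD('m) p0 * maximal_constant CARD('n) p0"
  define u where "u = (\<lambda>z. enn_powr (min (H z) (of_nat N)) (r - 1) * indicator ?B z)"
  define X where "X = (\<integral>\<^sup>+ z. enn_powr (min (H z) (of_nat N)) r * indicator ?B z \<partial>lborel)"
  have [measurable]: "H \<in> borel_measurable borel" "G \<in> borel_measurable borel" unfolding H_def G_def by measurable
  have [measurable]: "u \<in> borel_measurable borel" unfolding u_def by measurable
  \<comment> \<open>This turns the L^s norm of the test function back into \<open>X\<close> to the
    power 1 / s, ready for absorption.\<close>
  have rs: "(r - 1) * s = r" using r by (simp add: field_simps)
  have us: "enn_powr (u z) s = enn_powr (min (H z) (of_nat N)) r * indicator ?B z" for z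
    using r by (auto simp: u_def indicator_def enn_powr_powr rs)
  have "X \<le> (\<integral>\<^sup>+ z. enn_powr (of_nat N) r * indicator ?B z \<partial>lborel)"
    unfolding X_def using r by (intro nn_integral_mono mult_right_mono enn_powr_mono) auto
  also have "\<dots> = enn_powr (of_nat N) r * emeasure lborel ?B"
    by (rule nn_integral_cmult_indicator) simp
  also have "\<dots> < top"
    using emeasure_shell_product_finite[where 'n = 'n and 'm = 'm] by (simp add: ennreal_mult_less_top of_nat_less_top)
  finally have fin: "X < top" .
  have "X \<le> (\<integral>\<^sup>+ z. H z * u z \<partial>lborel)"
    unfolding X_def
  proof (intro nn_integral_mono)
    fix z
    have "enn_powr (min (H z) (of_nat N)) r = min (H z) (of_nat N) * enn_powr (min (H z) (of_nat N)) (r - 1)"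
      using r enn_powr_add[of 1 "r - 1" "min (H z) (of_nat N)"] by simp
    also have "\<dots> \<le> H z * enn_powr (min (H z) (of_nat N)) (r - 1)"
      by (intro mult_right_mono) auto
    finally show "enn_powr (min (H z) (of_nat N)) r * indicator ?B z \<le> H z * u z"
      by (auto simp: u_def indicator_def)
  qed
  also have "\<dots> = (\<Sum>\<nu>. \<integral>\<^sup>+ z. enn_powr (max2 (max1 (g \<nu>)) z) p0 * u z \<partial>lborel)"
    unfolding H_def by (subst nn_integral_suminf[symmetric]) (auto simp: ennreal_suminf_multc)
  \<comment> \<open>The vector-valued problem becomes scalar here: the weight \<open>u\<close> is
    the same for all \<nu>, so the weighted inequality is applied termwise and the sum reassembles
    to \<open>G\<close>.\<close>
  also have "\<dots> \<le> (\<Sum>\<nu>. ?K * (\<integral>\<^sup>+ z. enn_powr (g \<nu> z) p0 * max1 (max2 u) z \<partial>lborel))"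
    by (intro suminf_le iterated_weighted p0) auto
  also have "\<dots> = ?K * (\<integral>\<^sup>+ z. G z * max1 (max2 u) z \<partial>lborel)"
    unfolding G_def by (subst ennreal_suminf_cmult, subst nn_integral_suminf[symmetric]) (auto simp: ennreal_suminf_multc)
  \<comment> \<open>Since \<open>G\<close> lives on the source block, only the restriction of the
    dual weight to that block counts, and this is what decays.\<close>
  also have "(\<integral>\<^sup>+ z. G z * max1 (max2 u) z \<partial>lborel) = (\<integral>\<^sup>+ z. G z * (max1 (max2 u) z * indicator ?A z) \<partial>lborel)"
    using supp by (intro nn_integral_cong) (auto simp: indicator_def G_def)
  also have "\<dots> \<le> Lq lborel r G * Lq lborel s (\<lambda>z. max1 (max2 u) z * indicator ?A z)"
    by (intro Holder_inequality_nn_integral r) auto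
  also have "Lq lborel s (\<lambda>z. max1 (max2 u) z * indicator ?A z)
      = enn_powr (\<integral>\<^sup>+ z. enn_powr (max1 (max2 u) z) s * indicator ?A z \<partial>lborel) (1 / s)"
    unfolding Lq_def
    by (intro arg_cong[where f = "\<lambda>x. enn_powr x (1 / s)"] nn_integral_cong) (auto simp: indicator_def)
  also have "\<dots> \<le> enn_powr (W * (\<integral>\<^sup>+ z. enn_powr (u z) s \<partial>lborel)) (1 / s)"
    using r by (intro enn_powr_mono decay) (auto simp: u_def)
  also have "\<dots> = enn_powr W (1 / s) * enn_powr X (1 / s)"
    using r by (simp add: us X_def enn_powr_mult)
  finally have "X \<le> (?K * Lq lborel r G * enn_powr W (1 / s)) * enn_powr X (1 / s)"
    by (simp add: mult_left_mono mult.assoc)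
  from enn_powr_self_improve[OF fin this] r show ?thesis unfolding X_def by simp
qed

text \<open>The truncation is removed by monotone convergence. The p0-th root then turns L^r norms
  of sums of p0-th powers into L^p norms of \<open>lp_sum\<close>, because r p0 = p.\<close>

lemma vector_block_estimate:
  fixes p0 p :: real
  assumes p: "1 < p0" "p0 < p"
  obtains C :: ennreal where "C < top"
    "\<And>i j k l (g :: nat \<Rightarrow> (real ^ 'n) \<times> (real ^ 'm) \<Rightarrow> ennreal).
      (\<And>\<nu>. g \<nu> \<in> borel_measurable borel) \<Longrightarrow> (\<And>\<nu> z. z \<notin> shell i \<times> shell j \<Longrightarrow> g \<nu> z = 0) \<Longrightarrow>
      Lq lborel p (\<lambda>z. lp_sum p0 (\<lambda>\<nu>. max2 (max1 (g \<nu>))) z * indicator (shell k \<times> shell l) z)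
        \<le> C * ennreal (block_decay CARD('n) p0 p (k - i) * block_decay CARD('m) p0 p (l - j)) *
          Lq lborel p (lp_sum p0 g)"
proof -
  define r s where "r = p / p0" and "s = p / (p - p0)"
  have rs: "1 < r" "1 < s" "1 / r + 1 / s = 1"
    using p by (auto simp: r_def s_def field_simps)
  have e: "1 / s * (1 / p0) = (p - p0) / (p * p0)" "1 / r * (1 / p0) = 1 / p" "1 / p0 * p = r"
    using p by (auto simp: r_def s_def field_simps)
  obtain D :: ennreal where D: "D < top" and decay:
    "\<And>i j k l (u :: (real ^ 'n) \<times> (real ^ 'm) \<Rightarrow> ennreal). u \<in> borel_measurable borel \<Longrightarrow>
      (\<And>z. z \<notin> shell k \<times> shell l \<Longrightarrow> u z = 0) \<Longrightarrow>
      (\<integral>\<^sup>+ z. enn_powr (max1 (max2 u) z) s * indicator (shell i \<times> shell j) z \<partial>lborel)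
        \<le> D * ennreal (shell_decay CARD('n) s (i - k) * shell_decay CARD('m) s (j - l)) *
          (\<integral>\<^sup>+ z. enn_powr (u z) s \<partial>lborel)"
    by (rule iterated_shell_decay[OF rs(2), where 'n = 'n and 'm = 'm]) blast
  let ?K = "maximal_constant CARD('m) p0 * maximal_constant CARD('n) p0"
  define C where "C = enn_powr ?K (1 / p0) * enn_powr D (1 / s * (1 / p0))"
  show ?thesis
  proof
    show "C < top"
      using D maximal_constant_finite[OF p(1)] by (simp add: C_def ennreal_mult_less_top)
    fix i j k l and g :: "nat \<Rightarrow> (real ^ 'n) \<times> (real ^ 'm) \<Rightarrow> ennreal"
    assume g [measurable]: "\<And>\<nu>. g \<nu> \<in> borel_measurable borel"
      and supp: "\<And>\<nu> z. z \<notin> shell i \<times> shell j \<Longrightarrow> g \<nu> z = 0"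
    let ?B = "(shell k :: (real ^ 'n) set) \<times> (shell l :: (real ^ 'm) set)"
    define w where "w = shell_decay CARD('n) s (i - k) * shell_decay CARD('m) s (j - l)"
    have w: "0 \<le> w" by (simp add: w_def shell_decay_def)
    define H where "H = (\<lambda>z. \<Sum>\<nu>. enn_powr (max2 (max1 (g \<nu>)) z) p0)"
    define G where "G = (\<lambda>z. \<Sum>\<nu>. enn_powr (g \<nu> z) p0)"
    have [measurable]: "H \<in> borel_measurable borel" unfolding H_def by measurable
    define Y where "Y = ?K * Lq lborel r G * enn_powr (D * ennreal w) (1 / s)"
    have trunc: "enn_powr (\<integral>\<^sup>+ z. enn_powr (min (H z) (of_nat N)) r * indicator ?B z \<partial>lborel) (1 / r) \<le> Y" for N
      unfolding H_def G_def Y_def w_def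
      by (intro vector_block_estimate_truncated[where i = i and j = j] p(1) rs g supp decay)
    have "(\<integral>\<^sup>+ z. enn_powr (H z) r * indicator ?B z \<partial>lborel)
        = (\<integral>\<^sup>+ z. (SUP N. enn_powr (min (H z) (of_nat N)) r * indicator ?B z) \<partial>lborel)"
    proof (intro nn_integral_cong)
      fix z
      have "H z = (SUP N. min (H z) (of_nat N))"
        using inf_SUP[of "H z" "\<lambda>N::nat. of_nat N :: ennreal" UNIV]
        by (simp add: ennreal_SUP_of_nat_eq_top inf_min)
      then have "enn_powr (H z) r = (SUP N. enn_powr (min (H z) (of_nat N)) r)"
        using rs enn_powr_SUP[of r "\<lambda>N::nat. min (H z) (of_nat N)" UNIV] by simp
      then show "enn_powr (H z) r * indicator ?B z = (SUP N. enn_powr (min (H z) (of_nat N)) r * indicator ?B z)"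
        by (simp add: SUP_mult_right_ennreal)
    qed
    also have "\<dots> = (SUP N. \<integral>\<^sup>+ z. enn_powr (min (H z) (of_nat N)) r * indicator ?B z \<partial>lborel)"
      using rs by (intro nn_integral_monotone_convergence_SUP)
        (auto simp: incseq_def le_fun_def intro!: mult_right_mono enn_powr_mono min.mono of_nat_mono)
    finally have "enn_powr (\<integral>\<^sup>+ z. enn_powr (H z) r * indicator ?B z \<partial>lborel) (1 / r) \<le> Y"
      using rs trunc by (auto simp: enn_powr_SUP intro: SUP_least)
    then have "enn_powr (enn_powr (\<integral>\<^sup>+ z. enn_powr (H z) r * indicator ?B z \<partial>lborel) (1 / r)) (1 / p0)
        \<le> enn_powr Y (1 / p0)"
      using p by (intro enn_powr_mono) auto
    moreover have "Lq lborel p (\<lambda>z. lp_sum p0 (\<lambda>\<nu>. max2 (max1 (g \<nu>))) z * indicator ?B z)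
        = enn_powr (enn_powr (\<integral>\<^sup>+ z. enn_powr (H z) r * indicator ?B z \<partial>lborel) (1 / r)) (1 / p0)"
      unfolding Lq_def enn_powr_powr e
      by (intro arg_cong[where f = "\<lambda>x. enn_powr x (1 / p)"] nn_integral_cong)
        (use e(3) in \<open>auto simp: lp_sum_def H_def indicator_def enn_powr_powr\<close>)
    moreover have "enn_powr Y (1 / p0) = C * ennreal (w powr (1 / s * (1 / p0))) * enn_powr (Lq lborel r G) (1 / p0)"
      using p rs w by (simp add: Y_def C_def enn_powr_mult enn_powr_powr enn_powr_ennreal powr_powr mult_ac)
    moreover have "enn_powr (Lq lborel r G) (1 / p0) = Lq lborel p (lp_sum p0 g)"
      unfolding Lq_def enn_powr_powr e
      by (intro arg_cong[where f = "\<lambda>x. enn_powr x (1 / p)"] nn_integral_cong)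
        (use e(3) in \<open>auto simp: lp_sum_def G_def enn_powr_powr\<close>)
    moreover have "w powr (1 / s * (1 / p0)) = block_decay CARD('n) p0 p (k - i) * block_decay CARD('m) p0 p (l - j)"
      unfolding e w_def block_decay_def by (simp add: powr_mult shell_decay_def s_def)
    ultimately show "Lq lborel p (\<lambda>z. lp_sum p0 (\<lambda>\<nu>. max2 (max1 (g \<nu>))) z * indicator ?B z)
        \<le> C * ennreal (block_decay CARD('n) p0 p (k - i) * block_decay CARD('m) p0 p (l - j)) *
          Lq lborel p (lp_sum p0 g)"
      by simp
  qed
qed

section \<open>Summation over blocks\<close>

lemma shell_exists:
  fixes x :: "real ^ 'd"
  assumes "x \<noteq> 0" shows "\<exists>k. x \<in> shell k"
proof -
  define M where "M = Max (range (\<lambda>j. \<bar>x $ j\<bar>))"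
  have le: "\<bar>x $ j\<bar> \<le> M" for j unfolding M_def by (rule Max_ge) auto
  have "M \<in> range (\<lambda>j. \<bar>x $ j\<bar>)" unfolding M_def by (rule Max_in) auto
  then obtain j where j: "M = \<bar>x $ j\<bar>" by auto
  obtain j' where "x $ j' \<noteq> 0" using assms by (auto simp: vec_eq_iff)
  with le[of j'] have M: "0 < M" by auto
  \<comment> \<open>The shift by 2 matches the inner radius 2^(k-2) of the shell with index
    k.\<close>
  define k where "k = \<lfloor>log 2 M\<rfloor> + 2"
  have "of_int k - 2 \<le> log 2 M" "log 2 M < of_int k - 1" unfolding k_def by linarith+
  then have "2 powr (of_int k - 2) \<le> M" "M < 2 powr (of_int k - 1)"
    using M le_log_iff[of 2 M "of_int k - 2"] log_less_iff[of 2 M "of_int k - 1"] by auto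
  then have "x \<in> shell k" using le j by (auto simp: mem_shell_iff intro: le_less_trans)
  then show ?thesis ..
qed

lemma iterated_mono: "(\<And>z. f z \<le> g z) \<Longrightarrow> max2 (max1 f) z \<le> max2 (max1 g) z"
  unfolding max1_def max2_def by (intro cube_max_mono)

lemma iterated_count_space_le:
  fixes f :: "'i::countable \<Rightarrow> (real ^ 'n) \<times> (real ^ 'm) \<Rightarrow> ennreal"
  assumes [measurable]: "\<And>i. f i \<in> borel_measurable borel"
  shows "max2 (max1 (\<lambda>z. \<integral>\<^sup>+ i. f i z \<partial>count_space UNIV)) z
    \<le> (\<integral>\<^sup>+ i. max2 (max1 (f i)) z \<partial>count_space UNIV)"
proof -
  have "max1 (\<lambda>z. \<integral>\<^sup>+ i. f i z \<partial>count_space UNIV) z \<le> (\<integral>\<^sup>+ i. max1 (f i) z \<partial>count_space UNIV)" for z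
    unfolding max1_def by (intro cube_max_count_space_le section_measurable) auto
  then have "max2 (max1 (\<lambda>z. \<integral>\<^sup>+ i. f i z \<partial>count_space UNIV)) z
      \<le> max2 (\<lambda>z. \<integral>\<^sup>+ i. max1 (f i) z \<partial>count_space UNIV) z"
    unfolding max2_def by (intro cube_max_mono)
  also have "\<dots> \<le> (\<integral>\<^sup>+ i. max2 (max1 (f i)) z \<partial>count_space UNIV)"
    unfolding max2_def by (intro cube_max_count_space_le section_measurable) auto
  finally show ?thesis .
qed

definition block_norm :: "real \<Rightarrow> ((real ^ 'n) \<times> (real ^ 'm) \<Rightarrow> ennreal) \<Rightarrow> int \<times> int \<Rightarrow> ennreal" where
  "block_norm p f v = Lq lborel p (\<lambda>z. f z * indicator (shell (fst v) \<times> shell (snd v)) z)"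

text \<open>Splitting every \<open>g \<nu>\<close> into blocks and using countable subadditivity of
  the operators, Minkowski is applied in ell-p0 over \<nu> and then in L^p over the target block;
  each source block contributes by the block estimate.\<close>

lemma vector_block_sum:
  fixes p0 p :: real
  assumes p: "1 < p0" "p0 < p"
  obtains C :: ennreal where "C < top"
    "\<And>(g :: nat \<Rightarrow> (real ^ 'n) \<times> (real ^ 'm) \<Rightarrow> ennreal) v.
      (\<And>\<nu>. g \<nu> \<in> borel_measurable borel) \<Longrightarrow> (\<And>\<nu> z. fst z = 0 \<or> snd z = 0 \<Longrightarrow> g \<nu> z = 0) \<Longrightarrow>
      block_norm p (lp_sum p0 (\<lambda>\<nu>. max2 (max1 (g \<nu>)))) v
        \<le> (\<integral>\<^sup>+ w. C * ennreal (block_decay CARD('n) p0 p (fst v - fst w) * block_decay CARD('m) p0 p (snd v - snd w)) *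
          block_norm p (lp_sum p0 g) w \<partial>count_space UNIV)"
proof -
  obtain C :: ennreal where C: "C < top" and block:
    "\<And>i j k l (g :: nat \<Rightarrow> (real ^ 'n) \<times> (real ^ 'm) \<Rightarrow> ennreal).
      (\<And>\<nu>. g \<nu> \<in> borel_measurable borel) \<Longrightarrow> (\<And>\<nu> z. z \<notin> shell i \<times> shell j \<Longrightarrow> g \<nu> z = 0) \<Longrightarrow>
      Lq lborel p (\<lambda>z. lp_sum p0 (\<lambda>\<nu>. max2 (max1 (g \<nu>))) z * indicator (shell k \<times> shell l) z)
        \<le> C * ennreal (block_decay CARD('n) p0 p (k - i) * block_decay CARD('m) p0 p (l - j)) *
          Lq lborel p (lp_sum p0 g)"
    by (rule vector_block_estimate[OF p, where 'n = 'n and 'm = 'm]) blast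
  show ?thesis
  proof (rule that[OF C])
    fix g :: "nat \<Rightarrow> (real ^ 'n) \<times> (real ^ 'm) \<Rightarrow> ennreal" and v :: "int \<times> int"
    assume [measurable]: "\<And>\<nu>. g \<nu> \<in> borel_measurable borel"
      and axes: "\<And>\<nu> z. fst z = 0 \<or> snd z = 0 \<Longrightarrow> g \<nu> z = 0"
    let ?S = "\<lambda>w :: int \<times> int. (shell (fst w) :: (real ^ 'n) set) \<times> (shell (snd w) :: (real ^ 'm) set)"
    define h where "h = (\<lambda>w \<nu> z. g \<nu> z * indicator (?S w) z)"
    have h [measurable]: "h w \<nu> \<in> borel_measurable borel" for w \<nu> unfolding h_def by measurable
    define V where "V = (\<lambda>w. lp_sum p0 (\<lambda>\<nu>. max2 (max1 (h w \<nu>))))"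
    have [measurable]: "V w \<in> borel_measurable borel" for w unfolding V_def by measurable
    \<comment> \<open>The blocks miss the coordinate subspaces, so there the inequality rests on the
      assumption that \<open>g\<close> vanishes. It is needed at every point, since
      \<open>iterated_mono\<close> compares functions pointwise.\<close>
    have gh: "g \<nu> z \<le> (\<integral>\<^sup>+ w. h w \<nu> z \<partial>count_space UNIV)" for \<nu> z
    proof (cases "fst z = 0 \<or> snd z = 0")
      case False
      then obtain i j where "fst z \<in> shell i" "snd z \<in> shell j" using shell_exists[of "fst z"] shell_exists[of "snd z"] by auto
      then have "h (i, j) \<nu> z = g \<nu> z" by (simp add: h_def mem_Times_iff)
      moreover have "h (i, j) \<nu> z \<le> (\<integral>\<^sup>+ w. h w \<nu> z \<partial>count_space UNIV)"
        by (rule nn_integral_ge_point) simp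
      ultimately show ?thesis by simp
    qed (simp add: axes)
    have le: "max2 (max1 (g \<nu>)) z \<le> (\<integral>\<^sup>+ w. max2 (max1 (h w \<nu>)) z \<partial>count_space UNIV)" for \<nu> z
    proof -
      have "max2 (max1 (g \<nu>)) z \<le> max2 (max1 (\<lambda>z. \<integral>\<^sup>+ w. h w \<nu> z \<partial>count_space UNIV)) z"
        by (rule iterated_mono) (rule gh)
      also have "\<dots> \<le> (\<integral>\<^sup>+ w. max2 (max1 (h w \<nu>)) z \<partial>count_space UNIV)"
        by (rule iterated_count_space_le) (rule h)
      finally show ?thesis .
    qed
    have V_le: "lp_sum p0 (\<lambda>\<nu>. max2 (max1 (g \<nu>))) z \<le> (\<integral>\<^sup>+ w. V w z \<partial>count_space UNIV)" for z
    proof -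
      have "lp_sum p0 (\<lambda>\<nu>. max2 (max1 (g \<nu>))) z
          \<le> Lq (count_space UNIV) p0 (\<lambda>\<nu>. \<integral>\<^sup>+ w. max2 (max1 (h w \<nu>)) z \<partial>count_space UNIV)"
        unfolding lp_sum_eq_Lq using p by (intro Lq_mono le) auto
      also have "\<dots> \<le> (\<integral>\<^sup>+ w. V w z \<partial>count_space UNIV)"
        unfolding V_def lp_sum_eq_Lq using p by (intro Minkowski_count_space) auto
      finally show ?thesis .
    qed
    have "block_norm p (lp_sum p0 (\<lambda>\<nu>. max2 (max1 (g \<nu>)))) v
        \<le> Lq lborel p (\<lambda>z. \<integral>\<^sup>+ w. V w z * indicator (?S v) z \<partial>count_space UNIV)"
      unfolding block_norm_def using p
      by (intro Lq_mono) (simp_all add: nn_integral_multc mult_right_mono V_le)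
    also have "\<dots> \<le> (\<integral>\<^sup>+ w. Lq lborel p (\<lambda>z. V w z * indicator (?S v) z) \<partial>count_space UNIV)"
      using p by (intro Minkowski_count_space) auto
    also have "\<dots> \<le> (\<integral>\<^sup>+ w. C * ennreal (block_decay CARD('n) p0 p (fst v - fst w) * block_decay CARD('m) p0 p (snd v - snd w)) *
          block_norm p (lp_sum p0 g) w \<partial>count_space UNIV)"
    proof (intro nn_integral_mono)
      fix w :: "int \<times> int"
      have "lp_sum p0 (h w) = (\<lambda>z. lp_sum p0 g z * indicator (?S w) z)"
        by (auto simp: lp_sum_def h_def indicator_def)
      then have "Lq lborel p (lp_sum p0 (h w)) = block_norm p (lp_sum p0 g) w" by (simp add: block_norm_def)
      then show "Lq lborel p (\<lambda>z. V w z * indicator (?S v) z)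
        \<le> C * ennreal (block_decay CARD('n) p0 p (fst v - fst w) * block_decay CARD('m) p0 p (snd v - snd w)) *
          block_norm p (lp_sum p0 g) w"
        using block[of "h w" "fst w" "snd w" "fst v" "snd v"] unfolding V_def
        by (auto simp: h_def)
    qed
    finally show "block_norm p (lp_sum p0 (\<lambda>\<nu>. max2 (max1 (g \<nu>)))) v
        \<le> (\<integral>\<^sup>+ w. C * ennreal (block_decay CARD('n) p0 p (fst v - fst w) * block_decay CARD('m) p0 p (snd v - snd w)) *
          block_norm p (lp_sum p0 g) w \<partial>count_space UNIV)" .
  qed
qed

section \<open>The Morrey--Herz norm as a norm of arrays indexed by pairs of integers\<close>

definition quadrant :: "int \<times> int \<Rightarrow> (int \<times> int) set" where
  "quadrant L = {..fst L} \<times> {..snd L}"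

definition dyadic_weight :: "real \<Rightarrow> int \<times> int \<Rightarrow> ennreal" where
  "dyadic_weight \<alpha> v = ennreal (2 powr (of_int (fst v + snd v) * \<alpha>))"

text \<open>Applied to the array of block norms this is the product Morrey--Herz norm: restriction
  to a dyadic rectangle amounts to restriction of the array to a quadrant.\<close>

definition discrete_morrey_herz :: "real \<Rightarrow> real \<Rightarrow> real \<Rightarrow> (int \<times> int \<Rightarrow> ennreal) \<Rightarrow> ennreal" where
  "discrete_morrey_herz q \<alpha> lam A =
    (SUP L. dyadic_weight (- lam) L *
      Lq (count_space UNIV) q (\<lambda>v. dyadic_weight \<alpha> v * A v * indicator (quadrant L) v))"

lemma dyadic_weight_add: "dyadic_weight \<alpha> (v + w) = dyadic_weight \<alpha> v * dyadic_weight \<alpha> w"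
  by (simp add: dyadic_weight_def ennreal_mult[symmetric] powr_add[symmetric] algebra_simps)

lemma dyadic_weight_mult: "dyadic_weight \<alpha> v * dyadic_weight \<beta> v = dyadic_weight (\<alpha> + \<beta>) v"
  by (simp add: dyadic_weight_def ennreal_mult[symmetric] powr_add[symmetric] algebra_simps)

lemma Lq_count_space_shift:
  fixes f :: "int \<times> int \<Rightarrow> ennreal"
  shows "Lq (count_space UNIV) q (\<lambda>v. f (v - w)) = Lq (count_space UNIV) q f"
  unfolding Lq_def
  by (subst nn_integral_bij_count_space[of "\<lambda>v. v - w" UNIV UNIV "\<lambda>v. enn_powr (f v) q"])
     (auto intro!: bij_betwI[of _ _ _ "\<lambda>v. v + w"])

text \<open>A Young-type inequality: by Minkowski in ell-q the convolution is a superposition of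
  translates of \<open>A\<close>, and translation by \<open>w\<close> multiplies the norm by at most
  \<open>dyadic_weight (\<alpha> - lam) w\<close>.\<close>

lemma discrete_convolution_bound:
  fixes A B :: "int \<times> int \<Rightarrow> ennreal"
  assumes q: "1 \<le> q"
    and le: "\<And>v. B v \<le> (\<integral>\<^sup>+ w. K (v - w) * A w \<partial>count_space UNIV)"
  shows "discrete_morrey_herz q \<alpha> lam B
    \<le> (\<integral>\<^sup>+ w. dyadic_weight (\<alpha> - lam) w * K w \<partial>count_space UNIV) * discrete_morrey_herz q \<alpha> lam A"
  unfolding discrete_morrey_herz_def[of q \<alpha> lam B]
proof (rule SUP_least)
  fix L :: "int \<times> int"
  let ?M = "discrete_morrey_herz q \<alpha> lam A"
  let ?c = "\<lambda>w. dyadic_weight \<alpha> w * K w"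
  let ?A = "\<lambda>L v. dyadic_weight \<alpha> v * A v * indicator (quadrant L) v"
  have pt: "dyadic_weight \<alpha> v * B v * indicator (quadrant L) v
      \<le> (\<integral>\<^sup>+ w. ?c w * ?A (L - w) (v - w) \<partial>count_space UNIV)" for v
  proof -
    have "B v \<le> (\<integral>\<^sup>+ w. K (v - (v - w)) * A (v - w) \<partial>count_space UNIV)"
      using le[of v]
      by (subst nn_integral_bij_count_space[of "\<lambda>w. v - w" UNIV UNIV "\<lambda>w. K (v - w) * A w"])
        (auto intro!: bij_betwI[of _ _ _ "\<lambda>w. v - w"])
    then have "dyadic_weight \<alpha> v * B v * indicator (quadrant L) v
        \<le> dyadic_weight \<alpha> v * (\<integral>\<^sup>+ w. K w * A (v - w) \<partial>count_space UNIV) * indicator (quadrant L) v"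
      by (intro mult_right_mono mult_left_mono) auto
    also have "\<dots> = (\<integral>\<^sup>+ w. dyadic_weight \<alpha> v * (K w * A (v - w)) * indicator (quadrant L) v \<partial>count_space UNIV)"
      by (simp add: nn_integral_cmult nn_integral_multc)
    also have "\<dots> = (\<integral>\<^sup>+ w. ?c w * ?A (L - w) (v - w) \<partial>count_space UNIV)"
    proof (intro nn_integral_cong)
      fix w
      have "indicator (quadrant L) v = (indicator (quadrant (L - w)) (v - w) :: ennreal)"
        by (auto simp: quadrant_def indicator_def mem_Times_iff)
      moreover have "dyadic_weight \<alpha> v = dyadic_weight \<alpha> w * dyadic_weight \<alpha> (v - w)"
        by (simp flip: dyadic_weight_add)
      ultimately show "dyadic_weight \<alpha> v * (K w * A (v - w)) * indicator (quadrant L) v = ?c w * ?A (L - w) (v - w)"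
        by (simp add: mult_ac)
    qed
    finally show ?thesis .
  qed
  have "Lq (count_space UNIV) q (\<lambda>v. dyadic_weight \<alpha> v * B v * indicator (quadrant L) v)
      \<le> Lq (count_space UNIV) q (\<lambda>v. \<integral>\<^sup>+ w. ?c w * ?A (L - w) (v - w) \<partial>count_space UNIV)"
    using q by (intro Lq_mono pt) auto
  also have "\<dots> \<le> (\<integral>\<^sup>+ w. Lq (count_space UNIV) q (\<lambda>v. ?c w * ?A (L - w) (v - w)) \<partial>count_space UNIV)"
    using q by (intro Minkowski_count_space) auto
  also have "\<dots> = (\<integral>\<^sup>+ w. ?c w * Lq (count_space UNIV) q (?A (L - w)) \<partial>count_space UNIV)"
  proof (intro nn_integral_cong)
    fix w
    have "Lq (count_space UNIV) q (\<lambda>v. ?c w * ?A (L - w) (v - w)) = ?c w * Lq (count_space UNIV) q (\<lambda>v. ?A (L - w) (v - w))"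
      using q by (intro Lq_cmult) auto
    also have "Lq (count_space UNIV) q (\<lambda>v. ?A (L - w) (v - w)) = Lq (count_space UNIV) q (?A (L - w))"
      by (rule Lq_count_space_shift)
    finally show "Lq (count_space UNIV) q (\<lambda>v. ?c w * ?A (L - w) (v - w)) = ?c w * Lq (count_space UNIV) q (?A (L - w))" .
  qed
  finally have "dyadic_weight (- lam) L * Lq (count_space UNIV) q (\<lambda>v. dyadic_weight \<alpha> v * B v * indicator (quadrant L) v)
      \<le> dyadic_weight (- lam) L * (\<integral>\<^sup>+ w. ?c w * Lq (count_space UNIV) q (?A (L - w)) \<partial>count_space UNIV)"
    by (rule mult_left_mono) simp
  also have "\<dots> = (\<integral>\<^sup>+ w. dyadic_weight (- lam) L * (?c w * Lq (count_space UNIV) q (?A (L - w))) \<partial>count_space UNIV)"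
    by (rule nn_integral_cmult[symmetric]) simp
  also have "\<dots> \<le> (\<integral>\<^sup>+ w. dyadic_weight (\<alpha> - lam) w * K w * ?M \<partial>count_space UNIV)"
  proof (intro nn_integral_mono)
    fix w
    have "dyadic_weight (- lam) L = dyadic_weight (- lam) w * dyadic_weight (- lam) (L - w)"
      by (simp flip: dyadic_weight_add)
    then have "dyadic_weight (- lam) L * (?c w * Lq (count_space UNIV) q (?A (L - w)))
        = dyadic_weight \<alpha> w * dyadic_weight (- lam) w * K w * (dyadic_weight (- lam) (L - w) * Lq (count_space UNIV) q (?A (L - w)))"
      by (simp add: mult_ac)
    also have "\<dots> \<le> dyadic_weight \<alpha> w * dyadic_weight (- lam) w * K w * ?M"
      unfolding discrete_morrey_herz_def by (intro mult_left_mono SUP_upper) auto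
    finally show "dyadic_weight (- lam) L * (?c w * Lq (count_space UNIV) q (?A (L - w)))
        \<le> dyadic_weight (\<alpha> - lam) w * K w * ?M"
      by (simp add: dyadic_weight_mult)
  qed
  also have "\<dots> = (\<integral>\<^sup>+ w. dyadic_weight (\<alpha> - lam) w * K w \<partial>count_space UNIV) * ?M"
    by (rule nn_integral_multc) simp
  finally show "dyadic_weight (- lam) L * Lq (count_space UNIV) q (\<lambda>v. dyadic_weight \<alpha> v * B v * indicator (quadrant L) v)
      \<le> (\<integral>\<^sup>+ w. dyadic_weight (\<alpha> - lam) w * K w \<partial>count_space UNIV) * ?M" .
qed

text \<open>The number \<open>e\<close> below is the smaller of the two slacks: the upper bound on
  \<alpha> controls t \<ge> 0, where \<open>lam\<close> only helps, and the upper bound on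
  \<open>lam\<close> controls t < 0.\<close>

lemma block_decay_summable:
  assumes p: "1 < p0" "p0 < p"
    and \<alpha>: "0 < lam" "lam < \<alpha> + real d / p" "\<alpha> < real d * (1 / p0 - 1 / p)"
  shows "(\<integral>\<^sup>+ t. ennreal (2 powr (of_int t * (\<alpha> - lam)) * block_decay d p0 p t) \<partial>count_space (UNIV :: int set)) < top"
proof -
  define e where "e = min (real d * (1 / p0 - 1 / p) - \<alpha> + lam) (real d / p + \<alpha> - lam)"
  have e: "0 < e" using \<alpha> by (simp add: e_def)
  have "2 powr (of_int t * (\<alpha> - lam)) * block_decay d p0 p t \<le> 2 powr (- e * \<bar>of_int t\<bar>)" for t
  proof (cases "0 \<le> t")
    case True
    have "block_decay d p0 p t = 2 powr (- of_int t * real d * ((p - p0) / (p * p0)))"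
      using True by (simp add: block_decay_def shell_decay_def powr_powr)
    also have "(p - p0) / (p * p0) = 1 / p0 - 1 / p" using p by (simp add: field_simps)
    finally have "2 powr (of_int t * (\<alpha> - lam)) * block_decay d p0 p t
        = 2 powr (- (of_int t * (real d * (1 / p0 - 1 / p) - \<alpha> + lam)))"
      by (simp only: powr_add[symmetric]) (simp add: algebra_simps)
    also have "\<dots> \<le> 2 powr (- (of_int t * e))"
      using True by (intro powr_mono) (auto simp: e_def intro!: mult_left_mono)
    finally show ?thesis using True by (simp add: mult.commute)
  next
    case False
    \<comment> \<open>Taking roots turns the inward rate d (s - 1) of the s-th powers into d /
      p.\<close>
    have "(p / (p - p0) - 1) * ((p - p0) / (p * p0)) = 1 / p"
      using p by (simp add: field_simps)
    moreover have "block_decay d p0 p t = 2 powr (of_int t * real d * ((p / (p - p0) - 1) * ((p - p0) / (p * p0))))"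
      using False by (simp add: block_decay_def shell_decay_def powr_powr mult.assoc)
    ultimately have "2 powr (of_int t * (\<alpha> - lam)) * block_decay d p0 p t
        = 2 powr (of_int t * (real d / p + \<alpha> - lam))"
      by (simp only: powr_add[symmetric]) (simp add: algebra_simps)
    also have "\<dots> \<le> 2 powr (of_int t * e)"
      using False by (intro powr_mono mult_left_mono_neg) (auto simp: e_def)
    finally show ?thesis using False by (simp add: mult.commute)
  qed
  then have "(\<integral>\<^sup>+ t. ennreal (2 powr (of_int t * (\<alpha> - lam)) * block_decay d p0 p t) \<partial>count_space (UNIV :: int set))
      \<le> geometric_sum e"
    unfolding geometric_sum_def by (intro nn_integral_mono ennreal_leI)
  then show ?thesis using geometric_sum_finite[OF e] by (rule order.strict_trans1)
qed

lemma nn_integral_count_space_product: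
  fixes f g :: "int \<Rightarrow> ennreal"
  shows "(\<integral>\<^sup>+ v. f (fst v) * g (snd v) \<partial>count_space UNIV)
    = (\<integral>\<^sup>+ i. f i \<partial>count_space UNIV) * (\<integral>\<^sup>+ j. g j \<partial>count_space UNIV)"
proof -
  have "(\<integral>\<^sup>+ v. f (fst v) * g (snd v) \<partial>count_space UNIV)
      = (\<integral>\<^sup>+ i. \<integral>\<^sup>+ j. f i * g j \<partial>count_space UNIV \<partial>count_space UNIV)"
    using nn_integral_fst_count_space[of "\<lambda>v. f (fst v) * g (snd v)"] by simp
  then show ?thesis by (simp add: nn_integral_cmult nn_integral_multc)
qed

text \<open>The kernel from the block sum depends only on the difference of the indices and factors
  into its two coordinates, so its weighted mass is a product of two one-dimensional sums.\<close>

theorem vector_maximal_morrey_herz: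
  fixes p0 p q \<alpha> lam :: real
  assumes p: "1 < p0" "p0 < p" "1 \<le> q" "0 < lam"
    and n: "lam < \<alpha> + real CARD('n) / p" "\<alpha> < real CARD('n) * (1 / p0 - 1 / p)"
    and m: "lam < \<alpha> + real CARD('m) / p" "\<alpha> < real CARD('m) * (1 / p0 - 1 / p)"
  obtains C :: ennreal where "C < top"
    "\<And>(g :: nat \<Rightarrow> (real ^ 'n) \<times> (real ^ 'm) \<Rightarrow> ennreal).
      (\<And>\<nu>. g \<nu> \<in> borel_measurable borel) \<Longrightarrow> (\<And>\<nu> z. fst z = 0 \<or> snd z = 0 \<Longrightarrow> g \<nu> z = 0) \<Longrightarrow>
      discrete_morrey_herz q \<alpha> lam (block_norm p (lp_sum p0 (\<lambda>\<nu>. max2 (max1 (g \<nu>)))))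
        \<le> C * discrete_morrey_herz q \<alpha> lam (block_norm p (lp_sum p0 g))"
proof -
  obtain D :: ennreal where D: "D < top" and block:
    "\<And>(g :: nat \<Rightarrow> (real ^ 'n) \<times> (real ^ 'm) \<Rightarrow> ennreal) v.
      (\<And>\<nu>. g \<nu> \<in> borel_measurable borel) \<Longrightarrow> (\<And>\<nu> z. fst z = 0 \<or> snd z = 0 \<Longrightarrow> g \<nu> z = 0) \<Longrightarrow>
      block_norm p (lp_sum p0 (\<lambda>\<nu>. max2 (max1 (g \<nu>)))) v
        \<le> (\<integral>\<^sup>+ w. D * ennreal (block_decay CARD('n) p0 p (fst v - fst w) * block_decay CARD('m) p0 p (snd v - snd w)) *
          block_norm p (lp_sum p0 g) w \<partial>count_space UNIV)"
    by (rule vector_block_sum[OF p(1,2), where 'n = 'n and 'm = 'm]) blast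
  let ?S = "\<lambda>d. \<integral>\<^sup>+ t. ennreal (2 powr (of_int t * (\<alpha> - lam)) * block_decay d p0 p t) \<partial>count_space (UNIV :: int set)"
  let ?K = "\<lambda>w :: int \<times> int. D * ennreal (block_decay CARD('n) p0 p (fst w) * block_decay CARD('m) p0 p (snd w))"
  show ?thesis
  proof
    show "D * (?S CARD('n) * ?S CARD('m)) < top"
      using D block_decay_summable[OF p(1,2,4)] n m by (simp add: ennreal_mult_less_top)
    fix g :: "nat \<Rightarrow> (real ^ 'n) \<times> (real ^ 'm) \<Rightarrow> ennreal"
    assume g: "\<And>\<nu>. g \<nu> \<in> borel_measurable borel" "\<And>\<nu> z. fst z = 0 \<or> snd z = 0 \<Longrightarrow> g \<nu> z = 0"
    have "discrete_morrey_herz q \<alpha> lam (block_norm p (lp_sum p0 (\<lambda>\<nu>. max2 (max1 (g \<nu>)))))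
      \<le> (\<integral>\<^sup>+ w. dyadic_weight (\<alpha> - lam) w * ?K w \<partial>count_space UNIV) *
        discrete_morrey_herz q \<alpha> lam (block_norm p (lp_sum p0 g))"
      using block[OF g] p by (intro discrete_convolution_bound) auto
    also have "(\<integral>\<^sup>+ w. dyadic_weight (\<alpha> - lam) w * ?K w \<partial>count_space UNIV)
        = (\<integral>\<^sup>+ w. D * (ennreal (2 powr (of_int (fst w) * (\<alpha> - lam)) * block_decay CARD('n) p0 p (fst w)) *
            ennreal (2 powr (of_int (snd w) * (\<alpha> - lam)) * block_decay CARD('m) p0 p (snd w))) \<partial>count_space UNIV)"
    proof (intro nn_integral_cong)
      fix w :: "int \<times> int"
      have "2 powr (of_int (fst w + snd w) * (\<alpha> - lam))
          = 2 powr (of_int (fst w) * (\<alpha> - lam)) * (2 powr (of_int (snd w) * (\<alpha> - lam)) :: real)"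
        by (simp add: powr_add[symmetric] distrib_right)
      then show "dyadic_weight (\<alpha> - lam) w * ?K w
        = D * (ennreal (2 powr (of_int (fst w) * (\<alpha> - lam)) * block_decay CARD('n) p0 p (fst w)) *
            ennreal (2 powr (of_int (snd w) * (\<alpha> - lam)) * block_decay CARD('m) p0 p (snd w)))"
        by (simp add: dyadic_weight_def ennreal_mult block_decay_def mult_ac)
    qed
    also have "\<dots> = D * (?S CARD('n) * ?S CARD('m))"
      by (subst nn_integral_cmult) (auto simp: nn_integral_count_space_product[of
        "\<lambda>t. ennreal (2 powr (of_int t * (\<alpha> - lam)) * block_decay CARD('n) p0 p t)"
        "\<lambda>t. ennreal (2 powr (of_int t * (\<alpha> - lam)) * block_decay CARD('m) p0 p t)"])
    finally show "discrete_morrey_herz q \<alpha> lam (block_norm p (lp_sum p0 (\<lambda>\<nu>. max2 (max1 (g \<nu>)))))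
        \<le> D * (?S CARD('n) * ?S CARD('m)) * discrete_morrey_herz q \<alpha> lam (block_norm p (lp_sum p0 g))" .
  qed
qed

section \<open>The strong maximal operator\<close>

text \<open>The Herz norm is stated with \<open>infsum\<close>, while the inequalities above use
  integrals over counting measure; both are suprema of finite partial sums.\<close>

lemma infsum_ennreal_eq_nn_integral:
  fixes f :: "'i::countable \<Rightarrow> ennreal"
  shows "infsum f UNIV = (\<integral>\<^sup>+ i. f i \<partial>count_space UNIV)"
proof (rule antisym)
  have "sum f F \<le> (\<integral>\<^sup>+ i. f i \<partial>count_space UNIV)" if "finite F" for F
  proof -
    have "sum f F = (\<integral>\<^sup>+ i. f i \<partial>count_space F)"
      using that by (simp add: nn_integral_count_space_finite)
    also have "\<dots> = (\<integral>\<^sup>+ i. f i * indicator F i \<partial>count_space UNIV)"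
      by (simp add: nn_integral_restrict_space[symmetric] restrict_count_space)
    also have "\<dots> \<le> (\<integral>\<^sup>+ i. f i \<partial>count_space UNIV)"
      by (intro nn_integral_mono) (auto simp: indicator_def)
    finally show ?thesis .
  qed
  then show "infsum f UNIV \<le> (\<integral>\<^sup>+ i. f i \<partial>count_space UNIV)"
    by (subst nonneg_infsum_complete) (auto intro: SUP_least)
  have "(\<Sum>n<N. if n \<in> range (to_nat :: 'i \<Rightarrow> nat) then f (from_nat n) else 0) \<le> infsum f UNIV" for N
  proof -
    let ?A = "{n \<in> {..<N}. n \<in> range (to_nat :: 'i \<Rightarrow> nat)}"
    have "(\<Sum>n<N. if n \<in> range (to_nat :: 'i \<Rightarrow> nat) then f (from_nat n) else 0) = (\<Sum>n\<in>?A. f (from_nat n))"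
      by (rule sum.inter_filter[symmetric]) simp
    also have "\<dots> = sum f (from_nat ` ?A)"
      by (subst sum.reindex) (auto simp: inj_on_def)
    also have "\<dots> \<le> infsum f UNIV"
      by (subst nonneg_infsum_complete) (auto intro!: SUP_upper)
    finally show ?thesis .
  qed
  then show "(\<integral>\<^sup>+ i. f i \<partial>count_space UNIV) \<le> infsum f UNIV"
    unfolding nn_integral_count_space_from_nat suminf_eq_SUP by (intro SUP_least)
qed

lemma Lp_norm_eq_Lq: "Lp_norm p g = Lq lborel p g"
  by (simp add: Lp_norm_def Lq_def nn_integral_completion)

lemma dyadic_cube_mono: "i \<le> k \<Longrightarrow> dyadic_cube i \<subseteq> (dyadic_cube k :: (real ^ 'd) set)"
  unfolding dyadic_cube_def by (intro cube_subset) (auto intro: power_int_increasing)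

lemma shell_dyadic_cube:
  "i \<le> k \<Longrightarrow> shell i \<subseteq> (dyadic_cube k :: (real ^ 'd) set)"
  "k < i \<Longrightarrow> shell i \<inter> (dyadic_cube k :: (real ^ 'd) set) = {}"
  using dyadic_cube_mono[of i k, where 'd = 'd] dyadic_cube_mono[of k "i - 1", where 'd = 'd]
  by (auto simp: shell_def)

text \<open>A shell lies inside a dyadic cube or is disjoint from it, according to the order of the
  indices, so cutting to a rectangle keeps or deletes whole blocks.\<close>

lemma product_morrey_herz_norm_eq:
  fixes g :: "(real ^ 'n) \<times> (real ^ 'm) \<Rightarrow> ennreal"
  assumes "0 < q"
  shows "product_morrey_herz_norm p q \<alpha> lam g = discrete_morrey_herz q \<alpha> lam (block_norm p g)"
proof -
  have herz: "product_herz_norm p q \<alpha> (\<lambda>z. g z * indicator (dyadic_rectangle L1 L2) z)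
      = Lq (count_space UNIV) q (\<lambda>v. dyadic_weight \<alpha> v * block_norm p g v * indicator (quadrant (L1, L2)) v)" for L1 L2
  proof -
    have eq: "(case v of (i, j) \<Rightarrow> ennreal (2 powr (of_int (i + j) * q * \<alpha>)) *
          enn_powr (Lp_norm p (\<lambda>z. g z * indicator (dyadic_rectangle L1 L2) z * indicator (shell i \<times> shell j) z)) q)
        = enn_powr (dyadic_weight \<alpha> v * block_norm p g v * indicator (quadrant (L1, L2)) v) q" for v
    proof -
      obtain i j where v: "v = (i, j)" by (cases v)
      have "(\<lambda>z :: (real ^ 'n) \<times> (real ^ 'm). g z * indicator (dyadic_rectangle L1 L2) z * indicator (shell i \<times> shell j) z)
          = (\<lambda>z. if v \<in> quadrant (L1, L2) then g z * indicator (shell i \<times> shell j) z else 0)"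
        using shell_dyadic_cube(1)[of i L1, where 'd = 'n] shell_dyadic_cube(2)[of L1 i, where 'd = 'n]
          shell_dyadic_cube(1)[of j L2, where 'd = 'm] shell_dyadic_cube(2)[of L2 j, where 'd = 'm]
        by (auto simp: v quadrant_def dyadic_rectangle_def indicator_def fun_eq_iff not_le)
      then have "Lp_norm p (\<lambda>z. g z * indicator (dyadic_rectangle L1 L2) z * indicator (shell i \<times> shell j) z)
          = block_norm p g v * indicator (quadrant (L1, L2)) v"
        by (cases "v \<in> quadrant (L1, L2)") (simp_all add: Lp_norm_eq_Lq block_norm_def v)
      then show ?thesis
        using assms by (simp add: v enn_powr_mult dyadic_weight_def enn_powr_ennreal powr_powr mult_ac)
    qed
    show ?thesis
      unfolding product_herz_norm_def Lq_def infsum_ennreal_eq_nn_integral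
      by (intro arg_cong[where f = "\<lambda>x. enn_powr x (1 / q)"] nn_integral_cong eq)
  qed
  have "dyadic_weight (- lam) (L1, L2) = ennreal (2 powr (- of_int (L1 + L2) * lam))" for L1 L2
    by (simp add: dyadic_weight_def algebra_simps)
  then show ?thesis
    unfolding product_morrey_herz_norm_def discrete_morrey_herz_def
    by (intro SUP_cong refl) (auto simp: herz)
qed

lemma discrete_morrey_herz_mono:
  "0 < q \<Longrightarrow> (\<And>v. A v \<le> B v) \<Longrightarrow> discrete_morrey_herz q \<alpha> lam A \<le> discrete_morrey_herz q \<alpha> lam B"
  unfolding discrete_morrey_herz_def
  by (intro SUP_mono' mult_left_mono Lq_mono mult_right_mono) auto

lemma discrete_morrey_herz_cmult:
  assumes "0 < q"
  shows "discrete_morrey_herz q \<alpha> lam (\<lambda>v. c * A v) = c * discrete_morrey_herz q \<alpha> lam A"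
proof -
  have "Lq (count_space UNIV) q (\<lambda>v. dyadic_weight \<alpha> v * (c * A v) * indicator (quadrant L) v)
      = c * Lq (count_space UNIV) q (\<lambda>v. dyadic_weight \<alpha> v * A v * indicator (quadrant L) v)" for L
    using assms by (subst Lq_cmult[symmetric]) (auto simp: mult_ac)
  then show ?thesis
    unfolding discrete_morrey_herz_def by (simp add: SUP_mult_left_ennreal mult_ac)
qed

text \<open>In the supremum take the quadrant with corner \<open>v\<close>, and in the ell-q norm
  keep only the entry at \<open>v\<close>.\<close>

lemma le_discrete_morrey_herz:
  assumes "0 < q"
  shows "dyadic_weight (\<alpha> - lam) v * A v \<le> discrete_morrey_herz q \<alpha> lam A"
proof -
  let ?F = "\<lambda>w. dyadic_weight \<alpha> w * A w * indicator (quadrant v) w"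
  have "enn_powr (?F v) q \<le> (\<integral>\<^sup>+ w. enn_powr (?F w) q \<partial>count_space UNIV)"
    by (rule nn_integral_ge_point) simp
  then have "?F v \<le> Lq (count_space UNIV) q ?F"
    using assms by (simp add: Lq_def enn_powr_le_iff)
  then have "dyadic_weight (- lam) v * ?F v \<le> dyadic_weight (- lam) v * Lq (count_space UNIV) q ?F"
    by (rule mult_left_mono) simp
  also have "\<dots> \<le> discrete_morrey_herz q \<alpha> lam A"
    unfolding discrete_morrey_herz_def by (rule SUP_upper) simp
  also have "dyadic_weight (- lam) v * ?F v = dyadic_weight (\<alpha> - lam) v * A v"
    by (simp add: quadrant_def dyadic_weight_mult[symmetric] mem_Times_iff) (simp add: dyadic_weight_mult mult_ac flip: mult.assoc)
  finally show ?thesis .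
qed

lemma AE_off_axes: "AE z in lborel. fst (z :: (real ^ 'n) \<times> (real ^ 'm)) \<noteq> 0 \<and> snd z \<noteq> 0"
proof -
  have "emeasure (lborel :: ((real ^ 'n) \<times> (real ^ 'm)) measure) ({0} \<times> UNIV) = 0"
    by (simp add: lborel_prod[symmetric] lborel.emeasure_pair_measure_Times)
  moreover have "emeasure (lborel :: ((real ^ 'n) \<times> (real ^ 'm)) measure) (UNIV \<times> {0}) = 0"
    by (simp add: lborel_prod[symmetric] lborel.emeasure_pair_measure_Times)
  moreover have "{0} \<times> (UNIV :: (real ^ 'm) set) \<in> sets (borel :: ((real ^ 'n) \<times> (real ^ 'm)) measure)"
    "(UNIV :: (real ^ 'n) set) \<times> {0} \<in> sets (borel :: ((real ^ 'n) \<times> (real ^ 'm)) measure)"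
    by (auto intro!: borel_closed closed_Times)
  ultimately have "({0} \<times> UNIV) \<union> (UNIV \<times> {0}) \<in> null_sets (lborel :: ((real ^ 'n) \<times> (real ^ 'm)) measure)"
    by (intro null_sets.Un) (auto simp: null_sets_def)
  then show ?thesis
    by (rule AE_I') auto
qed

text \<open>Supplies Borel sections for the one-variable operators. Setting the function to zero on
  the coordinate subspaces changes it only on a null set.\<close>

lemma borel_representative:
  fixes f :: "(real ^ 'n) \<times> (real ^ 'm) \<Rightarrow> complex"
  assumes "f \<in> borel_measurable lebesgue"
  obtains g where "g \<in> borel_measurable borel" "\<And>z. fst z = 0 \<or> snd z = 0 \<Longrightarrow> g z = 0"
    "AE z in lborel. modulus f z = g z"
proof -
  have "modulus f \<in> borel_measurable (completion lborel)"
    using assms unfolding modulus_def[abs_def] by measurable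
  from completion_ex_borel_measurable[OF this]
  obtain g' where "g' \<in> borel_measurable lborel" and g': "AE z in lborel. modulus f z = g' z"
    by (elim bexE)
  then have [measurable]: "g' \<in> borel_measurable borel" by simp
  let ?O = "{z :: (real ^ 'n) \<times> (real ^ 'm). fst z \<noteq> 0 \<and> snd z \<noteq> 0}"
  have "open ?O"
    by (intro open_Collect_conj open_Collect_neq continuous_intros)
  then have [measurable]: "?O \<in> sets borel" by simp
  show ?thesis
  proof (rule that[of "\<lambda>z. g' z * indicator ?O z"])
    show "AE z in lborel. modulus f z = g' z * indicator ?O z"
      using g' AE_off_axes by eventually_elim simp
    show "(\<lambda>z. g' z * indicator ?O z) \<in> borel_measurable borel" by measurable
  qed auto
qed

lemma ennreal_divide_le_iff:
  fixes a b c :: ennreal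
  assumes "c \<noteq> 0" "c \<noteq> top"
  shows "a / c \<le> b \<longleftrightarrow> a \<le> b * c"
proof -
  have "a / c * c = a"
    using assms by (simp add: ennreal_divide_times ennreal_divide_self less_top[symmetric] zero_less_iff_neq_zero)
  then show ?thesis
    using assms mult_right_mono[of "a / c" b c] divide_right_mono_ennreal[of a "b * c" c]
    by (auto simp: mult_divide_eq_ennreal)
qed

text \<open>For fixed y' the integral over the first cube is bounded by its volume times
  \<open>max1 g\<close> at the point (\<open>fst z\<close>, y'); averaging this over the second cube
  brings in \<open>max2\<close>. Each step costs the factor for passing to rational cubes. The bound
  holds at every \<open>z\<close>, since averages of \<open>f\<close> see only its class modulo null
  sets.\<close>

lemma strong_maximal_le_iterated:
  fixes f :: "(real ^ 'n) \<times> (real ^ 'm) \<Rightarrow> complex"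
  assumes [measurable]: "g \<in> borel_measurable borel" and ae: "AE z in lborel. modulus f z = g z"
  shows "strong_maximal f z \<le> 2 ^ (CARD('n) + CARD('m)) * max2 (max1 g) z"
  unfolding strong_maximal_def
proof (rule SUP_least)
  fix R :: "((real ^ 'n) \<times> (real ^ 'm)) set"
  assume "R \<in> {R \<in> rectangles. z \<in> R}"
  then obtain x r y s where R: "R = cube x r \<times> cube y s" "0 < r" "0 < s" "fst z \<in> cube x r" "snd z \<in> cube y s"
    by (auto simp: rectangles_def)
  let ?Q = "cube x r" and ?P = "cube y s"
  have [measurable]: "?Q \<times> ?P \<in> sets borel" by (intro borel_open open_Times) auto
  have [measurable]: "max1 g \<in> borel_measurable borel" by measurable
  have Q: "emeasure lborel ?Q \<noteq> 0" "emeasure lborel ?Q \<noteq> top" using R(2) by (auto simp: emeasure_cube)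
  have P: "emeasure lborel ?P \<noteq> 0" "emeasure lborel ?P \<noteq> top" using R(3) by (auto simp: emeasure_cube)
  have vol: "emeasure lebesgue R = emeasure lborel ?Q * emeasure lborel ?P"
    by (simp add: R(1) lborel_prod[symmetric] lborel.emeasure_pair_measure_Times)
  have inner: "(\<integral>\<^sup>+ x'. g (x', y') * indicator ?Q x' \<partial>lborel)
      \<le> 2 ^ CARD('n) * emeasure lborel ?Q * max1 g (fst z, y')" for y'
  proof -
    have "(\<integral>\<^sup>+ x'. g (x', y') * indicator ?Q x' \<partial>lborel) / emeasure lborel ?Q \<le> 2 ^ CARD('n) * max1 g (fst z, y')"
      unfolding max1_def fst_conv snd_conv by (rule average_le_cube_max'[OF R(2,4)])
    then show ?thesis
      using Q by (subst (asm) ennreal_divide_le_iff) (auto simp: mult_ac)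
  qed
  have outer: "(\<integral>\<^sup>+ y'. max1 g (fst z, y') * indicator ?P y' \<partial>lborel)
      \<le> 2 ^ CARD('m) * emeasure lborel ?P * max2 (max1 g) z"
  proof -
    have "(\<integral>\<^sup>+ y'. max1 g (fst z, y') * indicator ?P y' \<partial>lborel) / emeasure lborel ?P \<le> 2 ^ CARD('m) * max2 (max1 g) z"
      unfolding max2_def by (rule average_le_cube_max'[OF R(3,5)])
    then show ?thesis
      using P by (subst (asm) ennreal_divide_le_iff) (auto simp: mult_ac)
  qed
  have [measurable]: "(\<lambda>y'. max1 g (fst z, y')) \<in> borel_measurable borel" by (intro section_measurable) measurable
  have "(\<integral>\<^sup>+ w. modulus f w * indicator R w \<partial>lebesgue) = (\<integral>\<^sup>+ w. g w * indicator (?Q \<times> ?P) w \<partial>lborel)"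
    unfolding nn_integral_completion R(1) using ae by (intro nn_integral_cong_AE) auto
  also have "\<dots> = (\<integral>\<^sup>+ y'. (\<integral>\<^sup>+ x'. g (x', y') * indicator (?Q \<times> ?P) (x', y') \<partial>lborel) \<partial>lborel)"
    by (rule Tonelli_lborel(2)) measurable
  also have "\<dots> = (\<integral>\<^sup>+ y'. (\<integral>\<^sup>+ x'. g (x', y') * indicator ?Q x' \<partial>lborel) * indicator ?P y' \<partial>lborel)"
    by (intro nn_integral_cong) (auto simp: indicator_def)
  also have "\<dots> \<le> (\<integral>\<^sup>+ y'. 2 ^ CARD('n) * emeasure lborel ?Q * (max1 g (fst z, y') * indicator ?P y') \<partial>lborel)"
    unfolding mult.assoc[symmetric] by (intro nn_integral_mono mult_right_mono inner[unfolded mult.assoc[symmetric]]) auto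
  also have "\<dots> = 2 ^ CARD('n) * emeasure lborel ?Q * (\<integral>\<^sup>+ y'. max1 g (fst z, y') * indicator ?P y' \<partial>lborel)"
    by (rule nn_integral_cmult) measurable
  also have "\<dots> \<le> 2 ^ CARD('n) * emeasure lborel ?Q * (2 ^ CARD('m) * emeasure lborel ?P * max2 (max1 g) z)"
    by (rule mult_left_mono[OF outer]) simp
  also have "\<dots> = emeasure lebesgue R * (2 ^ (CARD('n) + CARD('m)) * max2 (max1 g) z)"
    by (simp add: vol power_add mult_ac)
  finally show "(\<integral>\<^sup>+ w. modulus f w * indicator R w \<partial>lebesgue) / emeasure lebesgue R
      \<le> 2 ^ (CARD('n) + CARD('m)) * max2 (max1 g) z"
    using P Q by (subst ennreal_divide_le_iff) (auto simp: vol ennreal_mult_eq_top_iff mult_ac)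
qed

text \<open>Rectangles are open, so each strict superlevel set is a union of open sets: the function
  is lower semicontinuous.\<close>

lemma strong_maximal_measurable:
  fixes f :: "(real ^ 'n) \<times> (real ^ 'm) \<Rightarrow> complex"
  shows "strong_maximal f \<in> borel_measurable borel"
proof (rule borel_measurableI_greater)
  fix t
  have "{z. t < strong_maximal f z} =
      \<Union>{R \<in> rectangles. t < (\<integral>\<^sup>+ w. modulus f w * indicator R w \<partial>lebesgue) / emeasure lebesgue R}"
    by (auto simp: strong_maximal_def less_SUP_iff)
  moreover have "open \<dots>"
    by (intro open_Union) (auto simp: rectangles_def intro!: open_Times)
  ultimately show "{z \<in> space borel. t < strong_maximal f z} \<in> sets borel"
    by simp
qed

lemma block_norm_mono: "0 < p \<Longrightarrow> (\<And>z. f z \<le> g z) \<Longrightarrow> block_norm p f v \<le> block_norm p g v"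
  unfolding block_norm_def by (intro Lq_mono mult_right_mono) auto

theorem vector_strong_maximal:
  fixes p0 p q \<alpha> lam :: real
  assumes p: "1 < p0" "p0 < p" "1 \<le> q" "0 < lam"
    and n: "lam < \<alpha> + real CARD('n) / p" "\<alpha> < real CARD('n) * (1 / p0 - 1 / p)"
    and m: "lam < \<alpha> + real CARD('m) / p" "\<alpha> < real CARD('m) * (1 / p0 - 1 / p)"
  shows "\<exists>C > 0. \<forall>f :: nat \<Rightarrow> (real ^ 'n) \<times> (real ^ 'm) \<Rightarrow> complex. (\<forall>i. f i \<in> borel_measurable lebesgue) \<longrightarrow>
      product_morrey_herz_norm p q \<alpha> lam (lp_sum p0 (\<lambda>i. strong_maximal (f i)))
        \<le> ennreal C * product_morrey_herz_norm p q \<alpha> lam (lp_sum p0 (\<lambda>i. modulus (f i)))"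
proof -
  obtain D :: ennreal where D: "D < top" and vec:
    "\<And>(g :: nat \<Rightarrow> (real ^ 'n) \<times> (real ^ 'm) \<Rightarrow> ennreal).
      (\<And>\<nu>. g \<nu> \<in> borel_measurable borel) \<Longrightarrow> (\<And>\<nu> z. fst z = 0 \<or> snd z = 0 \<Longrightarrow> g \<nu> z = 0) \<Longrightarrow>
      discrete_morrey_herz q \<alpha> lam (block_norm p (lp_sum p0 (\<lambda>\<nu>. max2 (max1 (g \<nu>)))))
        \<le> D * discrete_morrey_herz q \<alpha> lam (block_norm p (lp_sum p0 g))"
    by (rule vector_maximal_morrey_herz[OF assms]) blast
  let ?c = "2 ^ (CARD('n) + CARD('m)) :: ennreal"
  \<comment> \<open>The summand 1 makes the real constant positive even if the extended one is
    zero.\<close>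
  define C where "C = enn2real (?c * D) + 1"
  have CD: "?c * D \<le> ennreal C"
  proof -
    have "?c * D < top" using D by (simp add: ennreal_mult_less_top power_less_top_ennreal)
    then have "?c * D = ennreal (enn2real (?c * D))" by simp
    also have "\<dots> \<le> ennreal C" unfolding C_def by (intro ennreal_leI) simp
    finally show ?thesis .
  qed
  show ?thesis
  proof (intro exI[of _ C] conjI allI impI)
    show "0 < C" unfolding C_def by (intro add_nonneg_pos) auto
    fix f :: "nat \<Rightarrow> (real ^ 'n) \<times> (real ^ 'm) \<Rightarrow> complex"
    assume f: "\<forall>i. f i \<in> borel_measurable lebesgue"
    have "\<forall>i. \<exists>g. g \<in> borel_measurable borel \<and> (\<forall>z. fst z = 0 \<or> snd z = 0 \<longrightarrow> g z = 0) \<and>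
        (AE z in lborel. modulus (f i) z = g z)"
    proof
      fix i
      obtain g where "g \<in> borel_measurable borel" "\<And>z. fst z = 0 \<or> snd z = 0 \<Longrightarrow> g z = 0"
        "AE z in lborel. modulus (f i) z = g z"
        by (rule borel_representative[OF f[rule_format, of i]]) (rule that)
      then show "\<exists>g. g \<in> borel_measurable borel \<and> (\<forall>z. fst z = 0 \<or> snd z = 0 \<longrightarrow> g z = 0) \<and>
        (AE z in lborel. modulus (f i) z = g z)" by (intro exI[of _ g] conjI allI impI)
    qed
    from choice[OF this] obtain g where rep: "\<forall>i. g i \<in> borel_measurable borel \<and> (\<forall>z. fst z = 0 \<or> snd z = 0 \<longrightarrow> g i z = 0) \<and>
        (AE z in lborel. modulus (f i) z = g i z)"
      by (elim exE)
    then have g [measurable]: "g i \<in> borel_measurable borel"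
      and axes: "fst z = 0 \<or> snd z = 0 \<Longrightarrow> g i z = 0"
      and ae: "AE z in lborel. modulus (f i) z = g i z" for i z
      by (simp_all only:)
    let ?V = "lp_sum p0 (\<lambda>i. max2 (max1 (g i)))"
    have [measurable]: "?V \<in> borel_measurable borel" by measurable
    have pt: "lp_sum p0 (\<lambda>i. strong_maximal (f i)) z \<le> ?c * ?V z" for z
    proof -
      have "lp_sum p0 (\<lambda>i. strong_maximal (f i)) z \<le> Lq (count_space UNIV) p0 (\<lambda>i. ?c * max2 (max1 (g i)) z)"
        unfolding lp_sum_eq_Lq using p by (intro Lq_mono strong_maximal_le_iterated g ae) auto
      also have "\<dots> = ?c * ?V z"
        unfolding lp_sum_eq_Lq using p by (intro Lq_cmult) auto
      finally show ?thesis .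
    qed
    have "block_norm p (lp_sum p0 (\<lambda>i. strong_maximal (f i))) v \<le> ?c * block_norm p ?V v" for v
    proof -
      have "block_norm p (lp_sum p0 (\<lambda>i. strong_maximal (f i))) v \<le> block_norm p (\<lambda>z. ?c * ?V z) v"
        using p by (intro block_norm_mono pt) auto
      also have "\<dots> = ?c * block_norm p ?V v"
        unfolding block_norm_def mult.assoc using p by (intro Lq_cmult) auto
      finally show ?thesis .
    qed
    then have "discrete_morrey_herz q \<alpha> lam (block_norm p (lp_sum p0 (\<lambda>i. strong_maximal (f i))))
        \<le> discrete_morrey_herz q \<alpha> lam (\<lambda>v. ?c * block_norm p ?V v)"
      using p by (intro discrete_morrey_herz_mono) auto
    also have "\<dots> = ?c * discrete_morrey_herz q \<alpha> lam (block_norm p ?V)"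
      using p by (intro discrete_morrey_herz_cmult) auto
    also have "\<dots> \<le> ?c * (D * discrete_morrey_herz q \<alpha> lam (block_norm p (lp_sum p0 g)))"
      by (intro mult_left_mono vec g axes) auto
    also have "block_norm p (lp_sum p0 g) = block_norm p (lp_sum p0 (\<lambda>i. modulus (f i)))"
    proof
      fix v
      \<comment> \<open>Countably many exceptional null sets are merged into one, so that the whole
        ell-p0 sum is unchanged almost everywhere.\<close>
      have "AE z in lborel. \<forall>i. modulus (f i) z = g i z" using ae by (simp add: AE_all_countable)
      then have "AE z in lborel. lp_sum p0 g z * indicator (shell (fst v) \<times> shell (snd v)) z
          = lp_sum p0 (\<lambda>i. modulus (f i)) z * indicator (shell (fst v) \<times> shell (snd v)) z"
        by eventually_elim (simp add: lp_sum_def)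
      then show "block_norm p (lp_sum p0 g) v = block_norm p (lp_sum p0 (\<lambda>i. modulus (f i))) v"
        unfolding block_norm_def by (rule Lq_cong_AE)
    qed
    also have "?c * (D * discrete_morrey_herz q \<alpha> lam (block_norm p (lp_sum p0 (\<lambda>i. modulus (f i)))))
        \<le> ennreal C * discrete_morrey_herz q \<alpha> lam (block_norm p (lp_sum p0 (\<lambda>i. modulus (f i))))"
      using CD unfolding mult.assoc[symmetric] by (intro mult_right_mono) auto
    finally show "product_morrey_herz_norm p q \<alpha> lam (lp_sum p0 (\<lambda>i. strong_maximal (f i)))
        \<le> ennreal C * product_morrey_herz_norm p q \<alpha> lam (lp_sum p0 (\<lambda>i. modulus (f i)))"
      using p by (simp add: product_morrey_herz_norm_eq)
  qed
qed

section \<open>Membership of the maximal function in the space\<close>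

lemma compact_subset_finite_shells:
  fixes K :: "(real ^ 'd) set"
  assumes "compact K" "0 \<notin> K"
  obtains I where "finite I" "K \<subseteq> (\<Union>i\<in>I. shell i)"
proof -
  obtain B where B: "0 < B" "\<And>x. x \<in> K \<Longrightarrow> norm x \<le> B"
    using compact_imp_bounded[OF assms(1)] by (auto simp: bounded_pos)
  have "open (- K)" using assms(1) by (intro open_Compl compact_imp_closed)
  then obtain e where e: "0 < e" "ball 0 e \<subseteq> - K"
    using assms(2) by (auto elim!: openE)
  \<comment> \<open>On shell i some coordinate is at least 2^(i-2), which gives i - 2 \<le> log 2 B.
    The sum of all coordinates is at most d 2^(i-1), and it dominates the norm, so e / d \<le>
    2^(i-1) bounds i from below.\<close>
  define a where "a = \<lfloor>log 2 (e / real CARD('d))\<rfloor>"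
  define b where "b = \<lceil>log 2 B\<rceil> + 2"
  have "i \<in> {a..b}" if xK: "x \<in> K" and xs: "x \<in> shell i" for x i
  proof -
    have x: "e \<le> norm x" "norm x \<le> B" using e xK B(2)[OF xK] by (auto simp: subset_eq not_less)
    obtain j where j: "2 powr (of_int i - 2) \<le> \<bar>x $ j\<bar>" using xs by (auto simp: mem_shell_iff)
    have "2 powr (of_int i - 2) \<le> B" using j x(2) component_le_norm_cart[of x j] by linarith
    then have "of_int i - 2 \<le> log 2 B" using B(1) by (simp add: le_log_iff)
    then have "i \<le> b" unfolding b_def by linarith
    have "norm x \<le> (\<Sum>j\<in>UNIV. \<bar>x $ j\<bar>)" by (rule norm_le_l1_cart)
    also have "\<dots> \<le> (\<Sum>j\<in>(UNIV :: 'd set). 2 powr (of_int i - 1))"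
      using xs by (intro sum_mono) (auto simp: mem_shell_iff less_imp_le)
    also have "\<dots> = real CARD('d) * 2 powr (of_int i - 1)" by simp
    finally have "e / real CARD('d) \<le> 2 powr (of_int i - 1)"
      using x(1) by (simp add: divide_le_eq mult.commute)
    then have "log 2 (e / real CARD('d)) \<le> of_int i - 1" using e(1) by (simp add: log_le_iff)
    then have "a \<le> i" unfolding a_def by linarith
    then show ?thesis using \<open>i \<le> b\<close> by simp
  qed
  then have "K \<subseteq> (\<Union>i\<in>{a..b}. shell i)"
    using assms(2) shell_exists by (metis UN_I subsetI)
  then show ?thesis by (intro that[of "{a..b}"]) auto
qed

lemma block_norm_finite:
  assumes "0 < q" "product_morrey_herz_norm p q \<alpha> lam S < top"
  shows "block_norm p S v < top"
proof -
  have "dyadic_weight (\<alpha> - lam) v * block_norm p S v < top"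
    using le_discrete_morrey_herz[OF assms(1), of \<alpha> lam v "block_norm p S"] assms
    by (simp add: product_morrey_herz_norm_eq)
  then show ?thesis by (auto simp: ennreal_mult_less_top dyadic_weight_def)
qed

text \<open>A finite norm forces a finite L^p norm on every block. Countably many blocks cover
  everything off the coordinate subspaces, which gives finiteness almost everywhere; a compact set
  avoiding those subspaces has projections avoiding 0 and meets only finitely many blocks, which
  gives local integrability.\<close>

lemma ext_in_product_morrey_herzI:
  fixes S :: "(real ^ 'n) \<times> (real ^ 'm) \<Rightarrow> ennreal"
  assumes pq: "0 < p" "0 < q"
    and [measurable]: "S \<in> borel_measurable borel" and fin: "product_morrey_herz_norm p q \<alpha> lam S < top"
  shows "ext_in_product_morrey_herz p q \<alpha> lam S"
proof -
  let ?A = "\<lambda>v :: int \<times> int. (shell (fst v) :: (real ^ 'n) set) \<times> (shell (snd v) :: (real ^ 'm) set)"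
  let ?F = "\<lambda>z. complex_of_real (enn2real (S z))"
  have mod: "modulus ?F z \<le> S z" for z
    by (cases "S z") (auto simp: modulus_def)
  have block: "(\<integral>\<^sup>+ z. enn_powr (S z) p * indicator (?A v) z \<partial>lborel) < top" for v
  proof -
    have "(\<integral>\<^sup>+ z. enn_powr (S z) p * indicator (?A v) z \<partial>lborel) = enn_powr (block_norm p S v) p"
      unfolding block_norm_def using pq by (subst Lq_powr) (auto intro!: nn_integral_cong simp: indicator_def)
    then show ?thesis using block_norm_finite[OF pq(2) fin, of v] by simp
  qed
  have "AE z in lborel. \<forall>v. enn_powr (S z) p * indicator (?A v) z \<noteq> \<infinity>"
    unfolding AE_all_countable using block by (intro allI nn_integral_noteq_infinite) (auto simp: less_top)
  then have "AE z in lborel. S z < \<infinity>"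
    using AE_off_axes
  proof eventually_elim
    case (elim z)
    then obtain i j where "fst z \<in> shell i" "snd z \<in> shell j"
      using shell_exists[of "fst z"] shell_exists[of "snd z"] by auto
    then have "z \<in> ?A (i, j)" by (simp add: mem_Times_iff)
    then have "enn_powr (S z) p \<noteq> top" using elim(1)[rule_format, of "(i, j)"] by simp
    then show ?case by (simp add: less_top[symmetric])
  qed
  then have ae: "AE z in lebesgue. S z < \<infinity>" by (rule AE_completion)
  have loc: "Lp_norm p (\<lambda>z. modulus ?F z * indicator K z) < \<infinity>"
    if K: "compact K" "K \<subseteq> (UNIV - {0}) \<times> (UNIV - {0})" for K
  proof -
    have K1: "compact (fst ` K)" "0 \<notin> fst ` K" and K2: "compact (snd ` K)" "0 \<notin> snd ` K"
      using K by (auto intro!: compact_continuous_image continuous_intros)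
    obtain I where I: "finite I" "fst ` K \<subseteq> (\<Union>i\<in>I. shell i)" by (rule compact_subset_finite_shells[OF K1])
    obtain J where J: "finite J" "snd ` K \<subseteq> (\<Union>j\<in>J. shell j)" by (rule compact_subset_finite_shells[OF K2])
    have "enn_powr (Lp_norm p (\<lambda>z. modulus ?F z * indicator K z)) p
        \<le> (\<integral>\<^sup>+ z. (\<Sum>v\<in>I \<times> J. enn_powr (S z) p * indicator (?A v) z) \<partial>lborel)"
      unfolding Lp_norm_eq_Lq Lq_powr[OF pq(1)]
    proof (intro nn_integral_mono)
      fix z
      show "enn_powr (modulus ?F z * indicator K z) p \<le> (\<Sum>v\<in>I \<times> J. enn_powr (S z) p * indicator (?A v) z)"
      proof (cases "z \<in> K")
        case True
        then obtain i j where ij: "i \<in> I" "j \<in> J" "z \<in> ?A (i, j)"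
          using I J by (force simp: mem_Times_iff)
        have "enn_powr (modulus ?F z * indicator K z) p \<le> enn_powr (S z) p"
          using True mod[of z] pq by (intro enn_powr_mono) auto
        also have "\<dots> = enn_powr (S z) p * indicator (?A (i, j)) z" using ij by simp
        also have "\<dots> \<le> (\<Sum>v\<in>I \<times> J. enn_powr (S z) p * indicator (?A v) z)"
          using ij I J by (intro member_le_sum) auto
        finally show ?thesis .
      qed simp
    qed
    also have "\<dots> = (\<Sum>v\<in>I \<times> J. \<integral>\<^sup>+ z. enn_powr (S z) p * indicator (?A v) z \<partial>lborel)"
      by (rule nn_integral_sum) measurable
    also have "\<dots> < top" using block I J by (simp add: less_top[symmetric])
    finally show ?thesis by simp
  qed
  have "product_morrey_herz_norm p q \<alpha> lam (modulus ?F) \<le> product_morrey_herz_norm p q \<alpha> lam S"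
    using pq by (simp add: product_morrey_herz_norm_eq discrete_morrey_herz_mono block_norm_mono mod)
  also have "\<dots> < \<infinity>" using fin by simp
  finally have "product_morrey_herz_norm p q \<alpha> lam (modulus ?F) < \<infinity>" .
  moreover have "?F \<in> borel_measurable lebesgue"
    by (rule measurable_completion) measurable
  ultimately show ?thesis
    unfolding ext_in_product_morrey_herz_def product_morrey_herz_def Lp_loc_def using ae loc by simp
qed

lemma lp_sum_single:
  assumes "0 < p0"
  shows "lp_sum p0 (\<lambda>i :: nat. if i = 0 then f else (\<lambda>z. 0)) = f"
proof
  fix z
  have "(\<Sum>i::nat. enn_powr ((if i = 0 then f else (\<lambda>z. 0)) z) p0) = (\<Sum>i\<in>{0::nat}. enn_powr ((if i = 0 then f else (\<lambda>z. 0)) z) p0)"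
    by (intro suminf_finite) auto
  then show "lp_sum p0 (\<lambda>i :: nat. if i = 0 then f else (\<lambda>z. 0)) z = f z"
    using assms by (simp add: lp_sum_def)
qed

lemma strong_maximal_0 [simp]: "strong_maximal (\<lambda>z. 0) z = 0"
proof -
  have "strong_maximal (\<lambda>z. 0) z \<le> 0"
    unfolding strong_maximal_def by (intro SUP_least) (simp add: modulus_def)
  then show ?thesis by simp
qed

theorem theorem5p1:
  fixes \<alpha> p0 p q lam n m :: real
  defines "n \<equiv> real CARD('n::finite)" and "m \<equiv> real CARD('m::finite)"
  assumes "1 < p0" and "p0 < p" and "p0 < q"
    and "0 < lam" and "lam < min (\<alpha> + n / p) (\<alpha> + m / p)"
    and "max (- n / p) (- m / p) < \<alpha>"
    and "\<alpha> < min (n * (1 / p0 - 1 / p)) (m * (1 / p0 - 1 / p))"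
  shows "(\<exists>C > 0. \<forall>f \<in> (product_morrey_herz p q \<alpha> lam :: ((real ^ 'n) \<times> (real ^ 'm) \<Rightarrow> complex) set).
            ext_in_product_morrey_herz p q \<alpha> lam (strong_maximal f) \<and>
            product_morrey_herz_norm p q \<alpha> lam (strong_maximal f)
              \<le> ennreal C * product_morrey_herz_norm p q \<alpha> lam (modulus f))
       \<and> (\<exists>C > 0. \<forall>f :: nat \<Rightarrow> (real ^ 'n) \<times> (real ^ 'm) \<Rightarrow> complex.
            (\<forall>i. f i \<in> product_morrey_herz p q \<alpha> lam) \<longrightarrow>
            product_morrey_herz_norm p q \<alpha> lam (lp_sum p0 (\<lambda>i. strong_maximal (f i)))
              \<le> ennreal C * product_morrey_herz_norm p q \<alpha> lam (lp_sum p0 (\<lambda>i. modulus (f i))))"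
proof -
  have pq: "0 < p" "0 < q" "1 \<le> q" "0 < p0" using assms by auto
  have "\<exists>C > 0. \<forall>f :: nat \<Rightarrow> (real ^ 'n) \<times> (real ^ 'm) \<Rightarrow> complex. (\<forall>i. f i \<in> borel_measurable lebesgue) \<longrightarrow>
      product_morrey_herz_norm p q \<alpha> lam (lp_sum p0 (\<lambda>i. strong_maximal (f i)))
        \<le> ennreal C * product_morrey_herz_norm p q \<alpha> lam (lp_sum p0 (\<lambda>i. modulus (f i)))"
    using assms by (intro vector_strong_maximal) auto
  then obtain C :: real where C: "0 < C" and bound:
    "\<And>f :: nat \<Rightarrow> (real ^ 'n) \<times> (real ^ 'm) \<Rightarrow> complex. \<forall>i. f i \<in> borel_measurable lebesgue \<Longrightarrow>
      product_morrey_herz_norm p q \<alpha> lam (lp_sum p0 (\<lambda>i. strong_maximal (f i)))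
        \<le> ennreal C * product_morrey_herz_norm p q \<alpha> lam (lp_sum p0 (\<lambda>i. modulus (f i)))"
    by blast
  have scalar: "ext_in_product_morrey_herz p q \<alpha> lam (strong_maximal f) \<and>
      product_morrey_herz_norm p q \<alpha> lam (strong_maximal f) \<le> ennreal C * product_morrey_herz_norm p q \<alpha> lam (modulus f)"
    if f: "f \<in> product_morrey_herz p q \<alpha> lam" for f :: "(real ^ 'n) \<times> (real ^ 'm) \<Rightarrow> complex"
  proof -
    \<comment> \<open>The scalar bound is the vector bound for the sequence f, 0, 0, ..., with the
      same constant.\<close>
    let ?f = "\<lambda>i :: nat. if i = 0 then f else (\<lambda>z. 0)"
    have f': "f \<in> borel_measurable lebesgue" "product_morrey_herz_norm p q \<alpha> lam (modulus f) < top"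
      using f by (auto simp: product_morrey_herz_def Lp_loc_def)
    have "strong_maximal (?f i) = (if i = 0 then strong_maximal f else (\<lambda>z. 0))" for i
      by (auto simp: fun_eq_iff)
    moreover have "modulus (?f i) = (if i = 0 then modulus f else (\<lambda>z. 0))" for i
      by (auto simp: fun_eq_iff modulus_def)
    ultimately have le: "product_morrey_herz_norm p q \<alpha> lam (strong_maximal f) \<le> ennreal C * product_morrey_herz_norm p q \<alpha> lam (modulus f)"
      using bound[of ?f] f' by (simp add: lp_sum_single[OF pq(4)])
    also have "\<dots> < top" using f' by (simp add: ennreal_mult_less_top)
    finally have "ext_in_product_morrey_herz p q \<alpha> lam (strong_maximal f)"
      using pq by (intro ext_in_product_morrey_herzI strong_maximal_measurable) auto
    with le show ?thesis by simp
  qed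
  show ?thesis
  proof
    show "\<exists>C > 0. \<forall>f \<in> (product_morrey_herz p q \<alpha> lam :: ((real ^ 'n) \<times> (real ^ 'm) \<Rightarrow> complex) set).
            ext_in_product_morrey_herz p q \<alpha> lam (strong_maximal f) \<and>
            product_morrey_herz_norm p q \<alpha> lam (strong_maximal f)
              \<le> ennreal C * product_morrey_herz_norm p q \<alpha> lam (modulus f)"
      using C scalar by (intro exI[of _ C]) simp
    show "\<exists>C > 0. \<forall>f :: nat \<Rightarrow> (real ^ 'n) \<times> (real ^ 'm) \<Rightarrow> complex.
            (\<forall>i. f i \<in> product_morrey_herz p q \<alpha> lam) \<longrightarrow>
            product_morrey_herz_norm p q \<alpha> lam (lp_sum p0 (\<lambda>i. strong_maximal (f i)))
              \<le> ennreal C * product_morrey_herz_norm p q \<alpha> lam (lp_sum p0 (\<lambda>i. modulus (f i)))"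
      using C bound by (intro exI[of _ C]) (simp add: product_morrey_herz_def Lp_loc_def)
  qed
qed

end
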